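(* Let $L>0$, $I_L=(0,L)$, let $\theta,\phi\in BV(I_L)$ with $\theta$ strictly increasing, and let $$\Omega(s)=\begin{pmatrix}0&\theta(s)&0\\-\theta(s)&0&\phi(s)\\0&-\phi(s)&0\end{pmatrix}.$$ Assume that for every $s$ in the jump set $S(\Omega)$ the jumps $d(s)=\theta(s^+)-\theta(s^-)$, $\mathfrak t(s)=\phi(s^+)-\phi(s^-)$ satisfy $0<\sqrt{d(s)^2+\mathfrak t(s)^2}<\pi$. For $n\in\mathbb N^+$ let $\mathbf c_n:[0,L]\to\mathbb R^3$ be the approximating curve defined in the context, obtained by retaining only the finitely many jump points in $S_n(\Omega)=\{s\in S(\Omega):|D^J\Omega|(\{s\})>1/n\}$. Then the sequence $\{\mathbf c_n\}$ converges uniformly to a rectifiable curve $\mathbf c$ of length $L$ and with finite total curvature and total absolute torsion.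
   Context: Notation. For a BV function $u$ on $I_L$: $u(s^\pm)$ one-sided limits, $u(0)=u(0^+)$, $S(u)$ the set of $s$ with $u(s^-)\neq u(s^+)$, $Du=\bar Du+D^Ju$ with $D^Ju$ the jump (atomic) part and $\bar Du$ the diffuse part (absolutely continuous plus Cantor). $\mathbb J_1=\begin{pmatrix}0&0&0\\0&0&-1\\0&1&0\end{pmatrix}$, $\mathbb J_3=\begin{pmatrix}0&-1&0\\1&0&0\\0&0&0\end{pmatrix}$, $\mathbf e_1=(1,0,0)^\top$. Matrices carry the Frobenius norm. The curves $\mathbf c_n$. Let $D^{at}\Omega=-\sum_{s\in S(\Omega)}\frac{\sin\sqrt{d(s)^2+\mathfrak t(s)^2}}{\sqrt{d(s)^2+\mathfrak t(s)^2}}\big(d(s)\mathbb J_3+\mathfrak t(s)\mathbb J_1\big)\delta_s$ and let $D^{at}_n\Omega$ be its restriction to $S_n(\Omega)$. $G_n\in BV(I_L,\mathbb R^{3\times3})$ is the solution of $$DG_n=-(G_n^\top)^{-1}(\bar D\Omega+D^{at}_n\Omega),\qquad G_n(0)=\mathbb I_3,$$ with $G_n(s)\in SO(3)$ for $s\in I_L\setminus S_n(\Omega)$ (equality of measures on $I_L$; $G_n$ on the right is the precise representative $\frac12(G_n(s^+)+G_n(s^-))$, invertible for every $s$), obtained as follows: on each component of $I_L\setminus S_n(\Omega)$, $G_n$ is continuous and solves $DG_n=-G_n\bar D\Omega$, and at each $s\in S_n(\Omega)$ one has $G_n(s^+)=R\,G_n(s^-)$, where $R\in SO(3)$ is the rotation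 of angle $\sqrt{d(s)^2+\mathfrak t(s)^2}$ around the axis oriented by $G_n(s^-)\mathbf v$, with $\mathbf v=(\mathfrak t(s),0,d(s))^\top/\sqrt{d(s)^2+\mathfrak t(s)^2}$. Then $\mathbf c_n(s)=\int_0^s\mathbf t_n(\sigma)\,d\sigma$, $s\in[0,L]$, where $\mathbf t_n=G_n\mathbf e_1$. Total curvature and torsion. The rotation of a polygonal curve is the sum of the turning angles at its interior vertices; $\mathrm{TC}(\mathbf c)$ is the supremum of the rotations of polygonal curves inscribed in $\mathbf c$. For a (non-closed) polygonal $\mathbf p$ with vertices $v_0,\dots,v_n$, $n\ge3$, with segments $\sigma_i=[v_{i-1},v_i]$ of positive length and consecutive segments not aligned (assumed without loss of generality), $\widetilde{\mathrm{TAT}}(\mathbf p)=\sum_{i=2}^{n-1}\widetilde\tau_i$, where $\widetilde\tau_i\in[0,\pi/2]$ is the angle between the unoriented lines spanned by $\sigma_{i-1}\times\sigma_i$ and $\sigma_i\times\sigma_{i+1}$. The total absolute torsion is $\mathrm{TAT}(\mathbf c)=\lim_{\varepsilon\to0^+}\sup\{\widetilde{\mathrm{TAT}}(\mathbf p):\mathbf p\text{ inscribed in }\mathbf c,\ \mu_{\mathbf c}(\mathbf p)<\varepsilon\}$, where $\mu_{\mathbf c}(\mathbf p)$ is the maximum of the diameters of the arcs of $\mathbf c$ determined by consecutive vertices of $\mathbf p$. *)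

theory Defs
  imports "HOL-Analysis.Analysis"
begin

section \<open>Functions of bounded variation on \<open>(0, L)\<close>\<close>

text \<open>Pointwise variation. For a continuous curve this is its length, i.e. the supremum of the
  lengths of the inscribed polygonal curves.\<close>

definition variation :: "real set \<Rightarrow> (real \<Rightarrow> 'a::metric_space) \<Rightarrow> ennreal" where
  "variation S u =
     (SUP ts \<in> {ts. sorted ts \<and> set ts \<subseteq> S}.
        \<Sum>i<length ts - 1. ennreal (dist (u (ts ! i)) (u (ts ! Suc i))))"

text \<open>A \<open>BV\<close> function is represented by an actual function of finite pointwise variation. All that
  follows depends only on its one-sided limits. Values outside \<open>(0, L)\<close> are irrelevant.\<close>

definition BV :: "real \<Rightarrow> (real \<Rightarrow> 'a::metric_space) \<Rightarrow> bool" where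
  "BV L u \<longleftrightarrow> variation {0<..<L} u < \<infinity>"

definition rlim :: "(real \<Rightarrow> 'a::t2_space) \<Rightarrow> real \<Rightarrow> 'a" where
  "rlim u s = Lim (at_right s) u"

definition llim :: "(real \<Rightarrow> 'a::t2_space) \<Rightarrow> real \<Rightarrow> 'a" where
  "llim u s = Lim (at_left s) u"

definition jump_set :: "real \<Rightarrow> (real \<Rightarrow> 'a::t2_space) \<Rightarrow> real set" where
  "jump_set L u = {s \<in> {0<..<L}. llim u s \<noteq> rlim u s}"

definition precise_rep :: "(real \<Rightarrow> 'a::real_normed_vector) \<Rightarrow> real \<Rightarrow> 'a" where
  "precise_rep u s = (1/2) *\<^sub>R (rlim u s + llim u s)"


section \<open>The derivative measure\<close>

text \<open>For \<open>u \<in> BV(0, L)\<close> the signed measure \<open>Du\<close> is the Lebesgue--Stieltjes measure of the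
  right-continuous representative of \<open>u\<close>, extended constantly to the real line (so that no mass
  sits at \<open>0\<close> or \<open>L\<close>), written as the difference of the measures generated by the two monotone
  functions of the Jordan decomposition. It satisfies \<open>Du((a, b)) = u(b-) - u(a+)\<close>.\<close>

definition rcont_rep :: "real \<Rightarrow> (real \<Rightarrow> real) \<Rightarrow> real \<Rightarrow> real" where
  "rcont_rep L u s = (if s \<le> 0 then rlim u 0 else if s < L then rlim u s else llim u L)"

definition pos_variation :: "real \<Rightarrow> (real \<Rightarrow> real) \<Rightarrow> real \<Rightarrow> real" where
  "pos_variation L u s =
     (enn2real (variation {0..s} (rcont_rep L u)) + (rcont_rep L u s - rcont_rep L u 0)) / 2"

definition neg_variation :: "real \<Rightarrow> (real \<Rightarrow> real) \<Rightarrow> real \<Rightarrow> real" where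
  "neg_variation L u s =
     (enn2real (variation {0..s} (rcont_rep L u)) - (rcont_rep L u s - rcont_rep L u 0)) / 2"

definition deriv_measure :: "real \<Rightarrow> (real \<Rightarrow> real) \<Rightarrow> real set \<Rightarrow> real" where
  "deriv_measure L u B =
     measure (interval_measure (pos_variation L u)) (B \<inter> {0<..<L})
     - measure (interval_measure (neg_variation L u)) (B \<inter> {0<..<L})"

text \<open>\<open>deriv_integral L u f B\<close> is the integral over \<open>B\<close> of \<open>f\<close> with respect to \<open>Du\<close>.\<close>

definition deriv_integral :: "real \<Rightarrow> (real \<Rightarrow> real) \<Rightarrow> (real \<Rightarrow> real) \<Rightarrow> real set \<Rightarrow> real" where
  "deriv_integral L u f B =
     (LINT s:B \<inter> {0<..<L}|interval_measure (pos_variation L u). f s)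
     - (LINT s:B \<inter> {0<..<L}|interval_measure (neg_variation L u). f s)"

definition mat_deriv_measure :: "real \<Rightarrow> (real \<Rightarrow> real^3^3) \<Rightarrow> real set \<Rightarrow> real^3^3" where
  "mat_deriv_measure L U B = (\<chi> i j. deriv_measure L (\<lambda>s. U s $ i $ j) B)"

definition mat_jump_measure :: "real \<Rightarrow> (real \<Rightarrow> real^3^3) \<Rightarrow> real set \<Rightarrow> real^3^3" where
  "mat_jump_measure L U B = mat_deriv_measure L U (B \<inter> jump_set L U)"

text \<open>The matrix measure obtained by multiplying the diffuse part of \<open>DU\<close> (that is, \<open>DU\<close> restricted
  to the complement of the jump set) by the matrix function \<open>A\<close> from the left.\<close>

definition mat_diffuse_integral ::
    "real \<Rightarrow> (real \<Rightarrow> real^3^3) \<Rightarrow> (real \<Rightarrow> real^3^3) \<Rightarrow> real set \<Rightarrow> real^3^3" where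
  "mat_diffuse_integral L A U B =
     (\<chi> i j. \<Sum>k\<in>UNIV. deriv_integral L (\<lambda>s. U s $ k $ j) (\<lambda>s. A s $ i $ k) (B - jump_set L U))"

definition total_variation :: "(real set \<Rightarrow> 'a::real_normed_vector) \<Rightarrow> real set \<Rightarrow> ennreal" where
  "total_variation \<mu> B =
     (SUP P \<in> {P. finite P \<and> disjoint P \<and> P \<subseteq> sets borel \<and> \<Union>P \<subseteq> B}. \<Sum>E\<in>P. ennreal (norm (\<mu> E)))"


section \<open>The approximating curves\<close>

definition J1 :: "real^3^3" where
  "J1 = vector [vector [0, 0, 0], vector [0, 0, -1], vector [0, 1, 0]]"

definition J3 :: "real^3^3" where
  "J3 = vector [vector [0, -1, 0], vector [1, 0, 0], vector [0, 0, 0]]"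

definition Omega :: "(real \<Rightarrow> real) \<Rightarrow> (real \<Rightarrow> real) \<Rightarrow> real \<Rightarrow> real^3^3" where
  "Omega \<theta> \<phi> s = vector [vector [0, \<theta> s, 0], vector [- \<theta> s, 0, \<phi> s], vector [0, - \<phi> s, 0]]"

definition jump :: "(real \<Rightarrow> real) \<Rightarrow> real \<Rightarrow> real" where
  "jump u s = rlim u s - llim u s"

definition jump_angle :: "(real \<Rightarrow> real) \<Rightarrow> (real \<Rightarrow> real) \<Rightarrow> real \<Rightarrow> real" where
  "jump_angle \<theta> \<phi> s = sqrt ((jump \<theta> s)\<^sup>2 + (jump \<phi> s)\<^sup>2)"

text \<open>The norm of \<open>real^3^3\<close> is the Frobenius norm.\<close>

definition S_n :: "real \<Rightarrow> (real \<Rightarrow> real) \<Rightarrow> (real \<Rightarrow> real) \<Rightarrow> nat \<Rightarrow> real set" where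
  "S_n L \<theta> \<phi> n =
     {s \<in> jump_set L (Omega \<theta> \<phi>).
        total_variation (mat_jump_measure L (Omega \<theta> \<phi>)) {s} > ennreal (1 / real n)}"

definition at_weight :: "(real \<Rightarrow> real) \<Rightarrow> (real \<Rightarrow> real) \<Rightarrow> real \<Rightarrow> real^3^3" where
  "at_weight \<theta> \<phi> s =
     - ((sin (jump_angle \<theta> \<phi> s) / jump_angle \<theta> \<phi> s) *\<^sub>R (jump \<theta> s *\<^sub>R J3 + jump \<phi> s *\<^sub>R J1))"

definition jump_axis :: "(real \<Rightarrow> real) \<Rightarrow> (real \<Rightarrow> real) \<Rightarrow> real \<Rightarrow> real^3" where
  "jump_axis \<theta> \<phi> s = (1 / jump_angle \<theta> \<phi> s) *\<^sub>R vector [jump \<phi> s, 0, jump \<theta> s]"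

text \<open>Rodrigues' formula: the right-handed rotation by the angle \<open>\<alpha>\<close> about the unit vector \<open>w\<close>.\<close>

definition axis_rotation :: "real^3 \<Rightarrow> real \<Rightarrow> real^3^3" where
  "axis_rotation w \<alpha> =
     matrix (\<lambda>x. cos \<alpha> *\<^sub>R x + sin \<alpha> *\<^sub>R cross3 w x + ((1 - cos \<alpha>) * (w \<bullet> x)) *\<^sub>R w)"

text \<open>At a retained jump point the measure equation alone does not distinguish the rotation angles
  \<open>\<alpha>\<close> and \<open>\<pi> - \<alpha>\<close>, so the jump relation is a separate requirement. On the other hand the equation
  \<open>DG = - G DU\<close>, with \<open>DU\<close> the diffuse part of the derivative of \<open>Omega\<close>, on the components of the
  complement of \<open>S_n\<close> is contained in the measure equation, because there \<open>G\<close> is orthogonal and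
  equals its precise representative.\<close>

definition approx_frame ::
    "real \<Rightarrow> (real \<Rightarrow> real) \<Rightarrow> (real \<Rightarrow> real) \<Rightarrow> nat \<Rightarrow> (real \<Rightarrow> real^3^3) \<Rightarrow> bool" where
  "approx_frame L \<theta> \<phi> n G \<longleftrightarrow>
     BV L G \<and>
     (\<forall>B \<in> sets borel. B \<subseteq> {0<..<L} \<longrightarrow>
        (let M = (\<lambda>s. matrix_inv (transpose (precise_rep G s)))
         in mat_deriv_measure L G B =
              - (mat_diffuse_integral L M (Omega \<theta> \<phi>) B
                 + (\<Sum>s\<in>S_n L \<theta> \<phi> n \<inter> B. M s ** at_weight \<theta> \<phi> s)))) \<and>
     rlim G 0 = mat 1 \<and>
     (\<forall>s \<in> {0<..<L} - S_n L \<theta> \<phi> n. rotation_matrix (G s)) \<and>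
     continuous_on ({0<..<L} - S_n L \<theta> \<phi> n) G \<and>
     (\<forall>s \<in> S_n L \<theta> \<phi> n.
        rlim G s = axis_rotation (llim G s *v jump_axis \<theta> \<phi> s) (jump_angle \<theta> \<phi> s) ** llim G s)"

definition frame_curve :: "(real \<Rightarrow> real^3^3) \<Rightarrow> real \<Rightarrow> real^3" where
  "frame_curve G s = integral {0..s} (\<lambda>\<sigma>. G \<sigma> *v axis 1 1)"


section \<open>Total curvature and total absolute torsion\<close>

definition vec_angle :: "real^3 \<Rightarrow> real^3 \<Rightarrow> real" where
  "vec_angle x y = arccos ((x \<bullet> y) / (norm x * norm y))"

definition line_angle :: "real^3 \<Rightarrow> real^3 \<Rightarrow> real" where
  "line_angle x y = arccos (\<bar>x \<bullet> y\<bar> / (norm x * norm y))"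

text \<open>A polygonal curve is given by the list of its vertices. Segments of length zero are dropped,
  and so are vanishing cross products of consecutive segments. The latter has the same effect as
  merging aligned consecutive segments, since this does not change the lines spanned by the other
  cross products.\<close>

definition poly_segments :: "(real^3) list \<Rightarrow> (real^3) list" where
  "poly_segments vs = filter (\<lambda>e. e \<noteq> 0) (map2 (\<lambda>v w. w - v) vs (tl vs))"

definition poly_rotation :: "(real^3) list \<Rightarrow> real" where
  "poly_rotation vs = (let es = poly_segments vs in sum_list (map2 vec_angle es (tl es)))"

definition poly_binormals :: "(real^3) list \<Rightarrow> (real^3) list" where
  "poly_binormals vs =
     (let es = poly_segments vs in filter (\<lambda>b. b \<noteq> 0) (map2 cross3 es (tl es)))"

definition poly_TAT :: "(real^3) list \<Rightarrow> real" where
  "poly_TAT vs = (let bs = poly_binormals vs in sum_list (map2 line_angle bs (tl bs)))"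

text \<open>The polygonal curves inscribed in \<open>c\<close> are those with vertices \<open>map c ts\<close>, where \<open>ts\<close> is a
  partition of \<open>[0, L]\<close>; in particular they have the end points of \<open>c\<close>.\<close>

definition partitions :: "real \<Rightarrow> real list set" where
  "partitions L = {ts. ts \<noteq> [] \<and> sorted_wrt (<) ts \<and> hd ts = 0 \<and> last ts = L}"

definition modulus :: "(real \<Rightarrow> real^3) \<Rightarrow> real list \<Rightarrow> real" where
  "modulus c ts = Max ((\<lambda>i. diameter (c ` {ts ! i .. ts ! Suc i})) ` {..<length ts - 1})"

definition TC :: "real \<Rightarrow> (real \<Rightarrow> real^3) \<Rightarrow> ennreal" where
  "TC L c = (SUP ts \<in> partitions L. ennreal (poly_rotation (map c ts)))"

definition TAT :: "real \<Rightarrow> (real \<Rightarrow> real^3) \<Rightarrow> ennreal" where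
  "TAT L c =
     Lim (at_right (0::real))
       (\<lambda>\<epsilon>. SUP ts \<in> {ts \<in> partitions L. modulus c ts < \<epsilon>}. ennreal (poly_TAT (map c ts)))"

end

theory Submission
  imports Defs "HOL-Probability.Distribution_Functions"
begin

text \<open>All frames \<open>G n\<close> solve the same linear equation away from their jumps, and its coefficient is
  antisymmetric. Hence \<open>G n ** transpose (G m)\<close> is constant between the points of \<open>S_n m\<close>, does not
  jump at the points of \<open>S_n n\<close>, and jumps by at most a multiple of the jump angle elsewhere. Since
  the jump angles are summable, the frames converge uniformly off the jump set to a frame
  \<open>(t, n, b)\<close> whose oscillation on an interval is controlled by the mass of \<open>|DU|\<close> there,
  \<open>U = Omega \<theta> \<phi>\<close>.

  As \<open>\<theta>\<close> is nondecreasing, increments of \<open>t\<close> over an interval lie in a narrow convex cone around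
  \<open>n\<close>, whose opening is proportional to that mass. This also holds across a jump, because
  \<open>R e1 - e1 = d (e2 + O(angle))\<close> for the jump rotation \<open>R\<close>. Integrating \<open>t\<close> once and
  \<open>t(x) \<times> t(y)\<close> twice, the edges of an inscribed polygonal lie in narrow cones around \<open>t\<close> and
  its binormals in narrow cones around \<open>b\<close>. Each angle is therefore at most a constant times the
  mass of the interval spanned by the edges involved, and these intervals overlap at most three
  times.\<close>

section \<open>Variation and one-sided limits\<close>

text \<open>Two obstacles shape the proof. First, there is no product rule for \<open>BV\<close>
  frames to start from. On an interval free of retained jumps, the measure equation gives a
  first-order step with a quadratic error; since the diffuse mass has a continuous distribution
  function, repeated halving removes that error. Jumps are handled apart, by chaining over the
  finitely many points of \<open>S n\<close>, with one-sided limits only. Second, angles do not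
  scale: an edge, and even more so a binormal, may be arbitrarily short, so an absolute error says
  nothing about its direction. The estimates behind the cones therefore have errors proportional to
  the main term itself. For the tangent this term is the increment of \<theta>, and the sign of the
  measure of \<theta> makes contributions add up instead of cancelling. Cones are convex and closed,
  hence stable under sums, limits and integrals. Bounds are written as \<open>K y - K x\<close> with
  a monotone control function \<open>K\<close>, so that they telescope; where such a bound is too
  large for the cone argument, it exceeds \<open>pi\<close> and any angle obeys it. The constants
  come from crude counting.\<close>

lemma variation_le_control:
  fixes u :: "real \<Rightarrow> 'a::metric_space"
  assumes "a \<le> b"
    and K: "\<And>x y. a \<le> x \<Longrightarrow> x \<le> y \<Longrightarrow> y \<le> b \<Longrightarrow> dist (u x) (u y) \<le> K y - K x"
  shows "variation {a..b} u \<le> ennreal (K b - K a)"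
  unfolding variation_def
proof (rule SUP_least)
  fix ts assume "ts \<in> {ts. sorted ts \<and> set ts \<subseteq> {a..b}}"
  then have ts: "sorted ts" "set ts \<subseteq> {a..b}" by auto
  have mono: "K x \<le> K y" if "a \<le> x" "x \<le> y" "y \<le> b" for x y
    using K[OF that] zero_le_dist[of "u x" "u y"] by linarith
  show "(\<Sum>i<length ts - 1. ennreal (dist (u (ts ! i)) (u (ts ! Suc i)))) \<le> ennreal (K b - K a)"
  proof (cases "length ts \<le> 1")
    case True
    then show ?thesis by simp
  next
    case False
    have "(\<Sum>i<length ts - 1. ennreal (dist (u (ts ! i)) (u (ts ! Suc i))))
      = ennreal (\<Sum>i<length ts - 1. dist (u (ts ! i)) (u (ts ! Suc i)))"
      by (simp add: sum_ennreal)
    also have "\<dots> \<le> ennreal (\<Sum>i<length ts - 1. K (ts ! Suc i) - K (ts ! i))"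
    proof (intro ennreal_leI sum_mono)
      fix i assume "i \<in> {..<length ts - 1}"
      then have "i < length ts" "Suc i < length ts" by auto
      then have "ts ! i \<in> {a..b}" "ts ! Suc i \<in> {a..b}" "ts ! i \<le> ts ! Suc i"
        using ts nth_mem by (auto simp: sorted_nth_mono subset_iff)
      then show "dist (u (ts ! i)) (u (ts ! Suc i)) \<le> K (ts ! Suc i) - K (ts ! i)"
        by (intro K) auto
    qed
    also have "\<dots> = ennreal (K (ts ! (length ts - 1)) - K (ts ! 0))"
      by (subst sum_lessThan_telescope) simp
    also have "\<dots> \<le> ennreal (K b - K a)"
    proof (intro ennreal_leI diff_mono mono)
      have "ts ! (length ts - 1) \<in> {a..b}" "ts ! 0 \<in> {a..b}"
        using False ts(2) by (auto intro!: subsetD[OF ts(2)] nth_mem simp del: atLeastAtMost_iff)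
      then show "a \<le> ts ! (length ts - 1)" "ts ! (length ts - 1) \<le> b" "a \<le> ts ! 0" "ts ! 0 \<le> b"
        by auto
    qed auto
    finally show ?thesis .
  qed
qed

text \<open>Append \<open>x\<close> and \<open>y\<close> to a list in \<open>S\<close>: the distance
  from its last point to \<open>x\<close> is one more nonnegative term. Consequently the variation
  up to a point is a control function for the increments.\<close>

lemma variation_append:
  fixes u :: "real \<Rightarrow> 'a::metric_space"
  assumes "S \<subseteq> T" "x \<in> T" "y \<in> T" "x \<le> y" "\<And>s. s \<in> S \<Longrightarrow> s \<le> x"
  shows "variation S u + ennreal (dist (u x) (u y)) \<le> variation T u"
proof -
  have "variation S u + ennreal (dist (u x) (u y))
    = (SUP ts \<in> {ts. sorted ts \<and> set ts \<subseteq> S}.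
        (\<Sum>i<length ts - 1. ennreal (dist (u (ts ! i)) (u (ts ! Suc i)))) + ennreal (dist (u x) (u y)))"
    unfolding variation_def
    by (subst ennreal_SUP_add_left) (auto intro!: exI[of _ "[]"])
  also have "\<dots> \<le> variation T u"
  proof (rule SUP_least)
    fix ts assume "ts \<in> {ts. sorted ts \<and> set ts \<subseteq> S}"
    then have ts: "sorted ts" "set ts \<subseteq> S" by auto
    let ?us = "ts @ [x, y]"
    have "(\<Sum>i<length ts - 1. ennreal (dist (u (ts ! i)) (u (ts ! Suc i)))) + ennreal (dist (u x) (u y))
      \<le> (\<Sum>i<length ?us - 1. ennreal (dist (u (?us ! i)) (u (?us ! Suc i))))"
    proof (cases ts rule: rev_cases)
      case Nil
      then show ?thesis by simp
    next
      case (snoc ts' z)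
      have "(\<Sum>i<length ts - 1. ennreal (dist (u (ts ! i)) (u (ts ! Suc i))))
        = (\<Sum>i<length ts'. ennreal (dist (u (?us ! i)) (u (?us ! Suc i))))"
        using snoc by (intro sum.cong) (auto simp: nth_append)
      moreover have "?us ! (Suc (length ts')) = x" "?us ! (Suc (Suc (length ts'))) = y"
        using snoc by (auto simp: nth_append)
      ultimately show ?thesis
        using snoc by (simp add: add.assoc add_increasing add_left_mono)
    qed
    also have "\<dots> \<le> variation T u"
      unfolding variation_def using ts assms
      by (intro SUP_upper) (fastforce simp: sorted_append)
    finally show "(\<Sum>i<length ts - 1. ennreal (dist (u (ts ! i)) (u (ts ! Suc i)))) + ennreal (dist (u x) (u y))
      \<le> variation T u" .
  qed
  finally show ?thesis .
qed

lemma variation_mono: "S \<subseteq> T \<Longrightarrow> variation S u \<le> variation T u"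
  unfolding variation_def by (intro SUP_subset_mono) auto

lemma dist_le_variation_diff:
  fixes u :: "real \<Rightarrow> 'a::metric_space"
  assumes "S \<subseteq> T" "x \<in> T" "y \<in> T" "x \<le> y" "\<And>s. s \<in> S \<Longrightarrow> s \<le> x" "variation T u < \<infinity>"
  shows "dist (u x) (u y) \<le> enn2real (variation T u) - enn2real (variation S u)"
proof -
  have "variation S u < \<infinity>"
    using variation_mono[OF assms(1)] assms(6) by (metis order_le_less_trans)
  then show ?thesis
    using variation_append[OF assms(1-5), of u] assms(6)
    by (cases "variation S u"; cases "variation T u") (auto simp flip: ennreal_plus)
qed

section \<open>Existence of one-sided limits\<close>

lemma mono_right_limit:
  fixes f :: "real \<Rightarrow> real"
  assumes "\<And>x y. a < x \<Longrightarrow> x \<le> y \<Longrightarrow> y < b \<Longrightarrow> f x \<le> f y" "\<And>x. a < x \<Longrightarrow> x < b \<Longrightarrow> m \<le> f x"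
    and "a \<le> s" "s < b"
  shows "\<exists>l. (f \<longlongrightarrow> l) (at_right s)"
proof -
  have "(f \<longlongrightarrow> Inf (f ` ({s<..} \<inter> {a<..<b}))) (at s within ({s<..} \<inter> {a<..<b}))"
    using assms by (intro Lim_right_bound[where K=m]) auto
  moreover have "{s<..} \<inter> {a<..<b} = {s<..<b}" using assms by auto
  moreover have "at s within {s<..<b} = at_right s"
    using assms(4) by (intro at_within_nhd[of s "{..<b}"]) auto
  ultimately show ?thesis by auto
qed

lemma mono_left_limit:
  fixes f :: "real \<Rightarrow> real"
  assumes "\<And>x y. a < x \<Longrightarrow> x \<le> y \<Longrightarrow> y < b \<Longrightarrow> f x \<le> f y" "\<And>x. a < x \<Longrightarrow> x < b \<Longrightarrow> f x \<le> m"
    and "a < s" "s \<le> b"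
  shows "\<exists>l. (f \<longlongrightarrow> l) (at_left s)"
proof -
  have "(f \<longlongrightarrow> Sup (f ` ({..<s} \<inter> {a<..<b}))) (at s within ({..<s} \<inter> {a<..<b}))"
    using assms by (intro Lim_left_bound[where K=m]) auto
  moreover have "{..<s} \<inter> {a<..<b} = {a<..<s}" using assms by auto
  moreover have "at s within {a<..<s} = at_left s"
    using assms(3) by (intro at_within_nhd[of s "{a<..}"]) auto
  ultimately show ?thesis by auto
qed

text \<open>Jordan decomposition: \<open>K + u\<close> and \<open>K\<close> are nondecreasing and
  bounded below, so both have right limits, and \<open>u\<close> is their difference.\<close>

lemma control_right_limit:
  fixes u :: "real \<Rightarrow> real"
  assumes K: "\<And>x y. a < x \<Longrightarrow> x \<le> y \<Longrightarrow> y < b \<Longrightarrow> \<bar>u y - u x\<bar> \<le> K y - K x"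
    and M: "\<And>x. a < x \<Longrightarrow> x < b \<Longrightarrow> 0 \<le> K x \<and> K x \<le> M"
    and "a \<le> s" "s < b"
  shows "\<exists>l. (u \<longlongrightarrow> l) (at_right s)"
proof -
  obtain x0 where x0: "a < x0" "x0 < b" using assms(3,4) dense[of s b] by (metis order_le_less_trans)
  have u: "u x \<ge> u x0 - M" if "a < x" "x < b" for x
    using K[of x x0] K[of x0 x] M[of x] M[of x0] that x0 by (cases "x \<le> x0") auto
  obtain l1 where l1: "((\<lambda>x. K x + u x) \<longlongrightarrow> l1) (at_right s)"
    using mono_right_limit[of a b "\<lambda>x. K x + u x" "u x0 - M" s] assms(3,4) K M u
    by (fastforce simp: abs_le_iff)
  obtain l2 where l2: "(K \<longlongrightarrow> l2) (at_right s)"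
    using mono_right_limit[of a b K 0 s] assms(3,4) K M abs_ge_zero by (smt (verit))
  have "((\<lambda>x. (K x + u x) - K x) \<longlongrightarrow> l1 - l2) (at_right s)"
    by (intro tendsto_diff l1 l2)
  then show ?thesis by auto
qed

lemma control_left_limit:
  fixes u :: "real \<Rightarrow> real"
  assumes K: "\<And>x y. a < x \<Longrightarrow> x \<le> y \<Longrightarrow> y < b \<Longrightarrow> \<bar>u y - u x\<bar> \<le> K y - K x"
    and M: "\<And>x. a < x \<Longrightarrow> x < b \<Longrightarrow> 0 \<le> K x \<and> K x \<le> M"
    and "a < s" "s \<le> b"
  shows "\<exists>l. (u \<longlongrightarrow> l) (at_left s)"
proof -
  obtain x0 where x0: "a < x0" "x0 < b" using assms(3,4) dense[of a s] by (metis order_less_le_trans)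
  have u: "u x \<le> u x0 + M" if "a < x" "x < b" for x
    using K[of x x0] K[of x0 x] M[of x] M[of x0] that x0 by (cases "x \<le> x0") auto
  obtain l1 where l1: "((\<lambda>x. K x + u x) \<longlongrightarrow> l1) (at_left s)"
    using mono_left_limit[of a b "\<lambda>x. K x + u x" "M + (u x0 + M)" s] assms(3,4) K M u
    by (smt (verit))
  obtain l2 where l2: "(K \<longlongrightarrow> l2) (at_left s)"
    using mono_left_limit[of a b K M s] assms(3,4) K M abs_ge_zero by (smt (verit))
  have "((\<lambda>x. (K x + u x) - K x) \<longlongrightarrow> l1 - l2) (at_left s)"
    by (intro tendsto_diff l1 l2)
  then show ?thesis by auto
qed

lemma BV_control:
  fixes u :: "real \<Rightarrow> 'a::metric_space"
  assumes "BV L u"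
  obtains K M where "\<And>x y. 0 < x \<Longrightarrow> x \<le> y \<Longrightarrow> y < L \<Longrightarrow> dist (u x) (u y) \<le> K y - K x"
    "\<And>x. 0 < x \<Longrightarrow> x < L \<Longrightarrow> 0 \<le> K x \<and> K x \<le> (M::real)"
proof
  have fin: "variation {0<..<L} u < \<infinity>" using assms by (simp add: BV_def)
  have fin': "variation {0<..x} u < \<infinity>" if "x < L" for x
    using variation_mono[of "{0<..x}" "{0<..<L}" u] that fin by (force intro: le_less_trans)
  show "dist (u x) (u y) \<le> enn2real (variation {0<..y} u) - enn2real (variation {0<..x} u)"
    if "0 < x" "x \<le> y" "y < L" for x y
    using that fin' by (intro dist_le_variation_diff) auto
  show "0 \<le> enn2real (variation {0<..x} u) \<and> enn2real (variation {0<..x} u)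
      \<le> enn2real (variation {0<..<L} u)" if "0 < x" "x < L" for x
  proof -
    have "{0<..x} \<subseteq> {0<..<L}" using that by auto
    then show ?thesis
      using fin by (auto intro!: enn2real_mono variation_mono simp: less_top)
  qed
qed

lemma BV_entry:
  fixes U :: "real \<Rightarrow> real^'n^'m"
  assumes "BV L U"
  shows "BV L (\<lambda>s. U s $ i $ j)"
proof -
  have "variation {0<..<L} (\<lambda>s. U s $ i $ j) \<le> variation {0<..<L} U"
    unfolding variation_def
    by (intro SUP_mono' sum_mono ennreal_leI)
      (metis Finite_Cartesian_Product.dist_vec_nth_le order_trans)
  then show ?thesis using assms by (auto simp: BV_def intro: le_less_trans)
qed

lemma BV_uminus:
  fixes u :: "real \<Rightarrow> 'a::real_normed_vector"
  assumes "BV L u" shows "BV L (\<lambda>s. - u s)"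
  using assms by (simp add: BV_def variation_def dist_minus)

lemma BV_const: "BV L (\<lambda>s. c)"
  unfolding BV_def variation_def by (rule le_less_trans[OF SUP_least[where u=0]]) auto

lemma BV_tendsto_rlim:
  fixes u :: "real \<Rightarrow> real"
  assumes "BV L u" "0 \<le> s" "s < L"
  shows "(u \<longlongrightarrow> rlim u s) (at_right s)"
proof -
  obtain K M where "\<And>x y. 0 < x \<Longrightarrow> x \<le> y \<Longrightarrow> y < L \<Longrightarrow> dist (u x) (u y) \<le> K y - K x"
    "\<And>x. 0 < x \<Longrightarrow> x < L \<Longrightarrow> 0 \<le> K x \<and> K x \<le> (M::real)"
    using BV_control[OF assms(1)] by blast
  then obtain l where "(u \<longlongrightarrow> l) (at_right s)"
    using control_right_limit[of 0 L u K M s] assms by (auto simp: dist_real_def abs_minus_commute)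
  then show ?thesis unfolding rlim_def by (simp add: tendsto_Lim)
qed

lemma BV_tendsto_llim:
  fixes u :: "real \<Rightarrow> real"
  assumes "BV L u" "0 < s" "s \<le> L"
  shows "(u \<longlongrightarrow> llim u s) (at_left s)"
proof -
  obtain K M where "\<And>x y. 0 < x \<Longrightarrow> x \<le> y \<Longrightarrow> y < L \<Longrightarrow> dist (u x) (u y) \<le> K y - K x"
    "\<And>x. 0 < x \<Longrightarrow> x < L \<Longrightarrow> 0 \<le> K x \<and> K x \<le> (M::real)"
    using BV_control[OF assms(1)] by blast
  then obtain l where "(u \<longlongrightarrow> l) (at_left s)"
    using control_left_limit[of 0 L u K M s] assms by (auto simp: dist_real_def abs_minus_commute)
  then show ?thesis unfolding llim_def by (simp add: tendsto_Lim)
qed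

lemma tendsto_matrixI:
  fixes U :: "'a \<Rightarrow> real^'n^'m"
  assumes "\<And>i j. ((\<lambda>s. U s $ i $ j) \<longlongrightarrow> l $ i $ j) F"
  shows "(U \<longlongrightarrow> l) F"
  by (intro vec_tendstoI assms)

text \<open>\<open>rlim\<close> is a \<open>Lim\<close> and carries no information without
  convergence, so the entrywise formula is obtained together with the existence of the matrix
  limit.\<close>

lemma
  fixes U :: "real \<Rightarrow> real^'n^'m"
  assumes "\<And>i j. BV L (\<lambda>s. U s $ i $ j)" "0 \<le> s" "s < L"
  shows matrix_tendsto_rlim: "(U \<longlongrightarrow> rlim U s) (at_right s)"
    and rlim_nth: "rlim U s $ i $ j = rlim (\<lambda>s. U s $ i $ j) s"
proof -
  have "(U \<longlongrightarrow> (\<chi> i j. rlim (\<lambda>s. U s $ i $ j) s)) (at_right s)"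
    by (intro tendsto_matrixI) (simp, rule BV_tendsto_rlim[OF assms])
  then have "rlim U s = (\<chi> i j. rlim (\<lambda>s. U s $ i $ j) s)" "(U \<longlongrightarrow> rlim U s) (at_right s)"
    by (auto simp: tendsto_Lim rlim_def)
  then show "(U \<longlongrightarrow> rlim U s) (at_right s)" "rlim U s $ i $ j = rlim (\<lambda>s. U s $ i $ j) s" by auto
qed

lemma
  fixes U :: "real \<Rightarrow> real^'n^'m"
  assumes "\<And>i j. BV L (\<lambda>s. U s $ i $ j)" "0 < s" "s \<le> L"
  shows matrix_tendsto_llim: "(U \<longlongrightarrow> llim U s) (at_left s)"
    and llim_nth: "llim U s $ i $ j = llim (\<lambda>s. U s $ i $ j) s"
proof -
  have "(U \<longlongrightarrow> (\<chi> i j. llim (\<lambda>s. U s $ i $ j) s)) (at_left s)"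
    by (intro tendsto_matrixI) (simp, rule BV_tendsto_llim[OF assms])
  then have "llim U s = (\<chi> i j. llim (\<lambda>s. U s $ i $ j) s)" "(U \<longlongrightarrow> llim U s) (at_left s)"
    by (auto simp: tendsto_Lim llim_def)
  then show "(U \<longlongrightarrow> llim U s) (at_left s)" "llim U s $ i $ j = llim (\<lambda>s. U s $ i $ j) s" by auto
qed

section \<open>The right-continuous representative\<close>

text \<open>The filter along which \<open>rcont_rep L u s\<close> is the limit of \<open>u\<close>.\<close>

definition rcont_side :: "real \<Rightarrow> real \<Rightarrow> real filter" where
  "rcont_side L s = (if s < L then at_right (max 0 s) else at_left L)"

lemma rcont_side_neq_bot [simp]: "rcont_side L s \<noteq> bot"
  by (simp add: rcont_side_def)

lemma tendsto_rcont_rep: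
  assumes "BV L u" "0 < L"
  shows "(u \<longlongrightarrow> rcont_rep L u s) (rcont_side L s)"
  using BV_tendsto_rlim[OF assms(1), of "max 0 s"] BV_tendsto_llim[OF assms(1), of L] assms(2)
  by (auto simp: rcont_side_def rcont_rep_def max_def split: if_splits)

text \<open>Both arguments are approached at once, so that an inequality for \<open>u\<close> at
  ordered points of the open interval passes to \<open>rcont_rep\<close>. For
  \<open>L \<le> x\<close> or \<open>y \<le> 0\<close> the two filters would coincide and impose no
  order.\<close>

lemma eventually_rcont_side_pair:
  assumes "0 < L" "x < y" "x < L" "0 < y"
  shows "eventually (\<lambda>(a, b). 0 < a \<and> a < b \<and> b < L) (rcont_side L x \<times>\<^sub>F rcont_side L y)"
proof -
  obtain m where m: "max 0 x < m" "m < min y L"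
    using assms dense[of "max 0 x" "min y L"] by auto
  have "eventually (\<lambda>a. 0 < a \<and> a < m) (rcont_side L x)"
    using assms m eventually_at_right_less[of "max 0 x"]
      order_tendstoD(2)[OF tendsto_ident_at, of "max 0 x" m "{max 0 x<..}"]
    unfolding rcont_side_def by (auto elim: eventually_elim2)
  moreover have "eventually (\<lambda>b. m < b \<and> b < L) (rcont_side L y)"
  proof (cases "y < L")
    case True
    then show ?thesis
      using assms m eventually_at_right_less[of "max 0 y"]
        order_tendstoD(2)[OF tendsto_ident_at, of "max 0 y" L "{max 0 y<..}"]
      unfolding rcont_side_def by (auto elim: eventually_elim2)
  next
    case False
    then show ?thesis
      using assms m eventually_at_left_real[of m L] unfolding rcont_side_def
      by (auto elim: eventually_mono)
  qed
  ultimately show ?thesis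
    unfolding eventually_prod_filter by (intro exI conjI) auto
qed

text \<open>A control function of \<open>u\<close> yields one for \<open>rcont_rep\<close> by taking
  its limits along the same filters.\<close>

lemma rcont_rep_control:
  fixes u :: "real \<Rightarrow> real"
  assumes "BV L u" "0 < L"
  obtains K where "\<And>x y. x \<le> y \<Longrightarrow> \<bar>rcont_rep L u y - rcont_rep L u x\<bar> \<le> K y - K x"
proof -
  obtain k M where k: "\<And>x y. 0 < x \<Longrightarrow> x \<le> y \<Longrightarrow> y < L \<Longrightarrow> dist (u x) (u y) \<le> k y - k x"
    and M: "\<And>x. 0 < x \<Longrightarrow> x < L \<Longrightarrow> 0 \<le> k x \<and> k x \<le> (M::real)"
    using BV_control[OF assms(1)] by blast
  have kmono: "k x \<le> k y" if "0 < x" "x \<le> y" "y < L" for x y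
    using k[OF that] zero_le_dist[of "u x" "u y"] by linarith
  have "\<exists>l. (k \<longlongrightarrow> l) (rcont_side L s)" for s
    using mono_right_limit[of 0 L k 0 "max 0 s"] mono_left_limit[of 0 L k M L] kmono M assms(2)
    by (auto simp: rcont_side_def)
  then obtain K where K: "\<And>s. (k \<longlongrightarrow> K s) (rcont_side L s)" by metis
  let ?K = "\<lambda>s. K (min L (max 0 s))"
  have same: "rcont_rep L u s = rcont_rep L u (min L (max 0 s))" for s
    using assms by (auto simp: rcont_rep_def)
  have "\<bar>rcont_rep L u y - rcont_rep L u x\<bar> \<le> K y - K x" if xy: "x < y" "0 \<le> x" "y \<le> L" for x y
  proof -
    let ?F = "rcont_side L x \<times>\<^sub>F rcont_side L y"
    have "?F \<noteq> bot" by (simp add: prod_filter_eq_bot)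
    moreover have "((\<lambda>(a, b). k b - k a) \<longlongrightarrow> K y - K x) ?F"
      unfolding split_def by (intro tendsto_diff filterlim_compose[OF K filterlim_snd]
          filterlim_compose[OF K filterlim_fst])
    moreover have "((\<lambda>(a, b). \<bar>u b - u a\<bar>) \<longlongrightarrow> \<bar>rcont_rep L u y - rcont_rep L u x\<bar>) ?F"
      unfolding split_def
      by (intro tendsto_rabs tendsto_diff
          filterlim_compose[OF tendsto_rcont_rep[OF assms] filterlim_snd]
          filterlim_compose[OF tendsto_rcont_rep[OF assms] filterlim_fst])
    moreover have "eventually (\<lambda>z. (case z of (a, b) \<Rightarrow> \<bar>u b - u a\<bar>) \<le> (case z of (a, b) \<Rightarrow> k b - k a)) ?F"
      by (rule eventually_mono[OF eventually_rcont_side_pair[of L x y]])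
        (use assms xy k in \<open>auto simp: dist_real_def abs_minus_commute\<close>)
    ultimately show ?thesis by (rule tendsto_le)
  qed
  then have *: "\<bar>rcont_rep L u y - rcont_rep L u x\<bar> \<le> K y - K x" if "x \<le> y" "0 \<le> x" "y \<le> L" for x y
    using that by (cases "x = y") auto
  show thesis
  proof (rule that[of ?K])
    fix x y :: real assume "x \<le> y"
    then show "\<bar>rcont_rep L u y - rcont_rep L u x\<bar> \<le> ?K y - ?K x"
      using *[of "min L (max 0 x)" "min L (max 0 y)"] assms same[of x] same[of y] by auto
  qed
qed

text \<open>Right limits of \<open>u\<close> slightly beyond \<open>s\<close> are limits of values
  of \<open>u\<close> that are close to its right limit at \<open>s\<close>. The margin
  \<open>e / 2\<close> absorbs the loss of strictness in the limit.\<close>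

lemma rcont_rep_right:
  assumes "BV L u" "0 < L"
  shows "(rcont_rep L u \<longlongrightarrow> rcont_rep L u s) (at_right s)"
proof -
  consider "s < 0" | "0 \<le> s" "s < L" | "L \<le> s" by linarith
  then show ?thesis
  proof cases
    case 1
    have "eventually (\<lambda>z. rcont_rep L u z = rcont_rep L u s) (at_right s)"
      using 1 order_tendstoD(2)[OF tendsto_ident_at, of s 0 "{s<..}"]
      by (auto simp: rcont_rep_def elim: eventually_mono)
    then show ?thesis by (rule tendsto_eventually)
  next
    case 3
    have "eventually (\<lambda>z. rcont_rep L u z = rcont_rep L u s) (at_right s)"
      using 3 assms eventually_at_right_less[of s]
      by (auto simp: rcont_rep_def elim!: eventually_mono)
    then show ?thesis by (rule tendsto_eventually)
  next
    case 2
    show ?thesis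
    proof (rule tendstoI)
      fix e :: real assume "0 < e"
      then have "eventually (\<lambda>z. dist (u z) (rcont_rep L u s) < e / 2) (at_right s)"
        using tendstoD[OF tendsto_rcont_rep[OF assms, of s], of "e / 2"] 2 by (auto simp: rcont_side_def max_def)
      then obtain b where b: "b > s" "\<And>z. s < z \<Longrightarrow> z < b \<Longrightarrow> dist (u z) (rcont_rep L u s) < e / 2"
        by (auto simp: eventually_at_right_field)
      have "dist (rcont_rep L u z) (rcont_rep L u s) < e" if z: "s < z" "z < min b L" for z
      proof -
        have "((\<lambda>w. dist (u w) (rcont_rep L u s)) \<longlongrightarrow> dist (rcont_rep L u z) (rcont_rep L u s)) (at_right z)"
          using tendsto_rcont_rep[OF assms, of z] 2 z
          by (intro tendsto_dist tendsto_const) (auto simp: rcont_side_def max_def)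
        moreover have "eventually (\<lambda>w. dist (u w) (rcont_rep L u s) \<le> e / 2) (at_right z)"
          unfolding eventually_at_right_field using b(2) z by (intro exI[of _ b]) (auto intro: less_imp_le)
        ultimately have "dist (rcont_rep L u z) (rcont_rep L u s) \<le> e / 2"
          by (intro tendsto_upperbound) auto
        then show ?thesis using \<open>0 < e\<close> by auto
      qed
      then show "eventually (\<lambda>z. dist (rcont_rep L u z) (rcont_rep L u s) < e) (at_right s)"
        unfolding eventually_at_right_field using b(1) 2 by (intro exI[of _ "min b L"]) auto
    qed
  qed
qed

lemma rcont_rep_left:
  assumes "BV L u" "0 < L" "0 < s" "s \<le> L"
  shows "(rcont_rep L u \<longlongrightarrow> llim u s) (at_left s)"
proof (rule tendstoI)
  fix e :: real assume "0 < e"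
  then have "eventually (\<lambda>z. dist (u z) (llim u s) < e / 2) (at_left s)"
    using tendstoD[OF BV_tendsto_llim[OF assms(1,3,4)], of "e / 2"] by auto
  then obtain b where b: "b < s" "\<And>z. b < z \<Longrightarrow> z < s \<Longrightarrow> dist (u z) (llim u s) < e / 2"
    by (auto simp: eventually_at_left_field)
  have "dist (rcont_rep L u z) (llim u s) < e" if z: "max b 0 < z" "z < s" for z
  proof -
    have "((\<lambda>w. dist (u w) (llim u s)) \<longlongrightarrow> dist (rcont_rep L u z) (llim u s)) (at_right z)"
      using tendsto_rcont_rep[OF assms(1,2), of z] assms z
      by (intro tendsto_dist tendsto_const) (simp add: rcont_side_def)
    moreover have "eventually (\<lambda>w. dist (u w) (llim u s) \<le> e / 2) (at_right z)"
      unfolding eventually_at_right_field using b(2) z by (intro exI[of _ s]) (auto intro: less_imp_le)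
    ultimately have "dist (rcont_rep L u z) (llim u s) \<le> e / 2"
      by (intro tendsto_upperbound) auto
    then show ?thesis using \<open>0 < e\<close> by auto
  qed
  then show "eventually (\<lambda>z. dist (rcont_rep L u z) (llim u s) < e) (at_left s)"
    unfolding eventually_at_left_field using b(1) assms by (intro exI[of _ "max b 0"]) auto
qed

lemma rcont_rep_eq_rlim: "0 \<le> s \<Longrightarrow> s < L \<Longrightarrow> rcont_rep L u s = rlim u s"
  by (auto simp: rcont_rep_def intro: arg_cong[of _ _ "rlim u"])

section \<open>The Jordan variation function and its continuity\<close>

definition variation_fun :: "real \<Rightarrow> (real \<Rightarrow> real) \<Rightarrow> real \<Rightarrow> real" where
  "variation_fun L u s = enn2real (variation {0..s} (rcont_rep L u))"

text \<open>Minimality among control functions. Upper bounds for the variation are proved below by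
  exhibiting a suitable \<open>K\<close>.\<close>

lemma variation_fun_le:
  assumes "0 \<le> b" "\<And>x y. 0 \<le> x \<Longrightarrow> x \<le> y \<Longrightarrow> y \<le> b \<Longrightarrow> \<bar>rcont_rep L u y - rcont_rep L u x\<bar> \<le> K y - K x"
  shows "variation_fun L u b \<le> K b - K 0"
proof -
  have "0 \<le> K b - K 0" using assms(2)[of 0 b] assms(1) by auto
  moreover have "variation {0..b} (rcont_rep L u) \<le> ennreal (K b - K 0)"
    using assms by (intro variation_le_control) (auto simp: dist_real_def abs_minus_commute)
  ultimately show ?thesis unfolding variation_fun_def by (simp add: enn2real_leI)
qed

lemma variation_fun_nonpos: "s \<le> 0 \<Longrightarrow> variation_fun L u s = 0"
proof -
  assume "s \<le> 0"
  then consider "s < 0" | "s = 0" by linarith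
  then have "variation {0..s} (rcont_rep L u) \<le> 0"
  proof cases
    case 1
    then show ?thesis unfolding variation_def by (intro SUP_least) auto
  next
    case 2
    have "variation {0..0} (rcont_rep L u) \<le> ennreal (0 - 0)"
      by (rule variation_le_control[where K="\<lambda>_. 0"]) (auto dest: antisym)
    then show ?thesis using 2 by simp
  qed
  then show ?thesis by (simp add: variation_fun_def)
qed

lemma pos_variation_eq: "pos_variation L u s = (variation_fun L u s + (rcont_rep L u s - rcont_rep L u 0)) / 2"
  by (simp add: pos_variation_def variation_fun_def)

lemma neg_variation_eq: "neg_variation L u s = (variation_fun L u s - (rcont_rep L u s - rcont_rep L u 0)) / 2"
  by (simp add: neg_variation_def variation_fun_def)

context
  fixes L :: real and u :: "real \<Rightarrow> real"
  assumes BV: "BV L u" and L: "0 < L"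
begin

lemma variation_fun_control: 
  assumes "x \<le> y"
  shows "\<bar>rcont_rep L u y - rcont_rep L u x\<bar> \<le> variation_fun L u y - variation_fun L u x"
proof -
  \<comment> \<open>This \<open>K\<close> only ensures that the variations are finite;
    \<open>enn2real\<close> would turn an infinite one into 0.\<close>
  obtain K where K: "\<And>x y. x \<le> y \<Longrightarrow> \<bar>rcont_rep L u y - rcont_rep L u x\<bar> \<le> K y - K x"
    using rcont_rep_control[OF BV L] by blast
  have fin: "variation {0..y} (rcont_rep L u) < \<infinity>" if "0 \<le> y" for y
    by (rule le_less_trans[OF variation_le_control[OF that, of _ K]])
      (use K in \<open>auto simp: dist_real_def abs_minus_commute\<close>)
  have *: "\<bar>rcont_rep L u y - rcont_rep L u x\<bar> \<le> variation_fun L u y - variation_fun L u x" if "0 \<le> x" "x \<le> y" for x y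
    using dist_le_variation_diff[of "{0..x}" "{0..y}" x y "rcont_rep L u"] that fin[of y]
    by (auto simp: variation_fun_def dist_real_def abs_minus_commute)
  have z: "rcont_rep L u x = rcont_rep L u 0" if "x \<le> 0" for x
    using that by (auto simp: rcont_rep_def)
  consider "0 \<le> x" | "x < 0" "y < 0" | "x < 0" "0 \<le> y" by linarith
  then show ?thesis
    using *[of x y] *[of 0 y] z[of x] z[of y] variation_fun_nonpos[of x] variation_fun_nonpos[of y] variation_fun_nonpos[of 0] assms
    by cases auto
qed

lemma variation_fun_mono: "x \<le> y \<Longrightarrow> variation_fun L u x \<le> variation_fun L u y"
  using variation_fun_control[of x y] abs_ge_zero by (smt (verit))

text \<open>Stopping the variation at \<open>L\<close> still gives a control function, because
  \<open>rcont_rep\<close> is constant from \<open>L\<close> on; minimality does the rest.\<close>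

lemma variation_fun_ge: 
  assumes "L \<le> s"
  shows "variation_fun L u s = variation_fun L u L"
proof -
  have c: "rcont_rep L u x = rcont_rep L u (min L x)" for x
    using L by (auto simp: rcont_rep_def min_def)
  have "variation_fun L u s \<le> variation_fun L u (min L s) - variation_fun L u (min L 0)"
  proof (rule variation_fun_le)
    fix x y :: real assume "0 \<le> x" "x \<le> y" "y \<le> s"
    then show "\<bar>rcont_rep L u y - rcont_rep L u x\<bar> \<le> variation_fun L u (min L y) - variation_fun L u (min L x)"
      using variation_fun_control[of "min L x" "min L y"] c[of x] c[of y] by simp
  qed (use assms L in auto)
  then show ?thesis using variation_fun_mono[of L s] assms L by (simp add: min_def variation_fun_nonpos)
qed

text \<open>The variation function is the least function controlling the increments; lowering it beyond
  \<open>s\<close> by the size of its right jump at \<open>s\<close> yields another such function.\<close>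

lemma variation_fun_right: "(variation_fun L u \<longlongrightarrow> variation_fun L u s) (at_right s)"
proof -
  obtain l where l: "(variation_fun L u \<longlongrightarrow> l) (at_right s)"
    using mono_right_limit[of "s - 1" "s + 1" "variation_fun L u" "variation_fun L u (s - 1)" s]
      variation_fun_mono by auto
  have ge: "variation_fun L u s \<le> l"
    using l by (rule tendsto_lowerbound)
      (auto intro!: variation_fun_mono eventually_mono[OF eventually_at_right_less])
  have "l \<le> variation_fun L u s"
  proof (cases "s < 0")
    case True
    have "eventually (\<lambda>z. variation_fun L u z \<le> 0) (at_right s)"
      using True order_tendstoD(2)[OF tendsto_ident_at, of s 0 "{s<..}"]
      by (auto simp: variation_fun_nonpos elim: eventually_mono)
    then show ?thesis
      using True tendsto_upperbound[OF l] by (simp add: variation_fun_nonpos)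
  next
    case False
    \<comment> \<open>Right-continuity of \<open>rcont_rep\<close> allows the left end of the
      increment to be moved down to \<open>s\<close>, while the variation there is replaced by its
      right limit \<open>l\<close>.\<close>
    have far: "\<bar>rcont_rep L u y - rcont_rep L u s\<bar> \<le> variation_fun L u y - l" if "s < y" for y
    proof (rule tendsto_le)
      show "((\<lambda>z. variation_fun L u y - variation_fun L u z) \<longlongrightarrow> variation_fun L u y - l) (at_right s)"
        by (intro tendsto_intros l)
      show "((\<lambda>z. \<bar>rcont_rep L u y - rcont_rep L u z\<bar>) \<longlongrightarrow> \<bar>rcont_rep L u y - rcont_rep L u s\<bar>) (at_right s)"
        by (intro tendsto_intros rcont_rep_right BV L)
      show "eventually (\<lambda>z. \<bar>rcont_rep L u y - rcont_rep L u z\<bar> \<le> variation_fun L u y - variation_fun L u z) (at_right s)"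
        by (rule eventually_mono[OF order_tendstoD(2)[OF tendsto_ident_at that]])
          (auto intro: variation_fun_control)
    qed auto
    let ?K = "\<lambda>x. if x \<le> s then variation_fun L u x else variation_fun L u x - (l - variation_fun L u s)"
    have "variation_fun L u (s + 1) \<le> ?K (s + 1) - ?K 0"
    proof (rule variation_fun_le)
      fix x y :: real assume "0 \<le> x" "x \<le> y" "y \<le> s + 1"
      then show "\<bar>rcont_rep L u y - rcont_rep L u x\<bar> \<le> ?K y - ?K x"
        using variation_fun_control[of x y] far[of y] variation_fun_control[of x s] by (auto; linarith)
    qed (use False in auto)
    then show ?thesis using False by (simp add: variation_fun_nonpos)
  qed
  with ge l show ?thesis by simp
qed

text \<open>Mirror image of the previous argument: the variation is lowered from \<open>s\<close> on
  by its left jump. Left-continuity of \<open>rcont_rep\<close> has to be assumed, as it fails at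
  jumps of \<open>u\<close>.\<close>

lemma variation_fun_left: 
  assumes "0 < s" and left: "(rcont_rep L u \<longlongrightarrow> rcont_rep L u s) (at_left s)"
  shows "(variation_fun L u \<longlongrightarrow> variation_fun L u s) (at_left s)"
proof -
  obtain l where l: "(variation_fun L u \<longlongrightarrow> l) (at_left s)"
    using mono_left_limit[of "s - 1" "s + 1" "variation_fun L u" "variation_fun L u (s + 1)" s]
      variation_fun_mono by auto
  have le: "l \<le> variation_fun L u s"
    using l by (rule tendsto_upperbound)
      (auto intro!: variation_fun_mono eventually_mono[OF eventually_at_left_real[of "s - 1"]])
  have far: "\<bar>rcont_rep L u s - rcont_rep L u x\<bar> \<le> l - variation_fun L u x" if "x < s" for x
  proof (rule tendsto_le)
    show "((\<lambda>z. variation_fun L u z - variation_fun L u x) \<longlongrightarrow> l - variation_fun L u x) (at_left s)"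
      by (intro tendsto_intros l)
    show "((\<lambda>z. \<bar>rcont_rep L u z - rcont_rep L u x\<bar>) \<longlongrightarrow> \<bar>rcont_rep L u s - rcont_rep L u x\<bar>) (at_left s)"
      by (intro tendsto_intros left)
    show "eventually (\<lambda>z. \<bar>rcont_rep L u z - rcont_rep L u x\<bar> \<le> variation_fun L u z - variation_fun L u x) (at_left s)"
      by (rule eventually_mono[OF order_tendstoD(1)[OF tendsto_ident_at that]])
        (auto intro: variation_fun_control)
  qed auto
  let ?K = "\<lambda>x. if x < s then variation_fun L u x else variation_fun L u x - (variation_fun L u s - l)"
  have "variation_fun L u s \<le> ?K s - ?K 0"
  proof (rule variation_fun_le)
    fix x y :: real assume "0 \<le> x" "x \<le> y" "y \<le> s"
    then show "\<bar>rcont_rep L u y - rcont_rep L u x\<bar> \<le> ?K y - ?K x"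
      using variation_fun_control[of x y] far[of x] variation_fun_control[of s y] by (auto; linarith)
  qed (use assms in auto)
  with le l assms show ?thesis by (simp add: variation_fun_nonpos)
qed

lemma mono_pos_variation: "x \<le> y \<Longrightarrow> pos_variation L u x \<le> pos_variation L u y"
  using variation_fun_control[of x y] by (simp add: pos_variation_eq)

lemma mono_neg_variation: "x \<le> y \<Longrightarrow> neg_variation L u x \<le> neg_variation L u y"
  using variation_fun_control[of x y] by (simp add: neg_variation_eq)

lemma right_pos_variation: "continuous (at_right s) (pos_variation L u)"
  unfolding continuous_within pos_variation_eq[abs_def]
  by (intro tendsto_intros variation_fun_right rcont_rep_right BV L) auto

lemma right_neg_variation: "continuous (at_right s) (neg_variation L u)"
  unfolding continuous_within neg_variation_eq[abs_def]
  by (intro tendsto_intros variation_fun_right rcont_rep_right BV L) auto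

end

lemma rcont_rep_uminus:
  fixes u :: "real \<Rightarrow> real"
  assumes "BV L u" "0 < L"
  shows "rcont_rep L (\<lambda>s. - u s) s = - rcont_rep L u s"
  using tendsto_unique[OF rcont_side_neq_bot tendsto_rcont_rep[OF BV_uminus[OF assms(1)] assms(2)]
      tendsto_minus[OF tendsto_rcont_rep[OF assms]]] .

text \<open>A change of sign preserves the variation and exchanges the two parts. This serves the
  entries \<open>- \<theta>\<close> and \<open>- \<phi>\<close> of \<open>Omega\<close>.\<close>

lemma
  fixes u :: "real \<Rightarrow> real"
  assumes "BV L u" "0 < L"
  shows pos_variation_uminus: "pos_variation L (\<lambda>s. - u s) = neg_variation L u"
    and neg_variation_uminus: "neg_variation L (\<lambda>s. - u s) = pos_variation L u"
proof -
  have "variation S (rcont_rep L (\<lambda>s. - u s)) = variation S (rcont_rep L u)" for S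
    by (simp add: variation_def rcont_rep_uminus[OF assms] dist_minus)
  then show "pos_variation L (\<lambda>s. - u s) = neg_variation L u" "neg_variation L (\<lambda>s. - u s) = pos_variation L u"
    by (auto simp: fun_eq_iff pos_variation_def neg_variation_def rcont_rep_uminus[OF assms])
qed

section \<open>The derivative measure\<close>

lemma finite_borel_measure_interval_measure:
  fixes F :: "real \<Rightarrow> real"
  assumes mono: "\<And>x y. x \<le> y \<Longrightarrow> F x \<le> F y" and right: "\<And>a. continuous (at_right a) F"
    and bounds: "\<And>x. m \<le> F x \<and> F x \<le> M"
  shows "finite_borel_measure (interval_measure F)"
proof (intro finite_borel_measure.intro finite_measureI finite_borel_measure_axioms.intro)
  have "(\<lambda>n. emeasure (interval_measure F) {-real n<..real n})
      \<longlonglongrightarrow> emeasure (interval_measure F) (\<Union>n. {-real n<..real n})"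
    by (intro Lim_emeasure_incseq) (auto simp: incseq_def)
  then have lim: "(\<lambda>n. emeasure (interval_measure F) {-real n<..real n})
      \<longlonglongrightarrow> emeasure (interval_measure F) UNIV"
    by (simp add: UN_Ioc_eq_UNIV)
  have "emeasure (interval_measure F) {-real n<..real n} \<le> ennreal (M - m)" for n
    using bounds[of "real n"] bounds[of "- real n"]
    by (subst emeasure_interval_measure_Ioc) (auto intro: mono right intro!: ennreal_leI)
  then have "emeasure (interval_measure F) UNIV \<le> ennreal (M - m)"
    by (intro tendsto_upperbound[OF lim]) auto
  then show "emeasure (interval_measure F) (space (interval_measure F)) \<noteq> \<infinity>"
    by (auto simp: top_unique)
qed auto

lemma (in finite_borel_measure) measure_singleton_tendsto:
  assumes "0 < d"
  shows "(\<lambda>n. measure M {s - d / real (Suc n)<..s}) \<longlonglongrightarrow> measure M {s}"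
proof -
  have "(\<lambda>n. measure M {s - d / real (Suc n)<..s}) \<longlonglongrightarrow> measure M (\<Inter>n. {s - d / real (Suc n)<..s})"
  proof (intro finite_Lim_measure_decseq)
    have "d / real (Suc n) \<le> d / real (Suc m)" if "m \<le> n" for m n
      using assms that by (intro divide_left_mono) auto
    then have "s - d / real (Suc m) \<le> s - d / real (Suc n)" if "m \<le> n" for m n
      using that by (intro diff_left_mono)
    then show "decseq (\<lambda>n. {s - d / real (Suc n)<..s})"
      unfolding decseq_def
      by (intro allI impI subsetI) (metis greaterThanAtMost_iff order.strict_trans1)
  qed auto
  moreover have "(\<Inter>n. {s - d / real (Suc n)<..s}) = {s}"
  proof -
    have "x = s" if "\<And>n. s - d / real (Suc n) < x" "x \<le> s" for x
    proof (rule ccontr)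
      assume "x \<noteq> s"
      then have "0 < (s - x) / d" using that assms by simp
      then obtain n where "inverse (real (Suc n)) < (s - x) / d"
        using reals_Archimedean by blast
      then have "d / real (Suc n) < s - x" using assms by (simp add: field_simps)
      with that(1)[of n] show False by simp
    qed
    then show ?thesis using assms by auto
  qed
  ultimately show ?thesis by simp
qed

text \<open>This is the distribution function of \<open>density M (indicator E)\<close>, a finite
  measure whose atoms are those of \<open>M\<close> in \<open>E\<close>.\<close>

lemma (in finite_borel_measure) cdf_restricted_continuous:
  assumes E: "E \<in> sets borel" and atoms: "\<And>s. s \<in> E \<Longrightarrow> measure M {s} = 0"
  shows "isCont (\<lambda>s. measure M (E \<inter> {..s})) x"
proof -
  let ?M = "density M (indicator E)"
  have m: "measure ?M A = measure M (E \<inter> A)" if "A \<in> sets borel" for A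
    using E that by (intro measure_restricted) auto
  interpret R: finite_borel_measure ?M
  proof (intro finite_borel_measure.intro finite_measureI finite_borel_measure_axioms.intro)
    show "emeasure ?M (space ?M) \<noteq> \<infinity>"
      using E by (subst emeasure_restricted) (auto simp: emeasure_eq_measure)
  qed (simp add: M_is_borel)
  have "measure M (E \<inter> {x}) = 0"
    using atoms by (cases "x \<in> E") auto
  then have "isCont (cdf ?M) x" by (simp add: R.isCont_cdf m)
  moreover have "cdf ?M = (\<lambda>s. measure M (E \<inter> {..s}))" by (simp add: fun_eq_iff cdf_def m)
  ultimately show ?thesis by simp
qed

lemma (in finite_borel_measure) set_integral_diff_const_bound:
  fixes f :: "real \<Rightarrow> real"
  assumes B: "B \<in> sets borel" and f: "set_borel_measurable borel B f"
    and c: "\<And>s. s \<in> B \<Longrightarrow> \<bar>f s - f0\<bar> \<le> c"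
  shows "\<bar>(LINT s:B|M. f s) - f0 * measure M B\<bar> \<le> c * measure M B"
proof -
  have meas: "(\<lambda>s. indicator B s * f s) \<in> borel_measurable M"
    using f M_is_borel measurable_cong_sets[OF M_is_borel refl]
    by (auto simp: set_borel_measurable_def)
  have B': "B \<in> sets M" using B M_is_borel by simp
  have i0: "integrable M (\<lambda>s. indicator B s * f0)"
    using B' by (intro integrable_mult_left integrable_real_indicator) (auto simp: emeasure_eq_measure)
  have int: "integrable M (\<lambda>s. indicator B s * f s)"
  proof (rule integrable_const_bound[where B="\<bar>f0\<bar> + \<bar>c\<bar>"])
    show "AE s in M. norm (indicator B s * f s) \<le> \<bar>f0\<bar> + \<bar>c\<bar>"
      using c by (intro always_eventually) (auto simp: indicator_def dest!: c)
  qed (rule meas)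
  have eq: "(LINT s:B|M. f s) - f0 * measure M B = (\<integral>s. indicator B s * (f s - f0) \<partial>M)"
    using B' int i0 by (simp add: set_lebesgue_integral_def right_diff_distrib)
  have "norm (\<integral>s. indicator B s * (f s - f0) \<partial>M) \<le> (\<integral>s. indicator B s * c \<partial>M)"
  proof (rule order_trans[OF integral_norm_bound], rule integral_mono)
    show "integrable M (\<lambda>s. norm (indicator B s * (f s - f0)))"
      using int i0 by (intro integrable_norm) (simp add: right_diff_distrib)
    show "integrable M (\<lambda>s. indicator B s * c)"
      using B' by (intro integrable_mult_left integrable_real_indicator) (auto simp: emeasure_eq_measure)
  qed (use c in \<open>auto simp: indicator_def\<close>)
  then show ?thesis using B' eq by (simp add: mult.commute)
qed

section \<open>Signed measure and mass of a \<open>BV\<close> function\<close>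

abbreviation pos_measure :: "real \<Rightarrow> (real \<Rightarrow> real) \<Rightarrow> real measure" where
  "pos_measure L u \<equiv> interval_measure (pos_variation L u)"

abbreviation neg_measure :: "real \<Rightarrow> (real \<Rightarrow> real) \<Rightarrow> real measure" where
  "neg_measure L u \<equiv> interval_measure (neg_variation L u)"

text \<open>The total variation measure \<open>|Du|\<close>, with the normalization of \<open>deriv_measure\<close>.\<close>

definition deriv_mass :: "real \<Rightarrow> (real \<Rightarrow> real) \<Rightarrow> real set \<Rightarrow> real" where
  "deriv_mass L u B = measure (pos_measure L u) (B \<inter> {0<..<L}) + measure (neg_measure L u) (B \<inter> {0<..<L})"

text \<open>Finite additivity is what cutting an interval at the finitely many points of
  \<open>S n\<close> requires.\<close>

definition additive_content :: "(real set \<Rightarrow> 'a::real_normed_vector) \<Rightarrow> bool" where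
  "additive_content N \<longleftrightarrow> (\<forall>A B. A \<in> sets borel \<longrightarrow> B \<in> sets borel \<longrightarrow> A \<inter> B = {} \<longrightarrow> N (A \<union> B) = N A + N B)"

lemma additive_contentD:
  "additive_content N \<Longrightarrow> A \<in> sets borel \<Longrightarrow> B \<in> sets borel \<Longrightarrow> A \<inter> B = {} \<Longrightarrow> N (A \<union> B) = N A + N B"
  by (simp add: additive_content_def)

lemma additive_content_empty: "additive_content N \<Longrightarrow> N {} = 0"
  using additive_contentD[of N "{}" "{}"] by simp

lemma content_mono:
  fixes N :: "real set \<Rightarrow> real"
  assumes "additive_content N" "\<And>A. 0 \<le> N A" "A \<subseteq> B" "A \<in> sets borel" "B \<in> sets borel"
  shows "N A \<le> N B"
proof -
  have "N B = N A + N (B - A)"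
    using additive_contentD[OF assms(1), of A "B - A"] assms by (simp add: Un_absorb1)
  then show ?thesis using assms(2)[of "B - A"] by simp
qed

lemma content_finite_sum:
  assumes "additive_content N" "finite F"
  shows "N F = (\<Sum>s\<in>F. N {s})"
  using assms(2)
proof (induction F)
  case empty
  then show ?case using additive_content_empty[OF assms(1)] by simp
next
  case (insert s F)
  then show ?case
    using additive_contentD[OF assms(1), of "{s}" F] by (simp add: finite_imp_closed borel_closed)
qed

lemma additive_content_restrict:
  assumes "additive_content N" "E \<in> sets borel"
  shows "additive_content (\<lambda>A. N (A \<inter> E))"
  unfolding additive_content_def
proof (intro allI impI)
  fix A B :: "real set" assume "A \<in> sets borel" "B \<in> sets borel" "A \<inter> B = {}"
  moreover have "(A \<union> B) \<inter> E = (A \<inter> E) \<union> (B \<inter> E)" by auto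
  ultimately show "N ((A \<union> B) \<inter> E) = N (A \<inter> E) + N (B \<inter> E)"
    using additive_contentD[OF assms(1), of "A \<inter> E" "B \<inter> E"] assms(2) by auto
qed

lemma additive_content_scale: "additive_content N \<Longrightarrow> additive_content (\<lambda>A. c *\<^sub>R N A)"
  by (simp add: additive_content_def scaleR_add_right)

lemma additive_content_sum:
  "(\<And>i. i \<in> I \<Longrightarrow> additive_content (N i)) \<Longrightarrow> additive_content (\<lambda>A. \<Sum>i\<in>I. N i A)"
  by (simp add: additive_content_def sum.distrib)

lemma deriv_measure_empty [simp]: "deriv_measure L u {} = 0"
  by (simp add: deriv_measure_def)

lemma deriv_mass_nonneg: "0 \<le> deriv_mass L u A"
  by (simp add: deriv_mass_def)

lemma abs_deriv_measure_le: "\<bar>deriv_measure L u A\<bar> \<le> deriv_mass L u A"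
proof -
  have "\<bar>a - b\<bar> \<le> a + b" if "0 \<le> a" "0 \<le> b" for a b :: real using that by auto
  then show ?thesis unfolding deriv_measure_def deriv_mass_def by simp
qed

context
  fixes L :: real and u :: "real \<Rightarrow> real"
  assumes BV: "BV L u" and L: "0 < L"
begin

text \<open>The Jordan parts are bounded, so the measures are finite and the real-valued
  \<open>measure\<close> never hides an infinite value.\<close>

lemma finite_borel_pos_measure: "finite_borel_measure (pos_measure L u)"
  and finite_borel_neg_measure: "finite_borel_measure (neg_measure L u)"
proof -
  have b: "0 \<le> variation_fun L u x" "variation_fun L u x \<le> variation_fun L u L" for x
    using variation_fun_mono[OF BV L, of x L] variation_fun_ge[OF BV L, of x] variation_fun_mono[OF BV L, of 0 x]
      variation_fun_nonpos[of x] variation_fun_nonpos[of 0] by (cases "x \<le> L"; cases "x \<le> 0"; simp)+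
  have c: "\<bar>rcont_rep L u x - rcont_rep L u 0\<bar> \<le> variation_fun L u L" for x
  proof (cases "0 \<le> x")
    case True
    then show ?thesis using variation_fun_control[OF BV L True] b[of x] by (simp add: variation_fun_nonpos)
  next
    case False
    then show ?thesis using b[of x] by (simp add: rcont_rep_def)
  qed
  have bp: "- variation_fun L u L \<le> pos_variation L u x \<and> pos_variation L u x \<le> variation_fun L u L" for x
    using b[of x] c[of x] by (simp add: pos_variation_eq abs_le_iff)
  have bm: "- variation_fun L u L \<le> neg_variation L u x \<and> neg_variation L u x \<le> variation_fun L u L" for x
    using b[of x] c[of x] by (simp add: neg_variation_eq abs_le_iff)
  show "finite_borel_measure (pos_measure L u)"
    by (rule finite_borel_measure_interval_measure[where m="- variation_fun L u L" and M="variation_fun L u L"])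
      (use bp mono_pos_variation[OF BV L] right_pos_variation[OF BV L] in auto)
  show "finite_borel_measure (neg_measure L u)"
    by (rule finite_borel_measure_interval_measure[where m="- variation_fun L u L" and M="variation_fun L u L"])
      (use bm mono_neg_variation[OF BV L] right_neg_variation[OF BV L] in auto)
qed

interpretation p: finite_borel_measure "pos_measure L u" by (rule finite_borel_pos_measure)
interpretation m: finite_borel_measure "neg_measure L u" by (rule finite_borel_neg_measure)

lemma pos_measure_Ioc: "x \<le> y \<Longrightarrow> measure (pos_measure L u) {x<..y} = pos_variation L u y - pos_variation L u x"
  by (rule measure_interval_measure_Ioc) (use mono_pos_variation[OF BV L] right_pos_variation[OF BV L] in auto)

lemma neg_measure_Ioc: "x \<le> y \<Longrightarrow> measure (neg_measure L u) {x<..y} = neg_variation L u y - neg_variation L u x"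
  by (rule measure_interval_measure_Ioc) (use mono_neg_variation[OF BV L] right_neg_variation[OF BV L] in auto)

lemma deriv_measure_Ioc:
  assumes "0 \<le> x" "x \<le> y" "y < L"
  shows "deriv_measure L u {x<..y} = rcont_rep L u y - rcont_rep L u x"
proof -
  have "{x<..y} \<inter> {0<..<L} = {x<..y}" using assms by auto
  then show ?thesis
    using assms by (simp add: deriv_measure_def pos_measure_Ioc neg_measure_Ioc pos_variation_eq neg_variation_eq
        field_simps)
qed

lemma additive_content_deriv_mass: "additive_content (deriv_mass L u)"
  unfolding additive_content_def
proof (intro allI impI)
  fix A B :: "real set" assume AB: "A \<in> sets borel" "B \<in> sets borel" "A \<inter> B = {}"
  let ?A = "A \<inter> {0<..<L}" and ?B = "B \<inter> {0<..<L}"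
  have "(A \<union> B) \<inter> {0<..<L} = ?A \<union> ?B" "?A \<inter> ?B = {}" using AB by auto
  moreover have "measure (pos_measure L u) (?A \<union> ?B) = measure (pos_measure L u) ?A + measure (pos_measure L u) ?B"
    by (rule p.finite_measure_Union) (use AB in auto)
  moreover have "measure (neg_measure L u) (?A \<union> ?B) = measure (neg_measure L u) ?A + measure (neg_measure L u) ?B"
    by (rule m.finite_measure_Union) (use AB in auto)
  ultimately show "deriv_mass L u (A \<union> B) = deriv_mass L u A + deriv_mass L u B"
    by (simp add: deriv_mass_def)
qed

text \<open>The intervals from \<open>?x n\<close> to \<open>s\<close> shrink to the point
  \<open>s\<close>. For the signed measure this yields the jump at once. The mass is subtler, since
  a positive and a negative atom could cancel; \<open>variation_fun_left\<close> excludes this where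
  \<open>u\<close> does not jump.\<close>

lemma
  assumes "0 < s" "s < L"
  shows deriv_measure_singleton: "deriv_measure L u {s} = rlim u s - llim u s"
    and deriv_mass_singleton_eq_0: "llim u s = rlim u s \<Longrightarrow> deriv_mass L u {s} = 0"
proof -
  have sing: "{s} \<inter> {0<..<L} = {s}" using assms by auto
  let ?x = "\<lambda>n. s - s / real (Suc n)"
  have x: "0 \<le> ?x n" "?x n < s" for n
    using assms by (auto simp: field_simps)
  have "filterlim ?x (at_left s) sequentially"
  proof (rule tendsto_imp_filterlim_at_left)
    have "(\<lambda>n. s - s * inverse (real (Suc n))) \<longlonglongrightarrow> s - s * 0"
      by (intro tendsto_intros LIMSEQ_inverse_real_of_nat)
    then show "?x \<longlonglongrightarrow> s" by (simp add: field_simps)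
  qed (use x in auto)
  note fl = filterlim_compose[OF _ this]
  have v: "(\<lambda>n. rcont_rep L u (?x n)) \<longlonglongrightarrow> llim u s"
    using assms by (intro fl rcont_rep_left BV L) auto
  have "(\<lambda>n. measure (pos_measure L u) {?x n<..s} - measure (neg_measure L u) {?x n<..s})
      \<longlonglongrightarrow> measure (pos_measure L u) {s} - measure (neg_measure L u) {s}"
    using assms by (intro tendsto_diff p.measure_singleton_tendsto m.measure_singleton_tendsto) auto
  moreover have "measure (pos_measure L u) {?x n<..s} - measure (neg_measure L u) {?x n<..s}
      = rcont_rep L u s - rcont_rep L u (?x n)" for n
    using x[of n] by (simp add: pos_measure_Ioc neg_measure_Ioc pos_variation_eq neg_variation_eq field_simps)
  ultimately have "(\<lambda>n. rcont_rep L u s - rcont_rep L u (?x n)) \<longlonglongrightarrow> deriv_measure L u {s}"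
    by (simp add: deriv_measure_def sing)
  moreover have "(\<lambda>n. rcont_rep L u s - rcont_rep L u (?x n)) \<longlonglongrightarrow> rcont_rep L u s - llim u s"
    by (intro tendsto_intros v)
  ultimately show "deriv_measure L u {s} = rlim u s - llim u s"
    using LIMSEQ_unique assms by (fastforce simp: rcont_rep_eq_rlim)
  assume eq: "llim u s = rlim u s"
  have "(variation_fun L u \<longlongrightarrow> variation_fun L u s) (at_left s)"
    using rcont_rep_left[OF BV L, of s] eq assms by (intro variation_fun_left BV L) (auto simp: rcont_rep_eq_rlim)
  then have "(\<lambda>n. variation_fun L u s - variation_fun L u (?x n)) \<longlonglongrightarrow> variation_fun L u s - variation_fun L u s"
    by (intro tendsto_intros fl)
  moreover have "(\<lambda>n. measure (pos_measure L u) {?x n<..s} + measure (neg_measure L u) {?x n<..s})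
      \<longlonglongrightarrow> measure (pos_measure L u) {s} + measure (neg_measure L u) {s}"
    using assms by (intro tendsto_add p.measure_singleton_tendsto m.measure_singleton_tendsto) auto
  moreover have "measure (pos_measure L u) {?x n<..s} + measure (neg_measure L u) {?x n<..s}
      = variation_fun L u s - variation_fun L u (?x n)" for n
    using x[of n] by (simp add: pos_measure_Ioc neg_measure_Ioc pos_variation_eq neg_variation_eq field_simps)
  ultimately show "deriv_mass L u {s} = 0"
    using LIMSEQ_unique by (fastforce simp: deriv_mass_def sing)
qed

text \<open>The number \<open>f0\<close> is a frozen value of the integrand: 0 for a size bound, the
  value at an end point for a first-order expansion, or a component of a cone axis.\<close>

lemma deriv_integral_bound:
  assumes B: "B \<in> sets borel" and f: "continuous_on (B \<inter> {0<..<L}) f"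
    and c: "\<And>s. s \<in> B \<Longrightarrow> 0 < s \<Longrightarrow> s < L \<Longrightarrow> \<bar>f s - f0\<bar> \<le> c"
  shows "\<bar>deriv_integral L u f B - f0 * deriv_measure L u B\<bar> \<le> c * deriv_mass L u B"
proof -
  have B': "B \<inter> {0<..<L} \<in> sets borel" using B by auto
  have "set_borel_measurable borel (B \<inter> {0<..<L}) f"
    by (rule set_measurable_continuous_on) (use B' f in auto)
  then have "\<bar>(LINT s:B \<inter> {0<..<L}|pos_measure L u. f s) - f0 * measure (pos_measure L u) (B \<inter> {0<..<L})\<bar>
        \<le> c * measure (pos_measure L u) (B \<inter> {0<..<L})"
      "\<bar>(LINT s:B \<inter> {0<..<L}|neg_measure L u. f s) - f0 * measure (neg_measure L u) (B \<inter> {0<..<L})\<bar>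
        \<le> c * measure (neg_measure L u) (B \<inter> {0<..<L})"
    using B' c by (auto intro!: p.set_integral_diff_const_bound m.set_integral_diff_const_bound)
  then show ?thesis
    by (simp add: deriv_integral_def deriv_measure_def deriv_mass_def right_diff_distrib distrib_left abs_le_iff)
qed

lemma deriv_mass_continuous:
  assumes E: "E \<in> sets borel" and atoms: "\<And>s. s \<in> E \<Longrightarrow> 0 < s \<Longrightarrow> s < L \<Longrightarrow> deriv_mass L u {s} = 0"
  shows "isCont (\<lambda>s. deriv_mass L u (E \<inter> {..s})) x"
proof -
  have "measure (pos_measure L u) {s} = 0" "measure (neg_measure L u) {s} = 0"
    if "s \<in> E \<inter> {0<..<L}" for s
  proof -
    have "measure (pos_measure L u) {s} + measure (neg_measure L u) {s} = 0"
      using atoms[of s] that by (auto simp: deriv_mass_def)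
    moreover have "0 \<le> measure (pos_measure L u) {s}" "0 \<le> measure (neg_measure L u) {s}" by auto
    ultimately show "measure (pos_measure L u) {s} = 0" "measure (neg_measure L u) {s} = 0"
      by linarith+
  qed
  then have "isCont (\<lambda>s. measure (pos_measure L u) ((E \<inter> {0<..<L}) \<inter> {..s})
      + measure (neg_measure L u) ((E \<inter> {0<..<L}) \<inter> {..s})) x"
    using E by (intro continuous_add p.cdf_restricted_continuous m.cdf_restricted_continuous) auto
  moreover have "(E \<inter> {0<..<L}) \<inter> {..s} = (E \<inter> {..s}) \<inter> {0<..<L}" for s by auto
  ultimately show ?thesis by (simp add: deriv_mass_def)
qed

lemma deriv_mass_decseq:
  assumes "decseq E" "\<And>n. E n \<in> sets borel" "(\<Inter>n. E n) = {}"
  shows "(\<lambda>n. deriv_mass L u (E n)) \<longlonglongrightarrow> 0"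
proof -
  have d: "decseq (\<lambda>n. E n \<inter> {0<..<L})" using assms(1) by (auto simp: decseq_def)
  have "(\<lambda>n. deriv_mass L u (E n)) \<longlonglongrightarrow> measure (pos_measure L u) (\<Inter>n. E n \<inter> {0<..<L})
      + measure (neg_measure L u) (\<Inter>n. E n \<inter> {0<..<L})"
    unfolding deriv_mass_def using assms(2) d
    by (intro tendsto_add p.finite_Lim_measure_decseq m.finite_Lim_measure_decseq) auto
  then show ?thesis by (simp add: assms(3))
qed

end

lemma
  fixes u :: "real \<Rightarrow> real"
  assumes "BV L u" "0 < L"
  shows deriv_measure_uminus: "deriv_measure L (\<lambda>s. - u s) B = - deriv_measure L u B"
    and deriv_integral_uminus: "deriv_integral L (\<lambda>s. - u s) f B = - deriv_integral L u f B"
  by (simp_all add: deriv_measure_def deriv_integral_def pos_variation_uminus[OF assms]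
      neg_variation_uminus[OF assms])

text \<open>The zero function is its own negative, so each of these quantities equals its own
  negative.\<close>

lemma
  assumes "0 < L"
  shows deriv_measure_zero: "deriv_measure L (\<lambda>s. 0) B = 0"
    and deriv_integral_zero: "deriv_integral L (\<lambda>s. 0) f B = 0"
  using deriv_measure_uminus[OF BV_const[of L 0] assms, of B]
    deriv_integral_uminus[OF BV_const[of L 0] assms, of f B] by auto

text \<open>For monotone \<open>u\<close> the function \<open>rcont_rep\<close> controls itself, so
  the negative variation vanishes. Through this lemma the monotonicity of \<theta> enters the
  geometry: an error bounded by the mass of \<theta> becomes an error relative to its
  increment.\<close>

lemma deriv_mass_eq_deriv_measure_mono:
  fixes u :: "real \<Rightarrow> real"
  assumes "BV L u" "0 < L" "\<And>x y. 0 < x \<Longrightarrow> x \<le> y \<Longrightarrow> y < L \<Longrightarrow> u x \<le> u y"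
  shows "deriv_mass L u B = deriv_measure L u B"
proof -
  have mono: "rcont_rep L u x \<le> rcont_rep L u y" if xy: "x < y" for x y
  proof (cases "y \<le> 0 \<or> L \<le> x")
    case True
    then show ?thesis using xy assms(2) by (auto simp: rcont_rep_def)
  next
    case False
    let ?F = "rcont_side L x \<times>\<^sub>F rcont_side L y"
    have "?F \<noteq> bot" by (simp add: prod_filter_eq_bot)
    moreover have "((\<lambda>(a, b). u b) \<longlongrightarrow> rcont_rep L u y) ?F"
      unfolding split_def by (intro filterlim_compose[OF tendsto_rcont_rep[OF assms(1,2)] filterlim_snd])
    moreover have "((\<lambda>(a, b). u a) \<longlongrightarrow> rcont_rep L u x) ?F"
      unfolding split_def by (intro filterlim_compose[OF tendsto_rcont_rep[OF assms(1,2)] filterlim_fst])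
    moreover have "eventually (\<lambda>z. (case z of (a, b) \<Rightarrow> u a) \<le> (case z of (a, b) \<Rightarrow> u b)) ?F"
      by (rule eventually_mono[OF eventually_rcont_side_pair[of L x y]])
        (use False assms xy in auto)
    ultimately show ?thesis by (rule tendsto_le)
  qed
  have "variation_fun L u s \<le> rcont_rep L u s - rcont_rep L u 0" for s
  proof (cases "0 \<le> s")
    case True
    then show ?thesis
    proof (rule variation_fun_le)
      fix x y :: real assume "x \<le> y"
      then show "\<bar>rcont_rep L u y - rcont_rep L u x\<bar> \<le> rcont_rep L u y - rcont_rep L u x"
        using mono[of x y] by (cases "x = y") auto
    qed
  next
    case False
    then show ?thesis by (simp add: variation_fun_nonpos rcont_rep_def)
  qed
  then have "neg_variation L u s \<le> 0" for s by (simp add: neg_variation_eq)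
  moreover have "0 \<le> neg_variation L u s" for s
  proof (cases "0 \<le> s")
    case True
    then show ?thesis using mono_neg_variation[OF assms(1,2) True] by (simp add: neg_variation_eq variation_fun_nonpos)
  next
    case False
    then show ?thesis by (simp add: neg_variation_eq variation_fun_nonpos rcont_rep_def)
  qed
  ultimately have neg: "neg_variation L u s = 0" for s by (rule antisym)
  interpret m: finite_borel_measure "neg_measure L u" by (rule finite_borel_neg_measure[OF assms(1,2)])
  have "measure (neg_measure L u) {0<..L} = 0"
    using assms(2) by (subst neg_measure_Ioc[OF assms(1,2)]) (auto simp: neg)
  moreover have "measure (neg_measure L u) (B \<inter> {0<..<L}) \<le> measure (neg_measure L u) {0<..L}"
    by (rule m.finite_measure_mono) auto
  ultimately have "measure (neg_measure L u) (B \<inter> {0<..<L}) = 0" using measure_nonneg antisym by metis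
  then show ?thesis by (simp add: deriv_mass_def deriv_measure_def)
qed

lemma total_variation_singleton:
  assumes "\<mu> {} = 0"
  shows "total_variation \<mu> {s} = ennreal (norm (\<mu> {s}))"
  unfolding total_variation_def
proof (rule antisym)
  show "(SUP P\<in>{P. finite P \<and> disjoint P \<and> P \<subseteq> sets borel \<and> \<Union> P \<subseteq> {s}}. \<Sum>E\<in>P. ennreal (norm (\<mu> E)))
    \<le> ennreal (norm (\<mu> {s}))"
  proof (rule SUP_least)
    fix P assume "P \<in> {P. finite P \<and> disjoint P \<and> P \<subseteq> sets borel \<and> \<Union> P \<subseteq> {s}}"
    then have "P \<subseteq> {{}, {s}}" by auto
    then have "(\<Sum>E\<in>P. ennreal (norm (\<mu> E))) \<le> (\<Sum>E\<in>{{}, {s}}. ennreal (norm (\<mu> E)))"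
      by (intro sum_mono2) auto
    then show "(\<Sum>E\<in>P. ennreal (norm (\<mu> E))) \<le> ennreal (norm (\<mu> {s}))" using assms by simp
  qed
  show "ennreal (norm (\<mu> {s}))
    \<le> (SUP P\<in>{P. finite P \<and> disjoint P \<and> P \<subseteq> sets borel \<and> \<Union> P \<subseteq> {s}}. \<Sum>E\<in>P. ennreal (norm (\<mu> E)))"
    by (rule SUP_upper2[of "{{s}}"]) auto
qed

section \<open>Rotations, jumps and cones\<close>

lemma norm_vec_le_sum: "norm (x :: 'a::real_normed_vector^'n) \<le> (\<Sum>i\<in>UNIV. norm (x $ i))"
  by (simp add: norm_vec_def L2_set_le_sum)

lemma norm_matrix_le_sum: "norm (A :: real^'n^'m) \<le> (\<Sum>i\<in>UNIV. \<Sum>j\<in>UNIV. \<bar>A $ i $ j\<bar>)"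
  by (rule order_trans[OF norm_vec_le_sum]) (intro sum_mono, metis norm_le_l1_cart)

lemma abs_matrix_entry_le: "\<bar>(A :: real^'n^'m) $ i $ j\<bar> \<le> norm A"
  by (rule order_trans[OF component_le_norm_cart Finite_Cartesian_Product.norm_nth_le])

lemma norm_transpose: "norm (transpose (A :: real^'n^'m)) = norm A"
  unfolding norm_eq_sqrt_inner inner_vec_def transpose_def by (simp, subst sum.swap, simp)

lemma norm_matrix_vector_mult_le: "norm ((A :: real^'n^'m) *v x) \<le> norm A * norm x"
proof -
  have "norm (A *v x) = L2_set (\<lambda>i. norm (A $ i \<bullet> x)) UNIV"
    by (simp add: norm_vec_def matrix_vector_mul_component)
  also have "\<dots> \<le> L2_set (\<lambda>i. norm (A $ i) * norm x) UNIV"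
    by (intro L2_set_mono) (auto intro: Cauchy_Schwarz_ineq2)
  also have "\<dots> = norm A * norm x"
    by (simp add: norm_vec_def[of A] L2_set_left_distrib)
  finally show ?thesis .
qed

lemma norm_matrix_mult_le: "norm ((A :: real^'n^'m) ** (B :: real^'p^'n)) \<le> norm A * norm B"
proof -
  have row: "(A ** B) $ i = transpose B *v (A $ i)" for i
    by (simp add: vec_eq_iff matrix_matrix_mult_def matrix_vector_mult_def transpose_def mult.commute)
  have "norm (A ** B) = L2_set (\<lambda>i. norm (transpose B *v (A $ i))) UNIV"
    by (simp add: norm_vec_def[of "A ** B"] row)
  also have "\<dots> \<le> L2_set (\<lambda>i. norm (A $ i) * norm B) UNIV"
    using norm_matrix_vector_mult_le[of "transpose B"]
    by (intro L2_set_mono) (simp_all add: norm_transpose mult.commute[of _ "norm B"] del: transpose_matrix_vector)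
  also have "\<dots> = norm A * norm B"
    by (simp add: norm_vec_def[of A] L2_set_left_distrib)
  finally show ?thesis .
qed

lemma norm_le_sum_columns: "norm (A :: real^'n^'m) \<le> (\<Sum>j\<in>UNIV. norm (A *v axis j 1))"
proof -
  have "A *v axis j 1 = transpose A $ j" for j
    by (simp add: matrix_vector_mult_basis column_def transpose_def)
  then show ?thesis using norm_vec_le_sum[of "transpose A"] by (simp add: norm_transpose)
qed

lemma orthogonal_matrix_norm: "orthogonal_matrix (A :: real^'n^'n) \<Longrightarrow> norm (A *v x) = norm x"
  using orthogonal_transformation_matrix[of "(*v) A"] orthogonal_transformation_norm by fastforce

text \<open>The three columns are unit vectors. The crude 3, instead of the square root of 3, enters
  most constants below.\<close>

lemma norm_rotation_matrix_le: "rotation_matrix (A :: real^3^3) \<Longrightarrow> norm A \<le> 3"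
  using norm_le_sum_columns[of A] by (simp add: rotation_matrix_def orthogonal_matrix_norm sum_3)

text \<open>At orthogonal frames the coefficient of the measure equation is therefore the frame
  itself, and the equation becomes linear.\<close>

lemma matrix_inv_transpose_rotation:
  assumes "rotation_matrix (A :: real^3^3)"
  shows "matrix_inv (transpose A) = A"
proof -
  have "transpose A ** A = mat 1" "A ** transpose A = mat 1"
    using assms by (auto simp: rotation_matrix_def orthogonal_matrix_def)
  moreover from this have "\<exists>B. transpose A ** B = mat 1 \<and> B ** transpose A = mat 1"
    by blast
  then have "matrix_inv (transpose A) ** transpose A = mat 1"
    unfolding matrix_inv_def by (rule someI2_ex) simp
  ultimately show ?thesis by (metis matrix_mul_assoc matrix_mul_lid matrix_mul_rid)
qed

lemma closed_rotation_matrix: "closed {A :: real^3^3. rotation_matrix A}"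
proof -
  have "continuous_on UNIV (\<lambda>A :: real^3^3. transpose A ** A)"
    "continuous_on UNIV (\<lambda>A :: real^3^3. A ** transpose A)"
    unfolding matrix_matrix_mult_def transpose_def by (intro continuous_intros)+
  moreover have "continuous_on UNIV (\<lambda>A :: real^3^3. det A)"
    unfolding det_3 by (intro continuous_intros)
  ultimately show ?thesis
    unfolding rotation_matrix_def orthogonal_matrix_def
    by (intro closed_Collect_conj closed_Collect_eq continuous_on_const)
qed

lemma axis_rotation_mult_vec:
  "axis_rotation w \<alpha> *v x = cos \<alpha> *\<^sub>R x + sin \<alpha> *\<^sub>R cross3 w x + ((1 - cos \<alpha>) * (w \<bullet> x)) *\<^sub>R w"
  unfolding axis_rotation_def
proof (rule matrix_works)
  show "Vector_Spaces.linear (*s) (*s) (\<lambda>x. cos \<alpha> *\<^sub>R x + sin \<alpha> *\<^sub>R cross3 w x + ((1 - cos \<alpha>) * (w \<bullet> x)) *\<^sub>R w)"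
    unfolding linear_matrix_vector_mul_eq
    by (rule linearI) (simp_all add: cross_add_right cross_mult_right algebra_simps inner_add_right)
qed

text \<open>Inner and cross products commute with a rotation \<open>H\<close>. A rotation about the
  moving axis \<open>H *v w\<close>, acting from the left, thus becomes a factor on the right that
  does not depend on the frame.\<close>

lemma axis_rotation_conj:
  assumes "rotation_matrix H"
  shows "axis_rotation (H *v w) \<alpha> ** H = H ** axis_rotation w \<alpha>"
proof -
  have "(axis_rotation (H *v w) \<alpha> ** H) *v x = (H ** axis_rotation w \<alpha>) *v x" for x
  proof -
    have "(H *v w) \<bullet> (H *v x) = w \<bullet> x"
      using assms orthogonal_transformation_matrix[of "(*v) H"]
      by (auto simp: rotation_matrix_def orthogonal_transformation_def)
    then show ?thesis
      by (simp add: axis_rotation_mult_vec cross_rotation_matrix[OF assms] matrix_vector_right_distrib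
          matrix_vector_mult_scaleR flip: matrix_vector_mul_assoc)
  qed
  then show ?thesis by (simp add: matrix_eq)
qed

lemma one_minus_cos_le: "1 - cos x \<le> x\<^sup>2 / 2" for x :: real
  using cos_diff_cos[of 0 x] sin_squared_eq[of "x/2"] abs_sin_x_le_abs_x[of "x / 2"]
    cos_double_sin[of "x / 2"] abs_le_square_iff[of "sin (x/2)" "x/2"]
  by (simp add: power_divide)

text \<open>On a unit vector Rodrigues' formula leaves three terms of size at most \<alpha>, since
  both \<open>1 - cos \<alpha>\<close> and \<open>\<bar>sin \<alpha>\<bar>\<close> are at most
  \<alpha>. Summing over the three columns gives 9.\<close>

lemma norm_axis_rotation_diff:
  assumes "norm w = 1" "0 \<le> \<alpha>"
  shows "norm (axis_rotation w \<alpha> - mat 1) \<le> 9 * \<alpha>"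
proof -
  have "1 - cos \<alpha> \<le> \<alpha>"
  proof (cases "\<alpha> \<le> 2")
    case True
    then have "\<alpha>\<^sup>2 / 2 \<le> \<alpha>" using assms(2) using mult_left_mono[of \<alpha> 2 \<alpha>] by (simp add: power2_eq_square)
    then show ?thesis using one_minus_cos_le[of \<alpha>] by linarith
  next
    case False
    then show ?thesis using cos_ge_minus_one[of \<alpha>] by linarith
  qed
  moreover have "\<bar>sin \<alpha>\<bar> \<le> \<alpha>" using abs_sin_x_le_abs_x[of \<alpha>] assms(2) by simp
  ultimately have c: "norm ((axis_rotation w \<alpha> - mat 1) *v x) \<le> 3 * \<alpha>" if "norm x = 1" for x
  proof -
    have "(axis_rotation w \<alpha> - mat 1) *v x
      = (cos \<alpha> - 1) *\<^sub>R x + sin \<alpha> *\<^sub>R cross3 w x + ((1 - cos \<alpha>) * (w \<bullet> x)) *\<^sub>R w"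
      by (simp add: matrix_vector_mult_diff_rdistrib axis_rotation_mult_vec algebra_simps)
    also have "norm \<dots> \<le> \<bar>cos \<alpha> - 1\<bar> + \<bar>sin \<alpha>\<bar> * norm (cross3 w x) + \<bar>1 - cos \<alpha>\<bar> * \<bar>w \<bullet> x\<bar>"
      using that assms(1)
      by (intro order_trans[OF norm_triangle_ineq] add_mono) (auto simp: abs_mult)
    also have "\<dots> \<le> \<bar>cos \<alpha> - 1\<bar> + \<bar>sin \<alpha>\<bar> * 1 + \<bar>1 - cos \<alpha>\<bar> * 1"
      using Cauchy_Schwarz_ineq2[of w x] norm_cross[of w x] that assms(1)
      by (intro add_mono mult_left_mono) (auto intro: power2_le_imp_le)
    also have "\<dots> \<le> 3 * \<alpha>"
      using \<open>1 - cos \<alpha> \<le> \<alpha>\<close> \<open>\<bar>sin \<alpha>\<bar> \<le> \<alpha>\<close> cos_le_one[of \<alpha>] abs_of_nonneg[of "1 - cos \<alpha>"] abs_minus_commute[of "cos \<alpha>" 1]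
      by simp
    finally show ?thesis .
  qed
  have "norm (axis_rotation w \<alpha> - mat 1) \<le> (\<Sum>j\<in>(UNIV :: 3 set). 3 * \<alpha>)"
    using c by (intro order_trans[OF norm_le_sum_columns] sum_mono) simp
  then show ?thesis by simp
qed

lemma abs_sin_diff_le: "\<bar>sin x - x\<bar> \<le> x\<^sup>2 / 2" for x :: real
  using Maclaurin_sin_bound[of x 2] by (simp add: numeral_2_eq_2 sin_coeff_def)

section \<open>Gluing increments across finitely many jumps\<close>

text \<open>Induction on the number of exceptional points, splitting at the last one,
  \<open>s\<close>. As the value \<open>f s\<close> is arbitrary, the parts on both sides of
  \<open>s\<close> are reached as limits, which is why each \<open>Q A\<close> must be closed and
  monotone in the set. The dependence of \<open>Q\<close> on the set admits norm bounds by an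
  additive mass as well as a fixed convex cone.\<close>

lemma chaining:
  fixes f :: "real \<Rightarrow> 'v::real_normed_vector"
  assumes F: "finite F"
    and closed: "\<And>A. closed (Q A)"
    and add: "\<And>x s y p q r. x < s \<Longrightarrow> s < y \<Longrightarrow> p \<in> Q {x<..<s} \<Longrightarrow> q \<in> Q {s} \<Longrightarrow> r \<in> Q {s<..y}
      \<Longrightarrow> p + q + r \<in> Q {x<..y}"
    and mono: "\<And>x z s. z < s \<Longrightarrow> Q {x<..z} \<subseteq> Q {x<..<s}" "\<And>s z y. s < z \<Longrightarrow> Q {z<..y} \<subseteq> Q {s<..y}"
    and comp: "\<And>x y. a \<le> x \<Longrightarrow> x < y \<Longrightarrow> y \<le> b \<Longrightarrow> {x..y} \<inter> F = {} \<Longrightarrow> f y - f x \<in> Q {x<..y}"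
    and jump: "\<And>s. s \<in> F \<Longrightarrow> a < s \<Longrightarrow> s < b \<Longrightarrow>
      \<exists>l r. (f \<longlongrightarrow> l) (at_left s) \<and> (f \<longlongrightarrow> r) (at_right s) \<and> r - l \<in> Q {s}"
    and xy: "a \<le> x" "x < y" "y \<le> b" "x \<notin> F" "y \<notin> F"
  shows "f y - f x \<in> Q {x<..y}"
  using xy
proof (induction "card (F \<inter> {x..y})" arbitrary: y rule: less_induct)
  case less
  show ?case
  proof (cases "F \<inter> {x..y} = {}")
    case True
    then show ?thesis using comp[of x y] less.prems by (simp add: Int_commute)
  next
    case False
    define s where "s = Max (F \<inter> {x..y})"
    have s: "s \<in> F \<inter> {x..y}" using False F unfolding s_def by (intro Max_in) auto
    then have sxy: "s \<in> F" "x < s" "s < y" using less.prems by (auto simp: less_le)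
    have smax: "t \<le> s" if "t \<in> F" "t \<le> y" "x \<le> t" for t
      using that F unfolding s_def by (intro Max_ge) auto
    obtain l r where lr: "(f \<longlongrightarrow> l) (at_left s)" "(f \<longlongrightarrow> r) (at_right s)" "r - l \<in> Q {s}"
      using jump[of s] sxy less.prems by auto
    have R: "f y - r \<in> Q {s<..y}"
    proof (rule Lim_in_closed_set[OF closed])
      show "((\<lambda>z. f y - f z) \<longlongrightarrow> f y - r) (at_right s)" by (intro tendsto_intros lr)
      show "eventually (\<lambda>z. f y - f z \<in> Q {s<..y}) (at_right s)"
        unfolding eventually_at_right_field
      proof (intro exI conjI allI impI)
        fix z assume z: "s < z" "z < y"
        have "{z..y} \<inter> F = {}" using smax z sxy by fastforce
        then show "f y - f z \<in> Q {s<..y}"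
          using comp[of z y] mono(2)[OF z(1), of y] z less.prems sxy by auto
      qed (use sxy in auto)
    qed simp
    have Le: "l - f x \<in> Q {x<..<s}"
    proof (rule Lim_in_closed_set[OF closed])
      show "((\<lambda>z. f z - f x) \<longlongrightarrow> l - f x) (at_left s)" by (intro tendsto_intros lr)
      \<comment> \<open>Beyond \<open>x'\<close> and before \<open>s\<close> there is no exceptional
        point, so \<open>z\<close> is admissible as an end point and the interval up to
        \<open>z\<close> contains fewer exceptional points.\<close>
      define x' where "x' = Max (insert x (F \<inter> {..<s}))"
      have x': "x' < s" "x \<le> x'" "\<And>t. t \<in> F \<Longrightarrow> t < s \<Longrightarrow> t \<le> x'"
        using F sxy unfolding x'_def by auto
      show "eventually (\<lambda>z. f z - f x \<in> Q {x<..<s}) (at_left s)"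
        unfolding eventually_at_left_field
      proof (intro exI conjI allI impI)
        fix z assume z: "x' < z" "z < s"
        have "card (F \<inter> {x..z}) < card (F \<inter> {x..y})"
          using F s z sxy by (intro psubset_card_mono psubsetI) (auto simp: set_eq_iff intro!: exI[of _ s])
        moreover have "z \<notin> F" using x'(3)[of z] z by auto
        ultimately have "f z - f x \<in> Q {x<..z}"
          using less.hyps[of z] less.prems z x' sxy by auto
        then show "f z - f x \<in> Q {x<..<s}" using mono(1)[OF z(2)] by auto
      qed (use x' in auto)
    qed simp
    have "(l - f x) + (r - l) + (f y - r) \<in> Q {x<..y}"
      using add[OF sxy(2,3) Le lr(3) R] .
    then show ?thesis by (simp add: algebra_simps)
  qed
qed

lemma chaining_content:
  fixes f :: "real \<Rightarrow> 'v::real_normed_vector"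
  assumes F: "finite F" and N: "additive_content N" "\<And>A. 0 \<le> N A"
    and comp: "\<And>u v. x \<le> u \<Longrightarrow> u < v \<Longrightarrow> v \<le> y \<Longrightarrow> {u..v} \<inter> F = {} \<Longrightarrow> norm (f v - f u) \<le> N {u<..v}"
    and jump: "\<And>s. s \<in> F \<Longrightarrow> x < s \<Longrightarrow> s < y \<Longrightarrow>
      \<exists>l r. (f \<longlongrightarrow> l) (at_left s) \<and> (f \<longlongrightarrow> r) (at_right s) \<and> norm (r - l) \<le> N {s}"
    and xy: "x < y" "x \<notin> F" "y \<notin> F"
  shows "norm (f y - f x) \<le> N {x<..y}"
proof -
  have "f y - f x \<in> {v. norm v \<le> N {x<..y}}"
  proof (rule chaining[OF F, where Q="\<lambda>A. {v. norm v \<le> N A}" and a=x and b=y])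
    show "closed {v :: 'v. norm v \<le> N A}" for A
      by (intro closed_Collect_le continuous_intros)
    fix x s y :: real and p q r :: 'v
    assume xs: "x < s" "s < y" and "p \<in> {v. norm v \<le> N {x<..<s}}" "q \<in> {v. norm v \<le> N {s}}"
      "r \<in> {v. norm v \<le> N {s<..y}}"
    moreover have "{x<..y} = ({x<..<s} \<union> {s}) \<union> {s<..y}" using xs by auto
    moreover have "N (({x<..<s} \<union> {s}) \<union> {s<..y}) = N ({x<..<s} \<union> {s}) + N {s<..y}"
      by (rule additive_contentD[OF N(1)]) auto
    moreover have "N ({x<..<s} \<union> {s}) = N {x<..<s} + N {s}"
      by (rule additive_contentD[OF N(1)]) auto
    ultimately show "p + q + r \<in> {v. norm v \<le> N {x<..y}}"
      using norm_triangle_ineq[of "p + q" r] norm_triangle_ineq[of p q] by simp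
  next
    show "{v :: 'v. norm v \<le> N {x<..z}} \<subseteq> {v. norm v \<le> N {x<..<s}}" if "z < s" for x z s
    proof -
      have "N {x<..z} \<le> N {x<..<s}" using that by (intro content_mono[OF N]) auto
      then show ?thesis by auto
    qed
    show "{v :: 'v. norm v \<le> N {z<..y}} \<subseteq> {v. norm v \<le> N {s<..y}}" if "s < z" for s z y
    proof -
      have "N {z<..y} \<le> N {s<..y}" using that by (intro content_mono[OF N]) auto
      then show ?thesis by auto
    qed
  qed (use comp jump xy in auto)
  then show ?thesis by simp
qed

text \<open>Halving the interval with respect to \<open>w\<close> halves the bound.\<close>

lemma constant_of_quadratic_increments:
  fixes f :: "real \<Rightarrow> 'v::real_normed_vector" and w :: "real \<Rightarrow> real"
  assumes w: "continuous_on {a..b} w"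
    and f: "\<And>x y. a \<le> x \<Longrightarrow> x \<le> y \<Longrightarrow> y \<le> b \<Longrightarrow> norm (f y - f x) \<le> C * (w y - w x)\<^sup>2"
    and wmono: "\<And>x y. a \<le> x \<Longrightarrow> x \<le> y \<Longrightarrow> y \<le> b \<Longrightarrow> w x \<le> w y"
    and "a \<le> b"
  shows "f b = f a"
proof -
  have *: "norm (f y - f x) \<le> C * (w y - w x)\<^sup>2 / 2 ^ k" if "a \<le> x" "x \<le> y" "y \<le> b" for x y and k :: nat
    using that
  proof (induction k arbitrary: x y)
    case 0
    then show ?case using f by simp
  next
    case (Suc k)
    have "continuous_on {x..y} w"
      using w by (rule continuous_on_subset) (use Suc.prems in auto)
    then have "\<exists>m\<ge>x. m \<le> y \<and> w m = (w x + w y) / 2"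
      using Suc.prems wmono[of x y] by (intro IVT') auto
    then obtain m where m: "x \<le> m" "m \<le> y" and wm: "w m = (w x + w y) / 2" by blast
    define D where "D = w y - w x"
    have D: "w y - w m = D / 2" "w m - w x = D / 2" by (simp_all add: wm D_def field_simps)
    have "norm (f y - f m) \<le> C * (w y - w m)\<^sup>2 / 2 ^ k"
      by (rule Suc.IH) (use Suc.prems m in auto)
    moreover have "norm (f m - f x) \<le> C * (w m - w x)\<^sup>2 / 2 ^ k"
      by (rule Suc.IH) (use Suc.prems m in auto)
    moreover have "C * (D / 2)\<^sup>2 / 2 ^ k + C * (D / 2)\<^sup>2 / 2 ^ k = C * (w y - w x)\<^sup>2 / 2 ^ Suc k"
      by (simp only: power_divide D_def[symmetric]) (simp add: divide_simps)
    moreover have "norm (f y - f x) \<le> norm (f y - f m) + norm (f m - f x)"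
      using norm_triangle_ineq[of "f y - f m" "f m - f x"] by simp
    ultimately show ?case unfolding D by linarith
  qed
  have "(\<lambda>k. C * (w b - w a)\<^sup>2 * (1 / 2) ^ k) \<longlonglongrightarrow> C * (w b - w a)\<^sup>2 * 0"
    by (intro tendsto_mult tendsto_const LIMSEQ_realpow_zero) auto
  then have "(\<lambda>k. C * (w b - w a)\<^sup>2 / 2 ^ k) \<longlonglongrightarrow> 0"
    by (simp add: power_one_over)
  then have "norm (f b - f a) \<le> 0"
    using *[of a b] assms(4) by (intro tendsto_lowerbound) auto
  then show ?thesis by simp
qed

text \<open>Here \<open>d\<close> and \<tau> are the jumps of the two angle functions. A Taylor
  bound of order \<open>\<alpha>\<^sup>2\<close> would be useless, because \<tau> may be much larger
  than \<open>d\<close>. But every component of the error contains a factor \<open>d\<close>: the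
  first is \<open>- (k * d\<^sup>2)\<close> because
  \<open>\<alpha>\<^sup>2 - \<tau>\<^sup>2 = d\<^sup>2\<close>, the second comes from
  \<open>sin \<alpha> - \<alpha>\<close> times \<open>d / \<alpha>\<close>, and the third is
  \<open>k * \<tau> * d\<close>.\<close>

lemma norm_axis_rotation_e1:
  fixes d \<tau> :: real
  defines "\<alpha> \<equiv> sqrt (d\<^sup>2 + \<tau>\<^sup>2)"
  assumes "0 < \<alpha>"
  shows "norm (axis_rotation ((1 / \<alpha>) *\<^sub>R vector [\<tau>, 0, d]) \<alpha> *v axis 1 1 - axis 1 1 - d *\<^sub>R axis 2 1)
    \<le> 2 * (\<bar>d\<bar> * \<alpha>)"
proof -
  let ?v = "axis_rotation ((1 / \<alpha>) *\<^sub>R vector [\<tau>, 0, d]) \<alpha> *v axis 1 1 - axis 1 1 - d *\<^sub>R axis 2 1"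
  have sq: "\<alpha>\<^sup>2 = d\<^sup>2 + \<tau>\<^sup>2" by (simp add: \<alpha>_def)
  have abs: "\<bar>d\<bar> \<le> \<alpha>" "\<bar>\<tau>\<bar> \<le> \<alpha>" by (simp_all add: \<alpha>_def real_le_rsqrt)
  define k where "k = (1 - cos \<alpha>) / \<alpha>\<^sup>2"
  have k: "0 \<le> k" "k \<le> 1 / 2"
    using one_minus_cos_le[of \<alpha>] assms(2) by (auto simp: k_def field_simps)
  have kc: "1 - cos \<alpha> = k * \<alpha>\<^sup>2" using assms(2) by (simp add: k_def)
  have v1: "?v $ 1 = - (k * d\<^sup>2)"
  proof -
    have "?v $ 1 = - (1 - cos \<alpha>) + (1 - cos \<alpha>) * (\<tau> / \<alpha>)\<^sup>2"
      using assms(2) by (simp add: axis_rotation_mult_vec inner_vec_def sum_3 cross3_def axis_def power2_eq_square)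
    also have "\<dots> = - (k * (\<alpha>\<^sup>2 - \<tau>\<^sup>2))"
      unfolding kc using assms(2) by (simp add: power_divide algebra_simps)
    finally show ?thesis using sq by simp
  qed
  have v2: "?v $ 2 = (sin \<alpha> - \<alpha>) * (d / \<alpha>)"
    using assms(2) by (simp add: axis_rotation_mult_vec inner_vec_def sum_3 cross3_def axis_def field_simps)
  have v3: "?v $ 3 = k * \<tau> * d"
  proof -
    have "?v $ 3 = (1 - cos \<alpha>) * (\<tau> / \<alpha>) * (d / \<alpha>)"
      using assms(2) by (simp add: axis_rotation_mult_vec inner_vec_def sum_3 cross3_def axis_def)
    then show ?thesis using assms(2) by (simp add: k_def power2_eq_square)
  qed
  have "\<bar>?v $ 1\<bar> \<le> (1 / 2) * (\<bar>d\<bar> * \<alpha>)"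
    unfolding v1 abs_minus_cancel abs_mult power2_eq_square using k abs by (intro mult_mono) auto
  moreover have "\<bar>?v $ 3\<bar> \<le> (1 / 2) * (\<bar>d\<bar> * \<alpha>)"
  proof -
    have "\<bar>?v $ 3\<bar> = k * (\<bar>d\<bar> * \<bar>\<tau>\<bar>)" unfolding v3 using k by (simp add: abs_mult)
    also have "\<dots> \<le> (1 / 2) * (\<bar>d\<bar> * \<alpha>)" using k abs by (intro mult_mono) auto
    finally show ?thesis .
  qed
  moreover have "\<bar>?v $ 2\<bar> \<le> (1 / 2) * (\<bar>d\<bar> * \<alpha>)"
  proof -
    have "\<bar>?v $ 2\<bar> = \<bar>sin \<alpha> - \<alpha>\<bar> * (\<bar>d\<bar> / \<alpha>)" unfolding v2 using assms(2) by (simp add: abs_mult)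
    also have "\<dots> \<le> (\<alpha>\<^sup>2 / 2) * (\<bar>d\<bar> / \<alpha>)"
      using abs_sin_diff_le[of \<alpha>] assms(2) by (intro mult_right_mono) auto
    also have "\<dots> = (1 / 2) * (\<bar>d\<bar> * \<alpha>)" using assms(2) by (simp add: power2_eq_square)
    finally show ?thesis .
  qed
  moreover have "norm ?v \<le> \<bar>?v $ 1\<bar> + \<bar>?v $ 2\<bar> + \<bar>?v $ 3\<bar>"
    using norm_le_l1_cart[of ?v] by (simp only: sum_3)
  moreover have "0 \<le> \<bar>d\<bar> * \<alpha>" using assms(2) by simp
  ultimately show ?thesis by linarith
qed

section \<open>Convex cones about an axis\<close>

text \<open>For a unit vector \<open>w\<close> the number \<delta> bounds the tangent of the angle
  between \<open>v\<close> and \<open>w\<close>. The condition is homogeneous in \<open>v\<close>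
  and holds for 0, so vanishing increments do no harm.\<close>

definition axis_cone :: "'a::real_inner \<Rightarrow> real \<Rightarrow> 'a set" where
  "axis_cone w \<delta> = {v. 0 \<le> v \<bullet> w \<and> norm (v - (v \<bullet> w) *\<^sub>R w) \<le> \<delta> * (v \<bullet> w)}"

lemma closed_cone: "closed (axis_cone w \<delta>)"
  unfolding axis_cone_def by (intro closed_Collect_conj closed_Collect_le continuous_intros)

lemma cone_add: "u \<in> axis_cone w \<delta> \<Longrightarrow> v \<in> axis_cone w \<delta> \<Longrightarrow> u + v \<in> axis_cone w \<delta>"
  using norm_triangle_ineq[of "u - (u \<bullet> w) *\<^sub>R w" "v - (v \<bullet> w) *\<^sub>R w"]
  by (simp add: axis_cone_def inner_add_left algebra_simps)

text \<open>The error is at most half of \<open>m\<close>, hence \<open>v \<bullet> w\<close> is at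
  least \<open>m / 2\<close>. Expressing the error by \<open>v \<bullet> w\<close> instead of
  \<open>m\<close> costs the factor 2.\<close>

lemma cone_near:
  assumes "norm w = 1" "norm (v - m *\<^sub>R w) \<le> \<delta> * m" "0 \<le> m" "0 \<le> \<delta>" "\<delta> \<le> 1 / 2"
  shows "v \<in> axis_cone w (2 * \<delta>)"
proof -
  have ww: "w \<bullet> w = 1" using assms(1) by (simp add: norm_eq_1)
  define e where "e = v - m *\<^sub>R w"
  have v: "v = e + m *\<^sub>R w" by (simp add: e_def)
  have e: "norm e \<le> \<delta> * m" using assms(2) by (simp add: e_def)
  have "\<bar>e \<bullet> w\<bar> \<le> \<delta> * m" using Cauchy_Schwarz_ineq2[of e w] assms(1) e by simp
  moreover have "\<delta> * m \<le> (1 / 2) * m" using assms by (intro mult_right_mono)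
  ultimately have vw: "v \<bullet> w \<ge> (1/2) * m" using ww by (simp add: v inner_add_left)
  have "norm (v - (v \<bullet> w) *\<^sub>R w) = norm (e - (e \<bullet> w) *\<^sub>R w)"
    by (simp add: v inner_add_left ww algebra_simps)
  also have "\<dots> \<le> norm e"
  proof (rule power2_le_imp_le)
    show "(norm (e - (e \<bullet> w) *\<^sub>R w))\<^sup>2 \<le> (norm e)\<^sup>2"
      unfolding power2_norm_eq_inner using ww
      by (simp add: inner_diff_left inner_diff_right inner_commute power2_eq_square)
  qed simp
  also have "\<dots> \<le> \<delta> * m" by (rule e)
  also have "\<dots> \<le> \<delta> * (2 * (v \<bullet> w))" using vw assms by (intro mult_left_mono) auto
  finally show ?thesis using vw assms by (simp add: axis_cone_def mult_ac)
qed

lemma cone_limit: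
  assumes "v \<longlonglongrightarrow> v'" "w \<longlonglongrightarrow> w'" "eventually (\<lambda>n. v n \<in> axis_cone (w n) \<delta>) sequentially"
  shows "v' \<in> axis_cone w' \<delta>"
proof -
  have "0 \<le> v' \<bullet> w'"
    using assms(3) by (intro tendsto_lowerbound[OF tendsto_inner[OF assms(1,2)]]) (auto simp: axis_cone_def elim: eventually_mono)
  moreover have "norm (v' - (v' \<bullet> w') *\<^sub>R w') \<le> \<delta> * (v' \<bullet> w')"
  proof (rule tendsto_le)
    show "(\<lambda>n. \<delta> * (v n \<bullet> w n)) \<longlonglongrightarrow> \<delta> * (v' \<bullet> w')" by (intro tendsto_intros assms)
    show "(\<lambda>n. norm (v n - (v n \<bullet> w n) *\<^sub>R w n)) \<longlonglongrightarrow> norm (v' - (v' \<bullet> w') *\<^sub>R w')"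
      by (intro tendsto_intros assms)
    show "eventually (\<lambda>n. norm (v n - (v n \<bullet> w n) *\<^sub>R w n) \<le> \<delta> * (v n \<bullet> w n)) sequentially"
      using assms(3) by (auto simp: axis_cone_def elim: eventually_mono)
  qed simp
  ultimately show ?thesis by (simp add: axis_cone_def)
qed

text \<open>A closed convex cone contains the integrals of its functions: both defining conditions
  are integrated, the second by the triangle inequality. Values on \<open>Z\<close> are replaced by
  0.\<close>

lemma cone_integral:
  fixes f :: "real \<Rightarrow> 'a::euclidean_space"
  assumes f: "f integrable_on {a..b}" and Z: "negligible Z"
    and cone: "\<And>s. s \<in> {a..b} - Z \<Longrightarrow> f s \<in> axis_cone w \<delta>"
  shows "integral {a..b} f \<in> axis_cone w \<delta>"
proof -
  let ?I = "integral {a..b}"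
  have inner: "((\<lambda>s. f s \<bullet> w) has_integral (?I f \<bullet> w)) {a..b}"
    using has_integral_linear[OF integrable_integral[OF f] bounded_linear_inner_left[of w]]
    by (simp add: o_def)
  have proj: "((\<lambda>s. f s - (f s \<bullet> w) *\<^sub>R w) has_integral (?I f - (?I f \<bullet> w) *\<^sub>R w)) {a..b}"
    by (intro has_integral_diff integrable_integral f has_integral_scaleR_left inner)
  have scaled: "((\<lambda>s. \<delta> * (f s \<bullet> w)) has_integral (\<delta> * (?I f \<bullet> w))) {a..b}"
    by (intro has_integral_mult_right inner)
  let ?g = "\<lambda>s. if s \<in> Z then 0 else f s - (f s \<bullet> w) *\<^sub>R w" and ?h = "\<lambda>s. if s \<in> Z then 0 else f s \<bullet> w"
  have g: "(?g has_integral (?I f - (?I f \<bullet> w) *\<^sub>R w)) {a..b}"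
    by (rule has_integral_spike[OF Z _ proj]) auto
  have h: "(?h has_integral (?I f \<bullet> w)) {a..b}"
    by (rule has_integral_spike[OF Z _ inner]) auto
  have "0 \<le> ?I f \<bullet> w"
    by (rule has_integral_nonneg[OF h]) (use cone in \<open>auto simp: axis_cone_def\<close>)
  moreover have "norm (integral {a..b} ?g) \<le> integral {a..b} (\<lambda>s. \<delta> * ?h s)"
    by (rule integral_norm_bound_integral)
      (use g has_integral_mult_right[OF h, of \<delta>] cone in \<open>auto simp: axis_cone_def intro: has_integral_integrable\<close>)
  ultimately show ?thesis
    using integral_unique[OF g] integral_unique[OF has_integral_mult_right[OF h, of \<delta>]]
      integral_unique[OF h]
    by (simp add: axis_cone_def del: integral_mult_right)
qed

section \<open>Angles between vectors of a common cone\<close>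

text \<open>With the half angle \<open>p\<close> one has \<open>1 - x = 2 * (sin p)\<^sup>2\<close>,
  and \<open>p / 3 \<le> sin p\<close> for \<open>p\<close> below 2 by the cubic Taylor bound. Then
  \<open>4 * p\<^sup>2 \<le> 36 * (sin p)\<^sup>2\<close>, which is the claim with constant
  18.\<close>

lemma arccos_bound:
  assumes "-1 \<le> x" "x \<le> 1"
  shows "(arccos x)\<^sup>2 \<le> 18 * (1 - x)"
proof -
  define p where "p = arccos x / 2"
  have p: "0 \<le> p" "p < 2"
    using arccos_lbound[OF assms] arccos_ubound[OF assms] pi_half_less_two by (auto simp: p_def)
  have "x = cos (2 * p)" using assms by (simp add: p_def)
  then have x: "1 - x = 2 * (sin p)\<^sup>2" by (simp add: cos_double_sin)
  have "\<bar>sin p - p\<bar> \<le> p ^ 3 / 6"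
    using Maclaurin_sin_bound[of p 3] p(1)
    by (simp add: numeral_3_eq_3 lessThan_Suc sin_coeff_def fact_numeral)
  moreover have "p ^ 3 / 6 \<le> p * 4 / 6"
    using mult_left_mono[OF power_mono[OF less_imp_le[OF p(2)] p(1), of 2] p(1)]
    by (simp add: power3_eq_cube power2_eq_square)
  ultimately have "p / 3 \<le> sin p" by linarith
  then have "(p / 3)\<^sup>2 \<le> (sin p)\<^sup>2" using p by (intro power_mono) auto
  then show ?thesis using x by (simp add: p_def power_divide)
qed

lemma vec_angle_le_pi: "vec_angle x y \<le> pi"
proof -
  have "\<bar>x \<bullet> y\<bar> / \<bar>norm x * norm y\<bar> \<le> 1"
    using Cauchy_Schwarz_ineq2[of x y] by (cases "norm x * norm y = 0") (auto simp: divide_le_eq_1)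
  then have "\<bar>x \<bullet> y / (norm x * norm y)\<bar> \<le> 1" by (simp only: abs_divide)
  then show ?thesis unfolding vec_angle_def abs_le_iff by (intro arccos_ubound) auto
qed

lemma line_angle_le_vec_angle: "line_angle x y \<le> vec_angle x y"
proof -
  have "\<bar>x \<bullet> y\<bar> / (norm x * norm y) \<le> 1"
    using Cauchy_Schwarz_ineq2[of x y] by (cases "norm x * norm y = 0") (auto simp: divide_le_eq_1)
  moreover have "-1 \<le> (x \<bullet> y) / (norm x * norm y)"
    using Cauchy_Schwarz_ineq2[of x y] by (cases "norm x * norm y = 0") (auto simp: le_divide_eq)
  moreover have "(x \<bullet> y) / (norm x * norm y) \<le> \<bar>x \<bullet> y\<bar> / (norm x * norm y)"
    by (intro divide_right_mono) auto
  ultimately show ?thesis unfolding vec_angle_def line_angle_def by (intro arccos_le_arccos) auto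
qed

text \<open>Pythagoras: \<open>c\<^sup>2 + (norm p)\<^sup>2 = 1\<close> with \<open>c\<close>
  between 0 and 1, so \<open>c \<ge> c\<^sup>2 \<ge> 1 - \<delta>\<^sup>2\<close>. The defect of the
  cosine is quadratic in \<delta>, which makes the angle linear.\<close>

lemma cone_unit:
  fixes v w :: "real^3"
  assumes w: "norm w = 1" and v: "v \<noteq> 0" "v \<in> axis_cone w \<delta>" and d: "0 \<le> \<delta>" "\<delta> \<le> 1"
  obtains c p where "v /\<^sub>R norm v = c *\<^sub>R w + p" "p \<bullet> w = 0" "norm p \<le> \<delta>" "1 - \<delta>\<^sup>2 \<le> c"
proof -
  define u where "u = v /\<^sub>R norm v"
  have u: "norm u = 1" using v by (simp add: u_def)
  have ww: "w \<bullet> w = 1" using w by (simp add: norm_eq_1)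
  define c p where "c = u \<bullet> w" and "p = u - c *\<^sub>R w"
  have c1: "c \<le> 1" using Cauchy_Schwarz_ineq2[of u w] u w by (simp add: c_def)
  have c0: "0 \<le> c" using v by (simp add: c_def u_def axis_cone_def)
  have "p = (v - (v \<bullet> w) *\<^sub>R w) /\<^sub>R norm v" by (simp add: p_def c_def u_def scaleR_diff_right)
  then have "norm p = norm (v - (v \<bullet> w) *\<^sub>R w) / norm v" by (simp add: divide_inverse mult.commute)
  also have "\<dots> \<le> (\<delta> * (v \<bullet> w)) / norm v" using v by (intro divide_right_mono) (auto simp: axis_cone_def)
  also have "\<dots> = \<delta> * c" by (simp add: c_def u_def divide_inverse mult_ac)
  also have "\<dots> \<le> \<delta>" using c1 d c0 by (simp add: mult_left_le)
  finally have p: "norm p \<le> \<delta>" .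
  have "1 = c\<^sup>2 + (norm p)\<^sup>2"
    using u ww unfolding p_def c_def norm_eq_1 power2_norm_eq_inner
    by (simp add: inner_diff_left inner_diff_right inner_commute power2_eq_square)
  moreover have "c\<^sup>2 \<le> c" using c0 c1 by (simp add: power2_eq_square mult_left_le)
  moreover have "(norm p)\<^sup>2 \<le> \<delta>\<^sup>2" using p by (intro power_mono) auto
  ultimately have "1 - \<delta>\<^sup>2 \<le> c" by linarith
  moreover have "p \<bullet> w = 0" by (simp add: p_def c_def inner_diff_left ww)
  ultimately show thesis using that[of c p] p by (simp add: p_def u_def)
qed

text \<open>The cosine of the angle is at least \<open>1 - 3 * \<delta>\<^sup>2\<close>, and
  \<open>18 * 3 = 54\<close> is below \<open>64 = 8 * 8\<close>. For \<delta> above 1 the bound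
  exceeds \<open>pi\<close>.\<close>

lemma cone_vec_angle_le:
  fixes v v' w :: "real^3"
  assumes w: "norm w = 1" and v: "v \<noteq> 0" "v \<in> axis_cone w \<delta>" "v' \<noteq> 0" "v' \<in> axis_cone w \<delta>" and d: "0 \<le> \<delta>"
  shows "vec_angle v v' \<le> 8 * \<delta>"
proof (cases "\<delta> \<le> 1")
  case False
  then show ?thesis using vec_angle_le_pi[of v v'] pi_less_4 by linarith
next
  case True
  obtain c p where cp: "v /\<^sub>R norm v = c *\<^sub>R w + p" "p \<bullet> w = 0" "norm p \<le> \<delta>" "1 - \<delta>\<^sup>2 \<le> c"
    using cone_unit[OF w v(1,2) d True] .
  obtain c' p' where cp': "v' /\<^sub>R norm v' = c' *\<^sub>R w + p'" "p' \<bullet> w = 0" "norm p' \<le> \<delta>" "1 - \<delta>\<^sup>2 \<le> c'"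
    using cone_unit[OF w v(3,4) d True] .
  have ww: "w \<bullet> w = 1" using w by (simp add: norm_eq_1)
  define x where "x = (v \<bullet> v') / (norm v * norm v')"
  have "x = (v /\<^sub>R norm v) \<bullet> (v' /\<^sub>R norm v')" by (simp add: x_def divide_inverse mult_ac)
  also have "\<dots> = c * c' + p \<bullet> p'"
    unfolding cp(1) cp'(1) using cp(2) cp'(2) ww
    by (simp add: inner_add_left inner_add_right inner_commute)
  finally have x: "x = c * c' + p \<bullet> p'" .
  have d2: "\<delta>\<^sup>2 \<le> 1" using d True by (simp add: power_le_one)
  have "(1 - \<delta>\<^sup>2) * (1 - \<delta>\<^sup>2) \<le> c * c'"
    using cp(4) cp'(4) d2 by (intro mult_mono) auto
  moreover have "1 - 2 * \<delta>\<^sup>2 \<le> (1 - \<delta>\<^sup>2) * (1 - \<delta>\<^sup>2)" by (simp add: algebra_simps)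
  moreover have "\<bar>p \<bullet> p'\<bar> \<le> \<delta> * \<delta>"
    using cp(3) cp'(3) d by (intro order_trans[OF Cauchy_Schwarz_ineq2] mult_mono) auto
  ultimately have xl: "1 - x \<le> 3 * \<delta>\<^sup>2" unfolding x power2_eq_square by linarith
  have "\<bar>x\<bar> \<le> 1"
    using Cauchy_Schwarz_ineq2[of v v'] v by (simp add: x_def divide_le_eq_1)
  then have "(arccos x)\<^sup>2 \<le> 18 * (1 - x)" by (intro arccos_bound) auto
  also have "\<dots> \<le> 18 * (3 * \<delta>\<^sup>2)" using xl by (intro mult_left_mono) auto
  also have "\<dots> \<le> 64 * \<delta>\<^sup>2" by simp
  also have "\<dots> = (8 * \<delta>)\<^sup>2" by (simp add: power_mult_distrib)
  finally have "arccos x \<le> 8 * \<delta>" by (rule power2_le_imp_le) (use d in simp)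
  then show ?thesis by (simp add: vec_angle_def x_def)
qed

section \<open>The approximating frames\<close>

lemma matrix_mult_diff_right: "(A :: real^'n^'m) ** (B - C) = A ** B - A ** C"
  by (simp add: vec_eq_iff matrix_matrix_mult_def right_diff_distrib sum_subtractf)

lemma matrix_mult_diff_left: "((A :: real^'n^'m) - B) ** C = A ** C - B ** C"
  by (simp add: vec_eq_iff matrix_matrix_mult_def left_diff_distrib sum_subtractf)

lemma tendsto_matrix_vector_mult:
  "(A \<longlongrightarrow> B) F \<Longrightarrow> ((\<lambda>s. (A s :: real^'n^'m) *v e) \<longlongrightarrow> B *v e) F"
  by (rule vec_tendstoI) (simp add: matrix_vector_mult_def, intro tendsto_intros)

lemma tendsto_matrix_mult:
  "(A \<longlongrightarrow> A') F \<Longrightarrow> (B \<longlongrightarrow> B') F \<Longrightarrow> ((\<lambda>s. (A s :: real^'n^'m) ** B s) \<longlongrightarrow> A' ** B') F"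
  by (rule tendsto_matrixI) (simp add: matrix_matrix_mult_def, intro tendsto_intros)

lemma tendsto_transpose:
  "(A \<longlongrightarrow> A') F \<Longrightarrow> ((\<lambda>s. transpose (A s :: real^'n^'m)) \<longlongrightarrow> transpose A') F"
  by (rule tendsto_matrixI) (simp add: transpose_def, intro tendsto_intros)

lemma deriv_integral_cong:
  assumes "\<And>s. s \<in> B \<Longrightarrow> 0 < s \<Longrightarrow> s < L \<Longrightarrow> f s = g s"
  shows "deriv_integral L u f B = deriv_integral L u g B"
proof -
  have "(\<lambda>s. indicator (B \<inter> {0<..<L}) s *\<^sub>R f s) = (\<lambda>s. indicator (B \<inter> {0<..<L}) s *\<^sub>R g s)"
    using assms by (auto simp: fun_eq_iff indicator_def)
  then show ?thesis by (simp add: deriv_integral_def set_lebesgue_integral_def)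
qed

text \<open>The bound does not depend on the row \<open>i\<close>, which accounts for the factor
  3.\<close>

lemma norm_matrix_le_triple_sum:
  fixes A :: "real^3^3"
  assumes "\<And>i j. \<bar>A $ i $ j\<bar> \<le> (\<Sum>k\<in>UNIV. c * n k j)"
  shows "norm A \<le> 3 * c * (\<Sum>k\<in>(UNIV::3 set). \<Sum>j\<in>(UNIV::3 set). n k j)"
proof -
  have "norm A \<le> (\<Sum>i\<in>(UNIV::3 set). \<Sum>j\<in>UNIV. \<Sum>k\<in>UNIV. c * n k j)"
    by (rule order_trans[OF norm_matrix_le_sum]) (intro sum_mono assms)
  also have "\<dots> = 3 * c * (\<Sum>k\<in>(UNIV::3 set). \<Sum>j\<in>(UNIV::3 set). n k j)"
    by (simp add: sum_3 algebra_simps)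
  finally show ?thesis .
qed

locale approx_frames =
  fixes L :: real and \<theta> \<phi> :: "real \<Rightarrow> real" and G :: "nat \<Rightarrow> real \<Rightarrow> real^3^3"
  assumes L: "0 < L" and BV_theta: "BV L \<theta>" and BV_phi: "BV L \<phi>"
    and theta_mono: "\<And>x y. 0 < x \<Longrightarrow> x \<le> y \<Longrightarrow> y < L \<Longrightarrow> \<theta> x \<le> \<theta> y"
    and angle_pos: "\<And>s. s \<in> jump_set L (Omega \<theta> \<phi>) \<Longrightarrow> 0 < jump_angle \<theta> \<phi> s"
    and frames: "\<And>n. n \<ge> 1 \<Longrightarrow> approx_frame L \<theta> \<phi> n (G n)"
begin

abbreviation "U \<equiv> Omega \<theta> \<phi>"
abbreviation "J \<equiv> jump_set L (Omega \<theta> \<phi>)"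
abbreviation "S n \<equiv> S_n L \<theta> \<phi> n"
abbreviation "DU \<equiv> mat_deriv_measure L (Omega \<theta> \<phi>)"

text \<open>An entrywise substitute for \<open>|DU|\<close>: it is additive by construction and
  dominates both the Frobenius norm of \<open>DU\<close> and the jump angles.\<close>

definition omega_mass :: "real set \<Rightarrow> real" where
  "omega_mass A = (\<Sum>k\<in>UNIV. \<Sum>j\<in>UNIV. deriv_mass L (\<lambda>s. U s $ k $ j) A)"

lemma U_entries:
  "U s $ 1 $ 1 = 0" "U s $ 1 $ 2 = \<theta> s" "U s $ 1 $ 3 = 0"
  "U s $ 2 $ 1 = - \<theta> s" "U s $ 2 $ 2 = 0" "U s $ 2 $ 3 = \<phi> s"
  "U s $ 3 $ 1 = 0" "U s $ 3 $ 2 = - \<phi> s" "U s $ 3 $ 3 = 0"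
  by (simp_all add: Omega_def)

lemma BV_U: "BV L (\<lambda>s. U s $ k $ j)"
  using exhaust_3[of k] exhaust_3[of j]
  by (auto simp: U_entries BV_const BV_theta BV_phi BV_uminus)

lemma omega_mass_nonneg: "0 \<le> omega_mass A"
  unfolding omega_mass_def by (intro sum_nonneg deriv_mass_nonneg)

lemma additive_omega_mass: "additive_content omega_mass"
  unfolding omega_mass_def[abs_def] by (intro additive_content_sum additive_content_deriv_mass BV_U L)

lemma omega_mass_mono: "A \<subseteq> B \<Longrightarrow> A \<in> sets borel \<Longrightarrow> B \<in> sets borel \<Longrightarrow> omega_mass A \<le> omega_mass B"
  by (rule content_mono[OF additive_omega_mass omega_mass_nonneg])

lemma deriv_mass_le_omega_mass: "deriv_mass L (\<lambda>s. U s $ k $ j) A \<le> omega_mass A"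
proof -
  have "deriv_mass L (\<lambda>s. U s $ k $ j) A \<le> (\<Sum>j\<in>UNIV. deriv_mass L (\<lambda>s. U s $ k $ j) A)"
    by (rule member_le_sum) (auto simp: deriv_mass_nonneg)
  also have "\<dots> \<le> omega_mass A"
    unfolding omega_mass_def
    by (rule member_le_sum[where f="\<lambda>k. \<Sum>j\<in>UNIV. deriv_mass L (\<lambda>s. U s $ k $ j) A"])
      (auto intro!: sum_nonneg deriv_mass_nonneg)
  finally show ?thesis .
qed

lemma norm_DU_le: "norm (DU A) \<le> omega_mass A"
  unfolding omega_mass_def
  by (rule order_trans[OF norm_matrix_le_sum])
    (auto intro!: sum_mono abs_deriv_measure_le simp: mat_deriv_measure_def)

lemma DU_antisym: "transpose (DU A) = - DU A"
proof -
  have *: "\<forall>i j. DU A $ j $ i = - (DU A $ i $ j)"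
    unfolding forall_3 mat_deriv_measure_def
    by (simp add: U_entries deriv_measure_zero[OF L]
        deriv_measure_uminus[OF BV_theta L] deriv_measure_uminus[OF BV_phi L])
  show ?thesis
  proof (unfold vec_eq_iff, intro allI)
    fix i j
    have "DU A $ j $ i = - (DU A $ i $ j)" using * by blast
    then show "transpose (DU A) $ i $ j = (- DU A) $ i $ j" by (simp add: transpose_def)
  qed
qed

section \<open>Jump points and their mass\<close>

lemma J_subset: "J \<subseteq> {0<..<L}"
  by (auto simp: jump_set_def)

lemma DU_singleton:
  assumes "0 < s" "s < L"
  shows "DU {s} = rlim U s - llim U s"
  using assms rlim_nth[OF BV_U, of s] llim_nth[OF BV_U, of s]
  by (simp add: vec_eq_iff mat_deriv_measure_def deriv_measure_singleton[OF BV_U L])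

lemma omega_mass_singleton_eq_0:
  assumes "0 < s" "s < L" "s \<notin> J"
  shows "omega_mass {s} = 0"
proof -
  have "llim U s = rlim U s" using assms by (auto simp: jump_set_def)
  then have "llim (\<lambda>s. U s $ k $ j) s = rlim (\<lambda>s. U s $ k $ j) s" for k j
    using rlim_nth[OF BV_U, of s k j] llim_nth[OF BV_U, of s k j] assms by simp
  then show ?thesis
    unfolding omega_mass_def using assms by (simp add: deriv_mass_singleton_eq_0[OF BV_U L])
qed

lemma S_eq: "S n = {s \<in> J. 1 / real n < norm (DU {s})}"
proof -
  have "total_variation (mat_jump_measure L U) {s} = ennreal (norm (DU {s}))" if "s \<in> J" for s
  proof -
    have "{s} \<inter> J = {s}" using that by auto
    moreover have "mat_jump_measure L U {} = 0"
      by (simp add: mat_jump_measure_def mat_deriv_measure_def vec_eq_iff)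
    ultimately show ?thesis
      using total_variation_singleton[of "mat_jump_measure L U" s] by (simp add: mat_jump_measure_def)
  qed
  then show ?thesis by (auto simp: S_n_def ennreal_less_iff)
qed

lemma S_subset: "S n \<subseteq> J"
  by (auto simp: S_eq)

lemma S_mono: "1 \<le> n \<Longrightarrow> n \<le> m \<Longrightarrow> S n \<subseteq> S m"
  by (auto simp: S_eq intro!: le_less_trans[of "1 / real m" "1 / real n"] divide_left_mono)

text \<open>Each point of \<open>S n\<close> carries mass above \<open>1 / n\<close>, and the total
  mass is finite.\<close>

lemma finite_S: 
  assumes "1 \<le> n"
  shows "finite (S n)"
proof (rule ccontr)
  assume "infinite (S n)"
  obtain k :: nat where k: "real k > real n * omega_mass {0<..<L}" using reals_Archimedean2 by blast
  obtain F where F: "F \<subseteq> S n" "finite F" "card F = k"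
    using infinite_arbitrarily_large[OF \<open>infinite (S n)\<close>] by blast
  have "real k * (1 / real n) = (\<Sum>s\<in>F. 1 / real n)" using F by simp
  also have "\<dots> \<le> (\<Sum>s\<in>F. omega_mass {s})"
    using F norm_DU_le by (intro sum_mono) (auto simp: S_eq intro: order_trans[OF less_imp_le])
  also have "\<dots> = omega_mass F" using content_finite_sum[OF additive_omega_mass F(2)] by simp
  also have "\<dots> \<le> omega_mass {0<..<L}"
    using F S_subset J_subset by (intro omega_mass_mono) (auto simp: finite_imp_closed)
  finally show False using k assms by (simp add: field_simps)
qed

lemma J_eq: "J = (\<Union>n\<in>{1..}. S n)"
proof -
  have "\<exists>n\<ge>1. s \<in> S n" if s: "s \<in> J" for s
  proof -
    have "0 < s" "s < L" "llim U s \<noteq> rlim U s" using s by (simp_all add: jump_set_def)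
    then have "norm (DU {s}) > 0" by (simp add: DU_singleton)
    then obtain n where "inverse (real (Suc n)) < norm (DU {s})" using reals_Archimedean by blast
    then show ?thesis using s by (intro exI[of _ "Suc n"]) (auto simp: S_eq inverse_eq_divide)
  qed
  then show ?thesis using S_subset by (intro equalityI subsetI) (fast, fast)
qed

lemma countable_J: "countable J"
  unfolding J_eq using finite_S by (intro countable_UN) (auto intro: countable_finite)

lemma J_borel [measurable, simp]: "J \<in> sets borel"
  using countable_J by (rule sets.countable[rotated]) auto

lemma S_borel [measurable, simp]: "S n \<in> sets borel"
  using countable_subset[OF S_subset countable_J] by (rule sets.countable[rotated]) auto

text \<open>Continuity from above: the sets of discarded jumps decrease to the empty set. This is
  the summability of jumps that drives the convergence of the frames.\<close>

lemma omega_mass_tail: "(\<lambda>n. omega_mass (J - S n)) \<longlonglongrightarrow> 0"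
proof -
  \<comment> \<open>The index is shifted because \<open>1 / 0 = 0\<close> makes \<open>S 0\<close>
    all of \<open>J\<close>; monotonicity starts at 1.\<close>
  have "(\<lambda>n. omega_mass (J - S (Suc n))) \<longlonglongrightarrow> (\<Sum>k\<in>(UNIV::3 set). \<Sum>j\<in>(UNIV::3 set). 0)"
    unfolding omega_mass_def
  proof (intro tendsto_sum deriv_mass_decseq BV_U L)
    show "decseq (\<lambda>n. J - S (Suc n))"
      using S_mono unfolding decseq_def by (metis Diff_mono Suc_le_mono le_add1 order_refl plus_1_eq_Suc)
    have "(\<Inter>n. J - S (Suc n)) = J - (\<Union>n. S (Suc n))" by auto
    moreover have "(\<Union>n. S (Suc n)) = J"
    proof -
      have "(\<Union>n. S (Suc n)) = (\<Union>n\<in>{1..}. S n)"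
        by (auto simp: Bex_def) (metis Suc_le_D One_nat_def)
      then show ?thesis using J_eq by simp
    qed
    ultimately show "(\<Inter>n. J - S (Suc n)) = {}" by simp
  qed auto
  then show ?thesis by (subst (asm) filterlim_sequentially_Suc[where f="\<lambda>n. omega_mass (J - S n)"]) simp
qed

lemma jump_le_omega_mass:
  assumes "0 < s" "s < L"
  shows "jump_angle \<theta> \<phi> s \<le> omega_mass {s}" "jump \<theta> s = deriv_measure L \<theta> {s}"
proof -
  have t: "jump \<theta> s = deriv_measure L \<theta> {s}" "jump \<phi> s = deriv_measure L \<phi> {s}"
    using assms by (simp_all add: jump_def deriv_measure_singleton[OF BV_theta L] deriv_measure_singleton[OF BV_phi L])
  have "jump_angle \<theta> \<phi> s \<le> \<bar>jump \<theta> s\<bar> + \<bar>jump \<phi> s\<bar>"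
    unfolding jump_angle_def by (rule sqrt_sum_squares_le_sum_abs)
  also have "\<dots> \<le> deriv_mass L \<theta> {s} + deriv_mass L \<phi> {s}"
    unfolding t by (intro add_mono abs_deriv_measure_le)
  also have "\<dots> \<le> omega_mass {s}"
    unfolding omega_mass_def by (simp add: sum_3 U_entries deriv_mass_nonneg add_nonneg_nonneg)
  finally show "jump_angle \<theta> \<phi> s \<le> omega_mass {s}" .
  show "jump \<theta> s = deriv_measure L \<theta> {s}" by (rule t)
qed

section \<open>A single approximating frame between its jumps\<close>

context
  fixes n :: nat
  assumes n: "1 \<le> n"
begin

lemma BV_G: "BV L (G n)"
  using frames[OF n] by (simp add: approx_frame_def)

lemma rotation_G: "0 < s \<Longrightarrow> s < L \<Longrightarrow> s \<notin> S n \<Longrightarrow> rotation_matrix (G n s)"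
  using frames[OF n] by (simp add: approx_frame_def)

lemma isCont_G:
  assumes "0 < s" "s < L" "s \<notin> S n"
  shows "isCont (G n) s"
proof -
  have "open ({0<..<L} - S n)" by (intro open_Diff finite_imp_closed finite_S n open_greaterThanLessThan)
  then show ?thesis
    using frames[OF n] assms continuous_on_eq_continuous_at by (fastforce simp: approx_frame_def)
qed

lemma G_limits:
  assumes "0 < s" "s < L"
  shows "(G n \<longlongrightarrow> llim (G n) s) (at_left s)" "(G n \<longlongrightarrow> rlim (G n) s) (at_right s)"
  using assms by (auto intro!: matrix_tendsto_llim matrix_tendsto_rlim BV_entry[OF BV_G])

lemma G_initial: "(G n \<longlongrightarrow> mat 1) (at_right 0)"
  using matrix_tendsto_rlim[OF BV_entry[OF BV_G], of 0] L frames[OF n] by (simp add: approx_frame_def)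

lemma G_limits_cont:
  assumes "0 < s" "s < L" "s \<notin> S n"
  shows "llim (G n) s = G n s" "rlim (G n) s = G n s"
proof -
  have "(G n \<longlongrightarrow> G n s) (at_left s)" "(G n \<longlongrightarrow> G n s) (at_right s)"
    using isCont_G[OF assms] by (auto simp: isCont_def filterlim_at_split)
  then show "llim (G n) s = G n s" "rlim (G n) s = G n s"
    by (auto simp: llim_def rlim_def tendsto_Lim)
qed

lemma eventually_notin_S:
  assumes "0 \<le> s" "s < L"
  shows "eventually (\<lambda>z. 0 < z \<and> z < L \<and> z \<notin> S n) (at_right s)"
proof -
  have "eventually (\<lambda>z. z \<notin> S n) (at_right s)"
    using islimpt_finite[OF finite_S[OF n], of s] by (auto simp: islimpt_iff_eventually eventually_at_split)
  moreover have "eventually (\<lambda>z. s < z \<and> z < L) (at_right s)"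
    using eventually_at_right_real[OF assms(2)] by (auto elim: eventually_mono)
  ultimately show ?thesis by eventually_elim (use assms in auto)
qed

lemma eventually_notin_S_left:
  assumes "0 < s" "s \<le> L"
  shows "eventually (\<lambda>z. 0 < z \<and> z < L \<and> z \<notin> S n) (at_left s)"
proof -
  have "eventually (\<lambda>z. z \<notin> S n) (at_left s)"
    using islimpt_finite[OF finite_S[OF n], of s] by (auto simp: islimpt_iff_eventually eventually_at_split)
  moreover have "eventually (\<lambda>z. 0 < z \<and> z < s) (at_left s)"
    using eventually_at_left_real[OF assms(1)] by (auto elim: eventually_mono)
  ultimately show ?thesis by eventually_elim (use assms in auto)
qed

lemma rotation_limits:
  assumes "0 < s" "s < L"
  shows "rotation_matrix (llim (G n) s)" "rotation_matrix (rlim (G n) s)"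
proof -
  have "llim (G n) s \<in> {A. rotation_matrix A}"
    by (rule Lim_in_closed_set[OF closed_rotation_matrix _ _ G_limits(1)[OF assms]])
      (use assms eventually_notin_S_left[of s] rotation_G in \<open>auto elim: eventually_mono\<close>)
  moreover have "rlim (G n) s \<in> {A. rotation_matrix A}"
    by (rule Lim_in_closed_set[OF closed_rotation_matrix _ _ G_limits(2)[OF assms]])
      (use assms eventually_notin_S[of s] rotation_G in \<open>auto elim: eventually_mono\<close>)
  ultimately show "rotation_matrix (llim (G n) s)" "rotation_matrix (rlim (G n) s)" by auto
qed

text \<open>Without retained jumps on the interval, \<open>G n\<close> is continuous and orthogonal
  there: the coefficient \<open>M\<close> is \<open>G n\<close>, the sum of atoms is empty, and the
  left-hand side of the measure equation is an increment. Discarded jumps are removed together with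
  \<open>J\<close>.\<close>

lemma G_increment:
  assumes xy: "0 < x" "x < y" "y < L" "{x..y} \<inter> S n = {}"
  shows "(G n y - G n x) $ i $ j
    = - (\<Sum>k\<in>UNIV. deriv_integral L (\<lambda>s. U s $ k $ j) (\<lambda>s. G n s $ i $ k) ({x<..y} - J))"
proof -
  define M where "M = (\<lambda>s. matrix_inv (transpose (precise_rep (G n) s)))"
  have notin: "z \<notin> S n" if "x \<le> z" "z \<le> y" for z using xy that by auto
  have M: "M s = G n s" if "x \<le> s" "s \<le> y" for s
    using notin[OF that] that xy G_limits_cont[of s] rotation_G[of s]
    by (simp add: M_def precise_rep_def matrix_inv_transpose_rotation flip: scaleR_2)
  have "mat_deriv_measure L (G n) {x<..y} =
      - (mat_diffuse_integral L M U {x<..y} + (\<Sum>s\<in>S n \<inter> {x<..y}. M s ** at_weight \<theta> \<phi> s))"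
    unfolding M_def
    by (rule frames[OF n, unfolded approx_frame_def Let_def, THEN conjunct2, THEN conjunct1, rule_format])
      (use xy in auto)
  moreover have "S n \<inter> {x<..y} = {}" using notin by (auto simp: disjoint_iff)
  ultimately have "mat_deriv_measure L (G n) {x<..y} = - mat_diffuse_integral L M U {x<..y}" by simp
  then have "mat_deriv_measure L (G n) {x<..y} $ i $ j = - (mat_diffuse_integral L M U {x<..y} $ i $ j)"
    by simp
  moreover have "mat_deriv_measure L (G n) {x<..y} $ i $ j = (G n y - G n x) $ i $ j"
  proof -
    have "rcont_rep L (\<lambda>s. G n s $ i $ j) z = G n z $ i $ j" if "x \<le> z" "z \<le> y" for z
    proof -
      have "0 < z" "z < L" using xy that by auto
      then have "rlim (G n) z $ i $ j = rlim (\<lambda>s. G n s $ i $ j) z"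
        by (rule rlim_nth[OF BV_entry[OF BV_G] less_imp_le])
      then show ?thesis
        using G_limits_cont(2)[of z] notin[OF that] \<open>0 < z\<close> \<open>z < L\<close> by (simp add: rcont_rep_eq_rlim)
    qed
    then show ?thesis
      using xy by (simp add: mat_deriv_measure_def deriv_measure_Ioc[OF BV_entry[OF BV_G] L])
  qed
  moreover have "mat_diffuse_integral L M U {x<..y} $ i $ j
      = (\<Sum>k\<in>UNIV. deriv_integral L (\<lambda>s. U s $ k $ j) (\<lambda>s. G n s $ i $ k) ({x<..y} - J))"
    unfolding mat_diffuse_integral_def using M by (auto intro!: sum.cong deriv_integral_cong)
  ultimately show ?thesis by simp
qed

lemma deriv_integral_G_bound:
  assumes xy: "0 < x" "x < y" "y < L" "{x..y} \<inter> S n = {}"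
    and u: "BV L u" and c: "\<And>s. x < s \<Longrightarrow> s \<le> y \<Longrightarrow> \<bar>G n s $ i $ k - f0\<bar> \<le> c"
  shows "\<bar>deriv_integral L u (\<lambda>s. G n s $ i $ k) ({x<..y} - J) - f0 * deriv_measure L u ({x<..y} - J)\<bar>
    \<le> c * deriv_mass L u ({x<..y} - J)"
proof (rule deriv_integral_bound[OF u L])
  show "continuous_on (({x<..y} - J) \<inter> {0<..<L}) (\<lambda>s. G n s $ i $ k)"
    using xy by (intro continuous_at_imp_continuous_on ballI isCont_vec_nth isCont_G)
      (auto simp: disjoint_iff)
qed (use c in auto)

text \<open>The integrand is frozen at 0: entries of a rotation are bounded by 3, and passing from
  entries to the matrix costs another 3.\<close>

lemma G_component_bound:
  assumes xy: "0 < x" "x < y" "y < L" "{x..y} \<inter> S n = {}"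
  shows "norm (G n y - G n x) \<le> 9 * omega_mass ({x<..y} - J)"
proof -
  have "\<bar>(G n y - G n x) $ i $ j\<bar> \<le> (\<Sum>k\<in>UNIV. 3 * deriv_mass L (\<lambda>s. U s $ k $ j) ({x<..y} - J))" for i j
  proof -
    have "\<bar>(G n y - G n x) $ i $ j\<bar>
      \<le> (\<Sum>k\<in>UNIV. \<bar>deriv_integral L (\<lambda>s. U s $ k $ j) (\<lambda>s. G n s $ i $ k) ({x<..y} - J)\<bar>)"
      unfolding G_increment[OF xy] abs_minus_cancel by (rule sum_abs)
    also have "\<dots> \<le> (\<Sum>k\<in>UNIV. 3 * deriv_mass L (\<lambda>s. U s $ k $ j) ({x<..y} - J))"
    proof (intro sum_mono)
      fix k :: 3
      have "\<bar>G n s $ i $ k - 0\<bar> \<le> 3" if "x < s" "s \<le> y" for s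
      proof -
        have "rotation_matrix (G n s)" using that xy by (intro rotation_G) (auto simp: disjoint_iff)
        then show ?thesis
          using norm_rotation_matrix_le abs_matrix_entry_le[of "G n s" i k] by fastforce
      qed
      from deriv_integral_G_bound[OF xy BV_U this]
      show "\<bar>deriv_integral L (\<lambda>s. U s $ k $ j) (\<lambda>s. G n s $ i $ k) ({x<..y} - J)\<bar>
        \<le> 3 * deriv_mass L (\<lambda>s. U s $ k $ j) ({x<..y} - J)" by simp
    qed
    finally show ?thesis .
  qed
  from norm_matrix_le_triple_sum[OF this] show ?thesis by (simp add: omega_mass_def)
qed

text \<open>The integrand is frozen at its value in \<open>x\<close>. By
  \<open>G_component_bound\<close> it moves by at most 9 times the mass, and one more factor 3 times
  the mass comes from integrating, so the remainder is of second order.\<close>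

lemma G_component_linear:
  assumes xy: "0 < x" "x < y" "y < L" "{x..y} \<inter> S n = {}"
  shows "norm (G n y - G n x + G n x ** DU ({x<..y} - J)) \<le> 27 * (omega_mass ({x<..y} - J))\<^sup>2"
proof -
  let ?A = "{x<..y} - J"
  have "\<bar>(G n y - G n x + G n x ** DU ?A) $ i $ j\<bar>
      \<le> (\<Sum>k\<in>UNIV. (9 * omega_mass ?A) * deriv_mass L (\<lambda>s. U s $ k $ j) ?A)" for i j
  proof -
    have "(G n y - G n x + G n x ** DU ?A) $ i $ j
      = (G n y - G n x) $ i $ j + (\<Sum>k\<in>UNIV. G n x $ i $ k * deriv_measure L (\<lambda>s. U s $ k $ j) ?A)"
      by (simp add: matrix_matrix_mult_def mat_deriv_measure_def)
    also have "\<dots> = - (\<Sum>k\<in>UNIV. deriv_integral L (\<lambda>s. U s $ k $ j) (\<lambda>s. G n s $ i $ k) ?A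
        - G n x $ i $ k * deriv_measure L (\<lambda>s. U s $ k $ j) ?A)"
      unfolding G_increment[OF xy] by (simp add: sum_subtractf)
    finally have eq: "(G n y - G n x + G n x ** DU ?A) $ i $ j
      = - (\<Sum>k\<in>UNIV. deriv_integral L (\<lambda>s. U s $ k $ j) (\<lambda>s. G n s $ i $ k) ?A
        - G n x $ i $ k * deriv_measure L (\<lambda>s. U s $ k $ j) ?A)" .
    have "\<bar>(G n y - G n x + G n x ** DU ?A) $ i $ j\<bar> \<le> (\<Sum>k\<in>UNIV. \<bar>deriv_integral L (\<lambda>s. U s $ k $ j) (\<lambda>s. G n s $ i $ k) ?A
        - G n x $ i $ k * deriv_measure L (\<lambda>s. U s $ k $ j) ?A\<bar>)"
      unfolding eq abs_minus_cancel by (rule sum_abs)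
    also have "\<dots> \<le> (\<Sum>k\<in>UNIV. (9 * omega_mass ?A) * deriv_mass L (\<lambda>s. U s $ k $ j) ?A)"
    proof (rule sum_mono)
      fix k :: 3
      have "\<bar>G n s $ i $ k - G n x $ i $ k\<bar> \<le> 9 * omega_mass ?A" if s: "x < s" "s \<le> y" for s
      proof -
        have "\<bar>G n s $ i $ k - G n x $ i $ k\<bar> \<le> norm (G n s - G n x)"
          using abs_matrix_entry_le[of "G n s - G n x" i k] by simp
        also have "\<dots> \<le> 9 * omega_mass ({x<..s} - J)"
          by (rule G_component_bound) (use s xy in \<open>auto simp: disjoint_iff\<close>)
        also have "\<dots> \<le> 9 * omega_mass ?A"
          using s by (intro mult_left_mono omega_mass_mono) auto
        finally show ?thesis .
      qed
      then show "\<bar>deriv_integral L (\<lambda>s. U s $ k $ j) (\<lambda>s. G n s $ i $ k) ?A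
        - G n x $ i $ k * deriv_measure L (\<lambda>s. U s $ k $ j) ?A\<bar> \<le> (9 * omega_mass ?A) * deriv_mass L (\<lambda>s. U s $ k $ j) ?A"
        by (rule deriv_integral_G_bound[OF xy BV_U])
    qed
    finally show ?thesis .
  qed
  from norm_matrix_le_triple_sum[OF this] show ?thesis by (simp add: omega_mass_def[symmetric] power2_eq_square)
qed

text \<open>The first column of \<open>U\<close> has the single entry \<open>- \<theta>\<close>, so
  the tangent moves by the integral of the normal against the measure of \<theta>. That measure is
  nonnegative; its diffuse mass on the interval is the \<open>m\<close> sought, and replacing the
  normal by \<open>w\<close> gives an error of \<delta> times \<open>m\<close> in each of three
  components.\<close>

lemma tangent_component:
  assumes xy: "0 < x" "x < y" "y < L" "{x..y} \<inter> S n = {}"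
    and w: "\<And>s. x \<le> s \<Longrightarrow> s \<le> y \<Longrightarrow> norm (G n s *v axis 2 1 - w) \<le> \<delta>"
  shows "\<exists>m\<ge>0. norm (G n y *v axis 1 1 - G n x *v axis 1 1 - m *\<^sub>R w) \<le> (3 * \<delta>) * m"
proof -
  let ?A = "{x<..y} - J"
  let ?m = "deriv_measure L \<theta> ?A"
  have m: "deriv_mass L \<theta> ?A = ?m" by (rule deriv_mass_eq_deriv_measure_mono[OF BV_theta L theta_mono])
  have m0: "0 \<le> ?m" using deriv_mass_nonneg[of L \<theta> ?A] m by simp
  let ?v = "G n y *v axis 1 1 - G n x *v axis 1 1 - ?m *\<^sub>R w"
  have "\<bar>?v $ i\<bar> \<le> \<delta> * ?m" for i
  proof -
    have "?v $ i = (G n y - G n x) $ i $ 1 - ?m * w $ i"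
      by (simp add: matrix_vector_mult_basis column_def)
    also have "\<dots> = deriv_integral L \<theta> (\<lambda>s. G n s $ i $ 2) ?A - w $ i * ?m"
      unfolding G_increment[OF xy]
      by (simp add: sum_3 U_entries deriv_integral_zero[OF L] deriv_integral_uminus[OF BV_theta L])
    finally have eq: "?v $ i = deriv_integral L \<theta> (\<lambda>s. G n s $ i $ 2) ?A - w $ i * ?m" .
    have "\<bar>?v $ i\<bar> \<le> \<delta> * deriv_mass L \<theta> ?A"
      unfolding eq
    proof (rule deriv_integral_G_bound[OF xy BV_theta])
      fix s assume "x < s" "s \<le> y"
      then have "norm (G n s *v axis 2 1 - w) \<le> \<delta>" by (intro w) auto
      moreover have "\<bar>(G n s *v axis 2 1 - w) $ i\<bar> \<le> norm (G n s *v axis 2 1 - w)"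
        by (rule component_le_norm_cart)
      ultimately show "\<bar>G n s $ i $ 2 - w $ i\<bar> \<le> \<delta>"
        by (simp add: matrix_vector_mult_basis column_def)
    qed
    then show ?thesis by (simp add: m)
  qed
  then have "(\<Sum>i\<in>(UNIV::3 set). \<bar>?v $ i\<bar>) \<le> (\<Sum>i\<in>(UNIV::3 set). \<delta> * ?m)"
    by (intro sum_mono)
  then have "norm ?v \<le> (3 * \<delta>) * ?m"
    using norm_le_l1_cart[of ?v] by simp
  with m0 show ?thesis by blast
qed

end

section \<open>Jumps and total increments of an approximating frame\<close>

lemma norm_jump_axis: "s \<in> J \<Longrightarrow> norm (jump_axis \<theta> \<phi> s) = 1"
proof -
  assume "s \<in> J"
  then have "0 < jump_angle \<theta> \<phi> s" by (rule angle_pos)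
  moreover have "norm (vector [jump \<phi> s, 0, jump \<theta> s] :: real^3) = jump_angle \<theta> \<phi> s"
    by (simp add: norm_eq_sqrt_inner inner_vec_def sum_3 jump_angle_def power2_eq_square add.commute)
  ultimately show ?thesis by (simp add: jump_axis_def)
qed

definition Rot :: "real \<Rightarrow> real^3^3" where
  "Rot s = axis_rotation (jump_axis \<theta> \<phi> s) (jump_angle \<theta> \<phi> s)"

text \<open>As a right factor the jump rotation depends on \<open>s\<close> alone and is common to
  all frames that retain \<open>s\<close>.\<close>

lemma G_jump:
  assumes n: "1 \<le> n" and s: "s \<in> S n"
  shows "rlim (G n) s = llim (G n) s ** Rot s"
proof -
  have "0 < s" "s < L" using s S_subset J_subset by fastforce+
  then have "rotation_matrix (llim (G n) s)" by (rule rotation_limits[OF n])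
  moreover have "rlim (G n) s = axis_rotation (llim (G n) s *v jump_axis \<theta> \<phi> s) (jump_angle \<theta> \<phi> s) ** llim (G n) s"
    using frames[OF n] s by (simp add: approx_frame_def)
  ultimately show ?thesis by (simp add: axis_rotation_conj Rot_def)
qed

lemma norm_G_jump:
  assumes n: "1 \<le> n" and s: "0 < s" "s < L"
  shows "norm (rlim (G n) s - llim (G n) s) \<le> 27 * omega_mass {s}"
proof (cases "s \<in> S n")
  case True
  then have sJ: "s \<in> J" using S_subset by auto
  have "rlim (G n) s - llim (G n) s = llim (G n) s ** (Rot s - mat 1)"
    by (simp add: G_jump[OF n True] matrix_mult_diff_right)
  then have "norm (rlim (G n) s - llim (G n) s) \<le> norm (llim (G n) s) * norm (Rot s - mat 1)"
    by (simp add: norm_matrix_mult_le)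
  also have "\<dots> \<le> 3 * (9 * jump_angle \<theta> \<phi> s)"
    unfolding Rot_def using angle_pos[OF sJ]
    by (intro mult_mono norm_rotation_matrix_le rotation_limits[OF n s] norm_axis_rotation_diff norm_jump_axis sJ) auto
  also have "\<dots> \<le> 27 * omega_mass {s}" using jump_le_omega_mass(1)[OF s] by simp
  finally show ?thesis .
next
  case False
  then show ?thesis using G_limits_cont[OF n s] by (simp add: omega_mass_nonneg)
qed

text \<open>Chaining of the diffuse bound, with constant 9, and the jump bound, with constant
  \<open>27 = 3 * 9\<close>.\<close>

lemma G_bound:
  assumes n: "1 \<le> n" and xy: "0 < x" "x < y" "y < L" "x \<notin> S n" "y \<notin> S n"
  shows "norm (G n y - G n x) \<le> 27 * omega_mass {x<..y}"
proof (rule chaining_content[where F="S n" and N="\<lambda>A. 27 * omega_mass A"])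
  show "additive_content (\<lambda>A. 27 * omega_mass A)"
    using additive_content_scale[OF additive_omega_mass, of 27] by simp
  show "norm (G n v - G n u) \<le> 27 * omega_mass {u<..v}" if "x \<le> u" "u < v" "v \<le> y" "{u..v} \<inter> S n = {}" for u v
  proof -
    have "norm (G n v - G n u) \<le> 9 * omega_mass ({u<..v} - J)"
      using that xy by (intro G_component_bound[OF n]) auto
    also have "\<dots> \<le> 27 * omega_mass {u<..v}"
      using omega_mass_nonneg[of "{u<..v} - J"] by (intro mult_mono omega_mass_mono) auto
    finally show ?thesis .
  qed
  show "\<exists>l r. (G n \<longlongrightarrow> l) (at_left s) \<and> (G n \<longlongrightarrow> r) (at_right s) \<and> norm (r - l) \<le> 27 * omega_mass {s}"
    if "x < s" "s < y" for s
    using G_limits[OF n, of s] norm_G_jump[OF n, of s] that xy by auto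
qed (use finite_S[OF n] xy omega_mass_nonneg in auto)

text \<open>Normals on the interval differ from the axis by at most \<delta>, that is 27 times the
  mass. Diffuse pieces and jumps both deviate from the axis direction by at most
  \<open>3 * \<delta>\<close> relative to their own part of the increment of \<theta>;
  \<open>cone_near\<close> doubles this to \<open>6 * 27 = 162\<close>.\<close>

lemma tangent_cone:
  assumes n: "1 \<le> n" and xy: "0 < x" "x < y" "y < L" "x \<notin> S n" "y \<notin> S n"
    and x0: "x \<le> x0" "x0 \<le> y" "x0 \<notin> S n" and small: "81 * omega_mass {x<..y} \<le> 1 / 2"
  shows "G n y *v axis 1 1 - G n x *v axis 1 1 \<in> axis_cone (G n x0 *v axis 2 1) (162 * omega_mass {x<..y})"
proof -
  let ?w = "G n x0 *v axis 2 1"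
  define \<delta> where "\<delta> = 27 * omega_mass {x<..y}"
  have d0: "0 \<le> \<delta>" by (simp add: \<delta>_def omega_mass_nonneg)
  have w1: "norm ?w = 1"
    using rotation_G[OF n, of x0] x0 xy by (simp add: rotation_matrix_def orthogonal_matrix_norm)
  have near: "norm (G n s *v axis 2 1 - ?w) \<le> \<delta>" if s: "x \<le> s" "s \<le> y" "s \<notin> S n" for s
  proof -
    have "norm (G n s - G n x0) \<le> \<delta>"
    proof (cases s x0 rule: linorder_cases)
      case less
      have "norm (G n x0 - G n s) \<le> 27 * omega_mass {s<..x0}" using less s x0 xy by (intro G_bound n) auto
      also have "\<dots> \<le> \<delta>" unfolding \<delta>_def using s x0 by (intro mult_left_mono omega_mass_mono) auto
      finally show ?thesis by (simp add: norm_minus_commute)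
    next
      case equal
      then show ?thesis using d0 by simp
    next
      case greater
      have "norm (G n s - G n x0) \<le> 27 * omega_mass {x0<..s}" using greater s x0 xy by (intro G_bound n) auto
      also have "\<dots> \<le> \<delta>" unfolding \<delta>_def using s x0 by (intro mult_left_mono omega_mass_mono) auto
      finally show ?thesis .
    qed
    then show ?thesis
      using norm_matrix_vector_mult_le[of "G n s - G n x0" "axis 2 1"]
      by (simp add: matrix_vector_mult_diff_rdistrib)
  qed
  have cone: "v \<in> axis_cone ?w (162 * omega_mass {x<..y})" if "norm (v - m *\<^sub>R ?w) \<le> (3 * \<delta>) * m" "0 \<le> m" for v m
    using cone_near[OF w1 that] small d0 by (simp add: \<delta>_def)
  show ?thesis
  proof (rule chaining[where F="S n" and Q="\<lambda>_. axis_cone ?w (162 * omega_mass {x<..y})" and a=x and b=y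
        and f="\<lambda>s. G n s *v axis 1 1"])
    fix u v assume uv: "x \<le> u" "u < v" "v \<le> y" "{u..v} \<inter> S n = {}"
    have "\<exists>m\<ge>0. norm (G n v *v axis 1 1 - G n u *v axis 1 1 - m *\<^sub>R ?w) \<le> (3 * \<delta>) * m"
      by (rule tangent_component[OF n]) (use uv xy near in \<open>auto simp: disjoint_iff\<close>)
    then show "G n v *v axis 1 1 - G n u *v axis 1 1 \<in> axis_cone ?w (162 * omega_mass {x<..y})" using cone by blast
  next
    fix s assume s: "s \<in> S n" "x < s" "s < y"
    have sL: "0 < s" "s < L" using s xy by auto
    have sJ: "s \<in> J" using s S_subset by auto
    let ?l = "llim (G n) s" and ?r = "rlim (G n) s" and ?d = "jump \<theta> s"
    have lim: "((\<lambda>s. G n s *v e) \<longlongrightarrow> ?l *v e) (at_left s)" "((\<lambda>s. G n s *v e) \<longlongrightarrow> ?r *v e) (at_right s)" for e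
      using G_limits[OF n sL] by (auto intro!: tendsto_matrix_vector_mult)
    have l: "norm (?l *v axis 2 1 - ?w) \<le> \<delta>"
    proof (rule tendsto_upperbound)
      show "((\<lambda>s. norm (G n s *v axis 2 1 - ?w)) \<longlongrightarrow> norm (?l *v axis 2 1 - ?w)) (at_left s)"
        by (intro tendsto_intros lim)
      have "eventually (\<lambda>z. x < z \<and> z < s) (at_left s)"
        using eventually_at_left_real[OF s(2)] by (auto elim: eventually_mono)
      then show "eventually (\<lambda>z. norm (G n z *v axis 2 1 - ?w) \<le> \<delta>) (at_left s)"
        using eventually_notin_S_left[OF n sL(1) less_imp_le[OF sL(2)]]
        by eventually_elim (use s near in auto)
    qed auto
    have d: "0 \<le> ?d"
      using deriv_mass_nonneg[of L \<theta> "{s}"] deriv_mass_eq_deriv_measure_mono[OF BV_theta L theta_mono, of "{s}"] jump_le_omega_mass(2)[OF sL]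
      by simp
    have "jump_angle \<theta> \<phi> s \<le> omega_mass {s}" by (rule jump_le_omega_mass(1)[OF sL])
    also have "\<dots> \<le> omega_mass {x<..y}" using s by (intro omega_mass_mono) auto
    finally have a: "2 * jump_angle \<theta> \<phi> s \<le> 2 * \<delta>" using omega_mass_nonneg[of "{x<..y}"] by (simp add: \<delta>_def)
    have e: "norm (Rot s *v axis 1 1 - axis 1 1 - ?d *\<^sub>R axis 2 1) \<le> 2 * (\<bar>?d\<bar> * jump_angle \<theta> \<phi> s)"
      unfolding Rot_def jump_axis_def jump_angle_def
      by (rule norm_axis_rotation_e1) (use angle_pos[OF sJ] in \<open>simp add: jump_angle_def\<close>)
    \<comment> \<open>The left limit is an isometry, so the error of the jump rotation in the fixed
      frame carries over; the remaining term compares the normal before the jump with the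
      axis.\<close>
    have "?r *v axis 1 1 - ?l *v axis 1 1 - ?d *\<^sub>R ?w
      = ?l *v (Rot s *v axis 1 1 - axis 1 1 - ?d *\<^sub>R axis 2 1) + ?d *\<^sub>R (?l *v axis 2 1 - ?w)"
      by (simp add: G_jump[OF n s(1)] matrix_vector_mult_diff_distrib matrix_vector_mult_scaleR
          scaleR_diff_right flip: matrix_vector_mul_assoc)
    also have "norm \<dots> \<le> norm (?l *v (Rot s *v axis 1 1 - axis 1 1 - ?d *\<^sub>R axis 2 1)) + norm (?d *\<^sub>R (?l *v axis 2 1 - ?w))"
      by (rule norm_triangle_ineq)
    also have "\<dots> \<le> ?d * (2 * jump_angle \<theta> \<phi> s) + ?d * \<delta>"
      using rotation_limits(1)[OF n sL] e d l
      by (intro add_mono) (auto simp: rotation_matrix_def orthogonal_matrix_norm mult_left_mono)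
    also have "\<dots> \<le> ?d * (2 * \<delta>) + ?d * \<delta>" using a d by (intro add_mono mult_left_mono) auto
    also have "\<dots> = (3 * \<delta>) * ?d" by simp
    finally have "?r *v axis 1 1 - ?l *v axis 1 1 \<in> axis_cone ?w (162 * omega_mass {x<..y})" using d by (rule cone)
    then show "\<exists>l r. ((\<lambda>s. G n s *v axis 1 1) \<longlongrightarrow> l) (at_left s) \<and> ((\<lambda>s. G n s *v axis 1 1) \<longlongrightarrow> r) (at_right s)
        \<and> r - l \<in> axis_cone ?w (162 * omega_mass {x<..y})"
      using lim by blast
  qed (use finite_S[OF n] xy closed_cone in \<open>auto intro: cone_add\<close>)
qed

end

section \<open>The limit frame\<close>

lemma norm_integral_le_ae:
  fixes f :: "real \<Rightarrow> 'a::euclidean_space"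
  assumes f: "f integrable_on {a..b}" and Z: "negligible Z" and ab: "a \<le> b"
    and B: "\<And>s. s \<in> {a..b} - Z \<Longrightarrow> norm (f s) \<le> B" and B0: "0 \<le> B"
  shows "norm (integral {a..b} f) \<le> B * (b - a)"
proof -
  let ?g = "\<lambda>s. if s \<in> Z then 0 else f s"
  have g: "(?g has_integral integral {a..b} f) {a..b}"
    by (rule has_integral_spike[OF Z _ integrable_integral[OF f]]) auto
  have "norm (integral {a..b} ?g) \<le> integral {a..b} (\<lambda>s. B)"
    by (rule integral_norm_bound_integral) (use g B B0 in \<open>auto intro: has_integral_integrable\<close>)
  then show ?thesis using integral_unique[OF g] ab by (simp add: mult.commute)
qed

lemma integrable_on_cong_negligible:
  fixes f :: "real \<Rightarrow> 'a::euclidean_space"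
  assumes "f integrable_on ({a<..<b} - Z)" "negligible Z"
  shows "f integrable_on {a..b}"
proof (rule integrable_spike_set[OF assms(1)])
  show "negligible {x \<in> ({a<..<b} - Z) - {a..b}. f x \<noteq> 0}"
    by (rule negligible_subset[of "{}"]) auto
  show "negligible {x \<in> {a..b} - ({a<..<b} - Z). f x \<noteq> 0}"
    by (rule negligible_subset[of "insert a (insert b Z)"]) (use assms(2) in \<open>auto simp: negligible_insert\<close>)
qed

lemma integrable_on_remove_negligible:
  fixes f :: "real \<Rightarrow> 'a::euclidean_space"
  assumes "f integrable_on {a..b}" "negligible Z"
  shows "f integrable_on ({a<..<b} - Z)"
proof (rule integrable_spike_set[OF assms(1)])
  show "negligible {x \<in> ({a<..<b} - Z) - {a..b}. f x \<noteq> 0}"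
    by (rule negligible_subset[of "{}"]) auto
  show "negligible {x \<in> {a..b} - ({a<..<b} - Z). f x \<noteq> 0}"
    by (rule negligible_subset[of "insert a (insert b Z)"]) (use assms(2) in \<open>auto simp: negligible_insert\<close>)
qed

context approx_frames
begin

section \<open>Comparison of two approximating frames\<close>

text \<open>Without the jump set there are no atoms left. Continuity is needed to split an interval
  into two parts of equal diffuse mass.\<close>

lemma omega_mass_diffuse_continuous: "isCont (\<lambda>s. omega_mass (- J \<inter> {..s})) x"
proof -
  have "deriv_mass L (\<lambda>s. U s $ k $ j) {s} = 0" if "s \<in> - J" "0 < s" "s < L" for k j s
    using deriv_mass_le_omega_mass[of k j "{s}"] deriv_mass_nonneg[of L "\<lambda>s. U s $ k $ j" "{s}"] omega_mass_singleton_eq_0[of s] that by simp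
  then have "isCont (\<lambda>s. deriv_mass L (\<lambda>s. U s $ k $ j) (- J \<inter> {..s})) x" for k j
    by (intro deriv_mass_continuous BV_U L) auto
  then show ?thesis unfolding omega_mass_def by (intro continuous_sum)
qed

text \<open>The terms linear in \<open>DU\<close> cancel because \<open>DU\<close> is antisymmetric.\<close>

lemma product_constant:
  assumes n: "1 \<le> n" "n \<le> m" and xy: "0 < x" "x < y" "y < L" "{x..y} \<inter> S m = {}"
  shows "G n y ** transpose (G m y) = G n x ** transpose (G m x)"
\<comment> \<open>The constant is \<open>81 + 81 + 27\<close>: two second-order remainders, each
  multiplied by a rotation, and one product of two first-order terms.\<close>
proof (rule constant_of_quadratic_increments[where w="\<lambda>s. omega_mass (- J \<inter> {..s})" and C=189])
  have m: "1 \<le> m" using n by simp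
  have xyn: "{x..y} \<inter> S n = {}" using xy(4) S_mono[OF n] by blast
  show "continuous_on {x..y} (\<lambda>s. omega_mass (- J \<inter> {..s}))"
    using omega_mass_diffuse_continuous by (simp add: continuous_at_imp_continuous_on)
  show "omega_mass (- J \<inter> {..u}) \<le> omega_mass (- J \<inter> {..v})" if "u \<le> v" for u v
    using that by (intro omega_mass_mono) auto
  fix u v assume uv: "x \<le> u" "u \<le> v" "v \<le> y"
  show "norm (G n v ** transpose (G m v) - G n u ** transpose (G m u))
    \<le> 189 * (omega_mass (- J \<inter> {..v}) - omega_mass (- J \<inter> {..u}))\<^sup>2"
  proof (cases "u = v")
    case False
    then have less: "u < v" using uv by simp
    have sub: "{u..v} \<inter> S n = {}" "{u..v} \<inter> S m = {}" using xy(4) xyn uv unfolding disjoint_iff by auto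
    have L': "0 < u" "v < L" using uv xy by auto
    let ?E = "{u<..v} - J"
    have N': "omega_mass (- J \<inter> {..v}) - omega_mass (- J \<inter> {..u}) = omega_mass ?E"
    proof -
      have "- J \<inter> {..v} = (- J \<inter> {..u}) \<union> ?E" using less by auto
      moreover have "omega_mass ((- J \<inter> {..u}) \<union> ?E) = omega_mass (- J \<inter> {..u}) + omega_mass ?E"
        by (rule additive_contentD[OF additive_omega_mass]) auto
      ultimately show ?thesis by simp
    qed
    let ?D = "DU ?E"
    define a b where "a = G n v - G n u + G n u ** ?D" and "b = G m v - G m u + G m u ** ?D"
    have a: "norm a \<le> 27 * (omega_mass ?E)\<^sup>2" unfolding a_def
      using n(1) L'(1) less L'(2) sub(1) by (rule G_component_linear)
    have b: "norm b \<le> 27 * (omega_mass ?E)\<^sup>2" unfolding b_def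
      using m L'(1) less L'(2) sub(2) by (rule G_component_linear)
    have dB: "norm (G m v - G m u) \<le> 9 * omega_mass ?E"
      using m L'(1) less L'(2) sub(2) by (rule G_component_bound)
    have rot: "rotation_matrix (G n u)" "rotation_matrix (G m v)"
      using sub less L' by (auto intro!: rotation_G n(1) m simp: disjoint_iff)
    \<comment> \<open>Transposing \<open>- G m u ** ?D\<close> with antisymmetric \<open>?D\<close>
      reverses the sign, so this first-order term is opposite to that of \<open>G n\<close>.\<close>
    have tb: "transpose (G m v) - transpose (G m u) = transpose b + ?D ** transpose (G m u)"
    proof -
      have "transpose b = transpose (G m v) - transpose (G m u) + transpose (G m u ** ?D)"
        unfolding b_def by (simp add: transpose_def vec_eq_iff)
      moreover have "transpose (G m u ** ?D) = - (?D ** transpose (G m u))"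
        unfolding matrix_transpose_mul DU_antisym by (simp add: matrix_matrix_mult_def vec_eq_iff sum_negf)
      ultimately show ?thesis by simp
    qed
    \<comment> \<open>Discrete product rule. In the last term of the next equation the first-order
      parts have cancelled up to an increment of \<open>G m\<close>.\<close>
    have "G n v ** transpose (G m v) - G n u ** transpose (G m u)
      = (G n v - G n u) ** transpose (G m v) + G n u ** (transpose (G m v) - transpose (G m u))"
      by (simp add: matrix_mult_diff_left matrix_mult_diff_right)
    also have "\<dots> = a ** transpose (G m v) + G n u ** transpose b
        - (G n u ** ?D) ** (transpose (G m v) - transpose (G m u))"
    proof -
      have "G n v - G n u = a - G n u ** ?D" by (simp add: a_def)
      then have "(G n v - G n u) ** transpose (G m v) = a ** transpose (G m v) - (G n u ** ?D) ** transpose (G m v)"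
        by (simp add: matrix_mult_diff_left)
      moreover have "G n u ** (transpose (G m v) - transpose (G m u))
        = G n u ** transpose b + (G n u ** ?D) ** transpose (G m u)"
        unfolding tb by (simp add: matrix_add_ldistrib matrix_mul_assoc)
      ultimately show ?thesis by (simp add: matrix_mult_diff_right)
    qed
    finally have eq: "G n v ** transpose (G m v) - G n u ** transpose (G m u)
      = a ** transpose (G m v) + G n u ** transpose b
        - (G n u ** ?D) ** (transpose (G m v) - transpose (G m u))" .
    have "norm (a ** transpose (G m v)) \<le> (27 * (omega_mass ?E)\<^sup>2) * 3"
      using a norm_rotation_matrix_le[OF rot(2)]
      by (intro order_trans[OF norm_matrix_mult_le] mult_mono) (auto simp: norm_transpose)
    moreover have "norm (G n u ** transpose b) \<le> 3 * (27 * (omega_mass ?E)\<^sup>2)"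
      using b norm_rotation_matrix_le[OF rot(1)]
      by (intro order_trans[OF norm_matrix_mult_le] mult_mono) (auto simp: norm_transpose)
    moreover have "norm ((G n u ** ?D) ** (transpose (G m v) - transpose (G m u))) \<le> (3 * omega_mass ?E) * (9 * omega_mass ?E)"
    proof (rule order_trans[OF norm_matrix_mult_le], rule mult_mono)
      show "norm (G n u ** ?D) \<le> 3 * omega_mass ?E"
        using norm_DU_le[of ?E] norm_rotation_matrix_le[OF rot(1)]
        by (intro order_trans[OF norm_matrix_mult_le] mult_mono) auto
      have "transpose (G m v) - transpose (G m u) = transpose (G m v - G m u)"
        by (simp add: transpose_def vec_eq_iff)
      then show "norm (transpose (G m v) - transpose (G m u)) \<le> 9 * omega_mass ?E"
        using dB by (simp add: norm_transpose)
    qed (use omega_mass_nonneg[of ?E] in auto)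
    moreover have "norm (p + q - r) \<le> norm p + norm q + norm r" for p q r :: "real^3^3"
      using norm_triangle_ineq4[of "p + q" r] norm_triangle_ineq[of p q] by linarith
    ultimately have "norm (G n v ** transpose (G m v) - G n u ** transpose (G m u))
      \<le> (27 * (omega_mass ?E)\<^sup>2) * 3 + 3 * (27 * (omega_mass ?E)\<^sup>2) + (3 * omega_mass ?E) * (9 * omega_mass ?E)"
      unfolding eq by (smt (verit))
    also have "\<dots> = 189 * (omega_mass ?E)\<^sup>2" by (simp add: power2_eq_square)
    finally show ?thesis by (simp only: N')
  qed simp
qed (use xy in auto)

text \<open>At the points of \<open>S n\<close> both frames are multiplied by the same rotation from the right, so the
  product does not jump there.\<close>

lemma product_jump:
  assumes n: "1 \<le> n" "n \<le> m" and s: "s \<in> S m"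
  shows "norm (rlim (G n) s ** transpose (rlim (G m) s) - llim (G n) s ** transpose (llim (G m) s))
    \<le> 81 * omega_mass ({s} \<inter> (J - S n))"
proof -
  have m: "1 \<le> m" using n by simp
  have sJ: "s \<in> J" using s S_subset by blast
  have sL: "0 < s" "s < L" using sJ J_subset by fastforce+
  note rn = rotation_limits[OF n(1) sL] and rm = rotation_limits[OF m sL]
  show ?thesis
  proof (cases "s \<in> S n")
    case True
    \<comment> \<open>Orthogonality of \<open>Rot s\<close> is read off from its being a product of
      two orthogonal matrices, without computing in Rodrigues' formula.\<close>
    have "transpose (llim (G n) s) ** rlim (G n) s = Rot s"
      using rn(1) by (simp add: G_jump[OF n(1) True] matrix_mul_assoc rotation_matrix_def orthogonal_matrix_def)
    moreover have "orthogonal_matrix (transpose (llim (G n) s) ** rlim (G n) s)"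
      using rn by (intro orthogonal_matrix_mul) (auto simp: rotation_matrix_def)
    ultimately have R: "Rot s ** transpose (Rot s) = mat 1" by (simp add: orthogonal_matrix_def)
    have "rlim (G n) s ** transpose (rlim (G m) s)
      = llim (G n) s ** ((Rot s ** transpose (Rot s)) ** transpose (llim (G m) s))"
      by (simp only: G_jump[OF n(1) True] G_jump[OF m s] matrix_transpose_mul matrix_mul_assoc)
    then show ?thesis using R omega_mass_nonneg by simp
  next
    case False
    have "{s} \<inter> (J - S n) = {s}" using False sJ by auto
    moreover have "rlim (G n) s ** transpose (rlim (G m) s) - llim (G n) s ** transpose (llim (G m) s)
      = G n s ** transpose (rlim (G m) s - llim (G m) s)"
      using G_limits_cont[OF n(1) sL False]
      by (simp add: transpose_def vec_eq_iff matrix_matrix_mult_def right_diff_distrib sum_subtractf)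
    moreover have "norm (G n s ** transpose (rlim (G m) s - llim (G m) s)) \<le> 3 * (27 * omega_mass {s})"
      using norm_G_jump[OF m sL] norm_rotation_matrix_le[OF rotation_G[OF n(1) sL False]]
      by (intro order_trans[OF norm_matrix_mult_le] mult_mono) (auto simp: norm_transpose)
    ultimately show ?thesis by simp
  qed
qed

text \<open>Only the jumps retained by \<open>G m\<close> but not by \<open>G n\<close> contribute,
  so chaining is done with the mass restricted to \<open>J - S n\<close>.\<close>

lemma product_bound:
  assumes n: "1 \<le> n" "n \<le> m" and xy: "0 < x" "x < y" "y < L" "x \<notin> S m" "y \<notin> S m"
  shows "norm (G n y ** transpose (G m y) - G n x ** transpose (G m x)) \<le> 81 * omega_mass (J - S n)"
proof -
  have m: "1 \<le> m" using n by simp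
  have "norm (G n y ** transpose (G m y) - G n x ** transpose (G m x)) \<le> 81 * omega_mass ({x<..y} \<inter> (J - S n))"
  proof (rule chaining_content[where F="S m" and N="\<lambda>A. 81 * omega_mass (A \<inter> (J - S n))"])
    show "additive_content (\<lambda>A. 81 * omega_mass (A \<inter> (J - S n)))"
      using additive_content_scale[OF additive_content_restrict[OF additive_omega_mass], of "J - S n" 81] by simp
    show "norm (G n v ** transpose (G m v) - G n u ** transpose (G m u)) \<le> 81 * omega_mass ({u<..v} \<inter> (J - S n))"
      if "x \<le> u" "u < v" "v \<le> y" "{u..v} \<inter> S m = {}" for u v
    proof -
      have "G n v ** transpose (G m v) = G n u ** transpose (G m u)"
        by (rule product_constant[OF n]) (use that xy in auto)
      then show ?thesis using omega_mass_nonneg by simp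
    qed
    show "\<exists>l r. ((\<lambda>s. G n s ** transpose (G m s)) \<longlongrightarrow> l) (at_left s) \<and>
        ((\<lambda>s. G n s ** transpose (G m s)) \<longlongrightarrow> r) (at_right s) \<and> norm (r - l) \<le> 81 * omega_mass ({s} \<inter> (J - S n))"
      if s: "s \<in> S m" "x < s" "s < y" for s
    proof -
      have sL: "0 < s" "s < L" using s xy by auto
      show ?thesis
        using product_jump[OF n s(1)] G_limits[OF n(1) sL] G_limits[OF m sL]
        by (intro exI conjI) (auto intro!: tendsto_matrix_mult tendsto_transpose)
    qed
  qed (use finite_S[OF m] xy omega_mass_nonneg in auto)
  also have "\<dots> \<le> 81 * omega_mass (J - S n)" by (intro mult_left_mono omega_mass_mono) auto
  finally show ?thesis .
qed

text \<open>Both frames start from the identity, so letting \<open>x\<close> tend to 0 compares the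
  product with \<open>mat 1\<close>. Multiplying by \<open>G m y\<close> costs 3, whence
  \<open>243 = 3 * 81\<close>.\<close>

lemma G_diff_bound:
  assumes n: "1 \<le> n" "n \<le> m" and y: "0 < y" "y < L" "y \<notin> S m"
  shows "norm (G n y - G m y) \<le> 243 * omega_mass (J - S n)"
proof -
  have m: "1 \<le> m" using n by simp
  have yn: "y \<notin> S n" using y(3) S_mono[OF n] by blast
  have lim: "((\<lambda>x. norm (G n y ** transpose (G m y) - G n x ** transpose (G m x)))
      \<longlongrightarrow> norm (G n y ** transpose (G m y) - mat 1 ** transpose (mat 1 :: real^3^3))) (at_right 0)"
    by (intro tendsto_norm tendsto_diff tendsto_const tendsto_matrix_mult tendsto_transpose
        G_initial n(1) m)
  have "eventually (\<lambda>x. 0 < x \<and> x < y) (at_right 0)"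
    using eventually_at_right_real[OF y(1)] by (auto elim: eventually_mono)
  then have "eventually (\<lambda>x. norm (G n y ** transpose (G m y) - G n x ** transpose (G m x)) \<le> 81 * omega_mass (J - S n)) (at_right 0)"
    using eventually_notin_S[OF m order_refl L]
    by eventually_elim (use y in \<open>auto intro!: product_bound n\<close>)
  then have P: "norm (G n y ** transpose (G m y) - mat 1) \<le> 81 * omega_mass (J - S n)"
    using tendsto_upperbound[OF lim] by (simp add: transpose_mat)
  have "transpose (G m y) ** G m y = mat 1"
    using rotation_G[OF m y] by (simp add: rotation_matrix_def orthogonal_matrix_def)
  then have "G n y - G m y = (G n y ** transpose (G m y) - mat 1) ** G m y"
    by (simp add: matrix_mult_diff_left flip: matrix_mul_assoc)
  also have "norm \<dots> \<le> (81 * omega_mass (J - S n)) * 3"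
    using P norm_rotation_matrix_le[OF rotation_G[OF m y]] omega_mass_nonneg[of "J - S n"]
    by (intro order_trans[OF norm_matrix_mult_le] mult_mono) auto
  finally show ?thesis by simp
qed

section \<open>The limit frame and its tangent\<close>

text \<open>On \<open>J\<close> the sequence need not converge, since the values at retained jump
  points are unrestricted. \<open>Glim\<close> is meaningful off \<open>J\<close>, and
  \<open>J\<close> is negligible.\<close>

definition Glim :: "real \<Rightarrow> real^3^3" where
  "Glim s = lim (\<lambda>n. G n s)"

lemma G_tendsto:
  assumes "s \<in> {0<..<L} - J"
  shows "(\<lambda>n. G n s) \<longlonglongrightarrow> Glim s"
proof -
  have notin: "s \<notin> S n" for n using S_subset assms by blast
  have "Cauchy (\<lambda>n. G n s)"
    unfolding Cauchy_altdef
  proof (intro allI impI)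
    fix e :: real assume "0 < e"
    then have "0 < e / 243" by simp
    then obtain M where M: "\<And>n. n \<ge> M \<Longrightarrow> omega_mass (J - S n) < e / 243"
      using order_tendstoD(2)[OF omega_mass_tail, of "e / 243"] by (auto simp: eventually_sequentially)
    show "\<exists>M. \<forall>m\<ge>M. \<forall>n>m. dist (G m s) (G n s) < e"
    proof (intro exI allI impI)
      fix m n assume "max M 1 \<le> m" "m < n"
      then have "norm (G m s - G n s) \<le> 243 * omega_mass (J - S m)" "omega_mass (J - S m) < e / 243"
        using assms notin M by (auto intro!: G_diff_bound)
      then show "dist (G m s) (G n s) < e" by (simp add: dist_norm)
    qed
  qed
  then show ?thesis
    unfolding Glim_def using Cauchy_convergent_iff convergent_LIMSEQ_iff by blast
qed

text \<open>\<open>G_diff_bound\<close> does not depend on \<open>m\<close>, so it survives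
  \<open>m\<close> tending to infinity; it is also independent of \<open>s\<close>, which makes the
  convergence uniform off \<open>J\<close>.\<close>

lemma G_Glim_bound:
  assumes "s \<in> {0<..<L} - J" "1 \<le> n"
  shows "norm (G n s - Glim s) \<le> 243 * omega_mass (J - S n)"
proof (rule tendsto_upperbound)
  show "(\<lambda>m. norm (G n s - G m s)) \<longlonglongrightarrow> norm (G n s - Glim s)"
    by (intro tendsto_intros G_tendsto assms)
  have "s \<notin> S m" for m using S_subset assms by blast
  then show "eventually (\<lambda>m. norm (G n s - G m s) \<le> 243 * omega_mass (J - S n)) sequentially"
    using assms by (intro eventually_sequentiallyI[of n] G_diff_bound) auto
qed simp

lemma rotation_Glim:
  assumes "s \<in> {0<..<L} - J"
  shows "rotation_matrix (Glim s)"
proof -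
  have "s \<notin> S m" for m using S_subset assms by blast
  then have "eventually (\<lambda>n. G n s \<in> {A. rotation_matrix A}) sequentially"
    using assms by (intro eventually_sequentiallyI[of 1]) (auto intro: rotation_G)
  then have "Glim s \<in> {A. rotation_matrix A}"
    by (intro Lim_in_closed_set[OF closed_rotation_matrix _ _ G_tendsto[OF assms]]) auto
  then show ?thesis by simp
qed

text \<open>The bound for \<open>G n\<close> is independent of \<open>n\<close>, because the mass
  counts all jumps, retained or not.\<close>

lemma Glim_bound:
  assumes xy: "x \<in> {0<..<L} - J" "y \<in> {0<..<L} - J" "x < y"
  shows "norm (Glim y - Glim x) \<le> 27 * omega_mass {x<..y}"
proof (rule tendsto_upperbound)
  show "(\<lambda>n. norm (G n y - G n x)) \<longlonglongrightarrow> norm (Glim y - Glim x)"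
    by (intro tendsto_intros G_tendsto xy)
  have "x \<notin> S m" "y \<notin> S m" for m using S_subset xy by blast+
  then show "eventually (\<lambda>n. norm (G n y - G n x) \<le> 27 * omega_mass {x<..y}) sequentially"
    using xy by (intro eventually_sequentiallyI[of 1] G_bound) auto
qed simp

lemma Glim_tangent_cone:
  assumes xy: "x \<in> {0<..<L} - J" "y \<in> {0<..<L} - J" "x < y"
    and x0: "x0 \<in> {0<..<L} - J" "x \<le> x0" "x0 \<le> y" and small: "81 * omega_mass {x<..y} \<le> 1 / 2"
  shows "Glim y *v axis 1 1 - Glim x *v axis 1 1 \<in> axis_cone (Glim x0 *v axis 2 1) (162 * omega_mass {x<..y})"
proof (rule cone_limit)
  show "(\<lambda>n. G n y *v axis 1 1 - G n x *v axis 1 1) \<longlonglongrightarrow> Glim y *v axis 1 1 - Glim x *v axis 1 1"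
    by (intro tendsto_diff tendsto_matrix_vector_mult G_tendsto xy)
  show "(\<lambda>n. G n x0 *v axis 2 1) \<longlonglongrightarrow> Glim x0 *v axis 2 1"
    by (intro tendsto_matrix_vector_mult G_tendsto x0)
  have "x \<notin> S m" "y \<notin> S m" "x0 \<notin> S m" for m using S_subset xy x0 by blast+
  then show "eventually (\<lambda>n. G n y *v axis 1 1 - G n x *v axis 1 1
      \<in> axis_cone (G n x0 *v axis 2 1) (162 * omega_mass {x<..y})) sequentially"
    using xy x0 small by (intro eventually_sequentiallyI[of 1] tangent_cone) auto
qed

lemma negligible_J: "negligible J"
  using countable_imp_null_set_lborel[OF countable_J] by (simp add: negligible_iff_null_sets null_sets_completionI)

lemma norm_tangent:
  assumes "s \<in> {0<..<L} - J"
  shows "1 \<le> n \<Longrightarrow> norm (G n s *v axis 1 1) = 1" "norm (Glim s *v axis 1 1) = 1"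
proof -
  have "s \<notin> S n" using S_subset assms by blast
  then show "1 \<le> n \<Longrightarrow> norm (G n s *v axis 1 1) = 1"
    using rotation_G[of n s] assms by (simp add: rotation_matrix_def orthogonal_matrix_norm)
  show "norm (Glim s *v axis 1 1) = 1"
    using rotation_Glim[OF assms] by (simp add: rotation_matrix_def orthogonal_matrix_norm)
qed

lemma tangent_integrable:
  assumes n: "1 \<le> n" and ab: "0 \<le> a" "b \<le> L"
  shows "(\<lambda>s. G n s *v axis 1 1) integrable_on {a..b}"
proof -
  let ?D = "{a<..<b} - S n"
  have D: "?D \<in> sets lebesgue" by auto
  have "(\<lambda>s. G n s *v axis 1 1) integrable_on ?D"
  proof (rule measurable_bounded_by_integrable_imp_integrable)
    have "continuous_on ?D (\<lambda>s. G n s *v axis 1 1)"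
      using ab unfolding continuous_on_def
      by (auto intro!: tendsto_matrix_vector_mult isCont_G[OF n, unfolded isCont_def, THEN tendsto_within_subset])
    then show "(\<lambda>s. G n s *v axis 1 1) \<in> borel_measurable (lebesgue_on ?D)"
      using D by (rule continuous_imp_measurable_on_sets_lebesgue)
    show "(\<lambda>s. 1 :: real) integrable_on ?D"
      using finite_S[OF n] by (intro integrable_on_remove_negligible) (auto intro: negligible_finite)
    show "norm (G n s *v axis 1 1) \<le> 1" if "s \<in> ?D" for s
      using rotation_G[OF n, of s] that ab by (simp add: rotation_matrix_def orthogonal_matrix_norm)
  qed (rule D)
  then show ?thesis
    by (rule integrable_on_cong_negligible) (rule negligible_finite[OF finite_S[OF n]])
qed

lemma limit_tangent_integrable:
  assumes ab: "0 \<le> a" "b \<le> L"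
  shows "(\<lambda>s. Glim s *v axis 1 1) integrable_on {a..b}"
proof -
  let ?D = "{a<..<b} - J"
  have "(\<lambda>s. Glim s *v axis 1 1) integrable_on ?D"
  proof (rule dominated_convergence(1))
    \<comment> \<open>The sequence starts at 1, as nothing is assumed about
      \<open>G 0\<close>.\<close>
    show "(\<lambda>s. G (Suc n) s *v axis 1 1) integrable_on ?D" for n
      by (intro integrable_on_remove_negligible tangent_integrable negligible_J ab) simp
    show "(\<lambda>s. 1 :: real) integrable_on ?D"
      by (rule integrable_on_remove_negligible[OF integrable_const_ivl negligible_J])
    show "norm (G (Suc n) s *v axis 1 1) \<le> 1" if "s \<in> ?D" for n s
      using norm_tangent(1)[of s "Suc n"] that ab by simp
    show "(\<lambda>n. G (Suc n) s *v axis 1 1) \<longlonglongrightarrow> Glim s *v axis 1 1" if "s \<in> ?D" for s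
    proof -
      have "(\<lambda>n. G n s *v axis 1 1) \<longlonglongrightarrow> Glim s *v axis 1 1"
        using that ab by (intro tendsto_matrix_vector_mult G_tendsto) auto
      then show ?thesis by (rule LIMSEQ_Suc)
    qed
  qed
  then show ?thesis by (rule integrable_on_cong_negligible) (rule negligible_J)
qed

text \<open>Tangents are uniformly close off the negligible set \<open>J\<close>, and integration
  over an interval of length at most \<open>L\<close> costs the factor \<open>L\<close>.\<close>

lemma frame_curve_uniform_limit:
  "uniform_limit {0..L} (\<lambda>n. frame_curve (G n)) (frame_curve Glim) sequentially"
proof (rule uniform_limitI)
  fix e :: real assume "0 < e"
  have bound: "dist (frame_curve (G n) s) (frame_curve Glim s) \<le> 243 * omega_mass (J - S n) * L"
    if n: "1 \<le> n" and s: "s \<in> {0..L}" for n s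
  proof -
    have int: "(\<lambda>\<sigma>. G n \<sigma> *v axis 1 1) integrable_on {0..s}" "(\<lambda>\<sigma>. Glim \<sigma> *v axis 1 1) integrable_on {0..s}"
      using s by (auto intro!: tangent_integrable limit_tangent_integrable n)
    have "dist (frame_curve (G n) s) (frame_curve Glim s)
      = norm (integral {0..s} (\<lambda>\<sigma>. G n \<sigma> *v axis 1 1 - Glim \<sigma> *v axis 1 1))"
      using int by (simp add: frame_curve_def dist_norm integral_diff)
    also have "\<dots> \<le> 243 * omega_mass (J - S n) * (s - 0)"
    proof (rule norm_integral_le_ae)
      show "(\<lambda>\<sigma>. G n \<sigma> *v axis 1 1 - Glim \<sigma> *v axis 1 1) integrable_on {0..s}"
        by (intro integrable_diff int)
      show "negligible (insert 0 (insert L J))" by (simp add: negligible_J)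
      show "norm (G n \<sigma> *v axis 1 1 - Glim \<sigma> *v axis 1 1) \<le> 243 * omega_mass (J - S n)"
        if "\<sigma> \<in> {0..s} - insert 0 (insert L J)" for \<sigma>
      proof -
        have "\<sigma> \<in> {0<..<L} - J" using that s by auto
        then have "norm (G n \<sigma> - Glim \<sigma>) \<le> 243 * omega_mass (J - S n)" using n by (rule G_Glim_bound)
        then show ?thesis
          using norm_matrix_vector_mult_le[of "G n \<sigma> - Glim \<sigma>" "axis 1 1"]
          by (simp add: matrix_vector_mult_diff_rdistrib)
      qed
    qed (use s omega_mass_nonneg in auto)
    also have "\<dots> \<le> 243 * omega_mass (J - S n) * L"
      using s omega_mass_nonneg by (intro mult_left_mono) auto
    finally show ?thesis .
  qed
  have "(\<lambda>n. 243 * omega_mass (J - S n) * L) \<longlonglongrightarrow> 243 * 0 * L"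
    by (intro tendsto_intros omega_mass_tail)
  then have "eventually (\<lambda>n. 243 * omega_mass (J - S n) * L < e) sequentially"
    using \<open>0 < e\<close> by (intro order_tendstoD(2)) auto
  then show "eventually (\<lambda>n. \<forall>s\<in>{0..L}. dist (frame_curve (G n) s) (frame_curve Glim s) < e) sequentially"
    using eventually_ge_at_top[of 1]
  proof eventually_elim
    case (elim n)
    then show ?case using le_less_trans[OF bound[OF elim(2)] elim(1)] by blast
  qed
qed

end

section \<open>Polygonal curves inscribed in the limit curve\<close>

lemma not_negligible_Ioo:
  fixes a b :: real
  assumes "a < b" "negligible Z"
  shows "\<exists>x\<in>{a<..<b}. x \<notin> Z"
proof (rule ccontr)
  assume "\<not> ?thesis"
  then have "{a<..<b} \<subseteq> Z" by auto
  then have "negligible (box a b)" using negligible_subset[OF assms(2)] by (simp add: box_real)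
  then have "box a b = {}" by (simp only: negligible_interval)
  then show False using assms(1) by (simp add: box_real)
qed

lemma norm_cross_le: "norm (cross3 x y) \<le> norm x * norm y"
proof (rule power2_le_imp_le)
  show "(norm (cross3 x y))\<^sup>2 \<le> (norm x * norm y)\<^sup>2"
    using norm_cross_dot[of x y] by (metis le_add_same_cancel1 zero_le_power2)
qed simp

lemma bounded_linear_cross_right: "bounded_linear (cross3 x)"
  unfolding linear_conv_bounded_linear[symmetric]
  by (rule linearI) (simp_all add: cross_add_right cross_mult_right)

lemma bounded_linear_cross_left: "bounded_linear (\<lambda>x. cross3 x y)"
  unfolding linear_conv_bounded_linear[symmetric]
  by (rule linearI) (simp_all add: cross_add_left cross_mult_left)

lemma cross_diff_right: "cross3 x (y - z) = cross3 x y - cross3 x z"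
  by (rule linear_diff[OF bounded_linear.linear[OF bounded_linear_cross_right]])

text \<open>Write \<open>B q - A p\<close> as \<open>(B q - A q) + (A q - A p)\<close>: the first
  part sums to the lengths of single items, the second telescopes. This counts overlaps of
  neighbouring intervals, gaps included, without tracking indices.\<close>

lemma sum_list_consecutive_le:
  fixes A B :: "'a \<Rightarrow> real"
  assumes "sorted_wrt R zs"
    and "\<And>p q. p \<in> set zs \<Longrightarrow> q \<in> set zs \<Longrightarrow> R p q \<Longrightarrow> f p q \<le> B q - A p"
    and "zs \<noteq> []"
  shows "sum_list (map2 f zs (tl zs)) \<le> sum_list (map (\<lambda>x. B x - A x) (tl zs)) + (A (last zs) - A (hd zs))"
  using assms
proof (induction zs)
  case (Cons p zs)
  show ?case
  proof (cases zs)
    case (Cons q r)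
    have "sum_list (map2 f zs (tl zs)) \<le> sum_list (map (\<lambda>x. B x - A x) (tl zs)) + (A (last zs) - A (hd zs))"
      using Cons.prems \<open>zs = q # r\<close> by (intro Cons.IH) auto
    moreover have "f p q \<le> B q - A p"
      using Cons.prems \<open>zs = q # r\<close> by auto
    ultimately show ?thesis using \<open>zs = q # r\<close> by simp
  qed simp
qed simp

lemma sum_list_filter_le:
  fixes f :: "'a \<Rightarrow> real"
  assumes "\<And>x. x \<in> set xs \<Longrightarrow> 0 \<le> f x"
  shows "sum_list (map f (filter P xs)) \<le> sum_list (map f xs)"
  using assms by (induction xs) (auto intro: add_increasing)

lemma sum_list_tl_le:
  fixes f :: "'a \<Rightarrow> real"
  assumes "\<And>x. x \<in> set xs \<Longrightarrow> 0 \<le> f x"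
  shows "sum_list (map f (tl xs)) \<le> sum_list (map f xs)"
  using assms by (cases xs) auto

lemma set_zip_tlD:
  assumes "sorted_wrt R zs" "(p, q) \<in> set (zip zs (tl zs))"
  shows "p \<in> set zs" "q \<in> set (tl zs)" "R p q"
proof -
  show "p \<in> set zs" "q \<in> set (tl zs)"
    using assms(2) by (auto dest: set_zip_leftD set_zip_rightD)
  show "R p q"
    using assms
  proof (induction zs)
    case (Cons a zs)
    then show ?case by (cases zs) auto
  qed simp
qed

text \<open>An inequality rather than an equality, since edges of length zero are dropped and leave
  gaps between the parameter intervals.\<close>

definition precedes :: "real \<times> real \<Rightarrow> real \<times> real \<Rightarrow> bool" where
  "precedes p q \<longleftrightarrow> snd p \<le> fst q"

lemma partition_intervals:
  fixes ts :: "real list"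
  assumes "sorted_wrt (<) ts" "ts \<noteq> []"
  shows "sorted_wrt precedes (zip ts (tl ts))"
    and "\<And>p. p \<in> set (zip ts (tl ts)) \<Longrightarrow> hd ts \<le> fst p \<and> fst p < snd p \<and> snd p \<le> last ts"
    and "sum_list (map (\<lambda>p. (K (snd p) - K (fst p) :: real)) (zip ts (tl ts))) = K (last ts) - K (hd ts)"
  using assms
proof (atomize (full), induction ts)
  case (Cons a ts)
  show ?case
  proof (cases ts)
    case (Cons b r)
    have ab: "a < b" and s: "sorted_wrt (<) ts" "ts \<noteq> []" and br: "\<And>x. x \<in> set r \<Longrightarrow> b < x"
      using Cons.prems \<open>ts = b # r\<close> by auto
    note IH = Cons.IH[OF s]
    have z: "zip (a # ts) (tl (a # ts)) = (a, b) # zip ts (tl ts)" using \<open>ts = b # r\<close> by simp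
    have l: "b \<le> last ts" using \<open>ts = b # r\<close> br by (auto simp: less_imp_le)
    have *: "b \<le> fst p \<and> fst p < snd p \<and> snd p \<le> last ts" if "p \<in> set (zip ts (tl ts))" for p
      using IH that \<open>ts = b # r\<close> by (cases p) auto
    then have "\<forall>p\<in>set (zip ts (tl ts)). precedes (a, b) p" by (simp add: precedes_def)
    then have "sorted_wrt precedes ((a, b) # zip ts (tl ts))"
      using IH by simp
    moreover have "\<forall>p. p \<in> set ((a, b) # zip ts (tl ts)) \<longrightarrow> a \<le> fst p \<and> fst p < snd p \<and> snd p \<le> last ts"
    proof (intro allI impI)
      fix p assume "p \<in> set ((a, b) # zip ts (tl ts))"
      then consider "p = (a, b)" | "p \<in> set (zip ts (tl ts))" by auto
      then show "a \<le> fst p \<and> fst p < snd p \<and> snd p \<le> last ts"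
        using ab l *[of p] by cases auto
    qed
    moreover have "sum_list (map (\<lambda>p. K (snd p) - K (fst p)) ((a, b) # zip ts (tl ts))) = K (last ts) - K a"
      using IH \<open>ts = b # r\<close> by simp
    ultimately show ?thesis unfolding z using s(2) by simp
  qed simp
qed simp

text \<open>Consecutive pairs of edges share an edge and are not ordered by \<open>precedes\<close>.
  What remains true, even after vanishing binormals are dropped, is that both ends of the spanned
  interval advance.\<close>

lemma sorted_wrt_pairs:
  assumes "sorted_wrt precedes zs" "\<And>p. p \<in> set zs \<Longrightarrow> fst p < snd p"
  shows "sorted_wrt (\<lambda>x y. fst (fst x) \<le> fst (fst y) \<and> snd (snd x) \<le> snd (snd y)) (zip zs (tl zs))"
  using assms
proof (induction zs)
  case (Cons p zs)
  show ?case
  proof (cases zs)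
    case (Cons q r)
    have "fst p \<le> fst p' \<and> snd q \<le> snd q'" if "(p', q') \<in> set (zip zs (tl zs))" for p' q'
    proof -
      have "p' \<in> set zs" "q' \<in> set r"
        using that \<open>zs = q # r\<close> by (auto dest: set_zip_leftD set_zip_rightD)
      then have "snd p \<le> fst p'" "snd q \<le> fst q'" "fst p < snd p" "fst q' < snd q'"
        using Cons.prems \<open>zs = q # r\<close> by (auto simp: precedes_def)
      then show ?thesis by linarith
    qed
    moreover have "sorted_wrt (\<lambda>x y. fst (fst x) \<le> fst (fst y) \<and> snd (snd x) \<le> snd (snd y)) (zip zs (tl zs))"
      using Cons.prems by (intro Cons.IH) auto
    ultimately show ?thesis using \<open>zs = q # r\<close> by auto
  qed simp
qed simp

text \<open>The properties of the limit frame that the geometry uses. \<open>K\<close> stands for 27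
  times the distribution function of the mass, so \<open>3 = 81 / 27\<close> and
  \<open>6 = 162 / 27\<close>; on \<open>Z\<close> the frame is arbitrary.\<close>

locale limit_frame =
  fixes L :: real and Z :: "real set" and F :: "real \<Rightarrow> real^3^3" and K :: "real \<Rightarrow> real"
  assumes L: "0 < L" and Z: "negligible Z"
    and rotation: "\<And>s. s \<in> {0<..<L} - Z \<Longrightarrow> rotation_matrix (F s)"
    and K_mono: "\<And>x y. x \<le> y \<Longrightarrow> K x \<le> K y"
    and increment: "\<And>x y. x \<in> {0<..<L} - Z \<Longrightarrow> y \<in> {0<..<L} - Z \<Longrightarrow> x < y \<Longrightarrow> norm (F y - F x) \<le> K y - K x"
    and tangent: "\<And>x y x0. x \<in> {0<..<L} - Z \<Longrightarrow> y \<in> {0<..<L} - Z \<Longrightarrow> x0 \<in> {0<..<L} - Z \<Longrightarrow>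
      x < y \<Longrightarrow> x \<le> x0 \<Longrightarrow> x0 \<le> y \<Longrightarrow> 3 * (K y - K x) \<le> 1 / 2 \<Longrightarrow>
      F y *v axis 1 1 - F x *v axis 1 1 \<in> axis_cone (F x0 *v axis 2 1) (6 * (K y - K x))"
    and integrable: "\<And>a b. 0 \<le> a \<Longrightarrow> b \<le> L \<Longrightarrow> (\<lambda>s. F s *v axis 1 1) integrable_on {a..b}"
begin

abbreviation "D \<equiv> {0<..<L} - Z"
abbreviation "T s \<equiv> F s *v axis 1 1"
abbreviation "c \<equiv> frame_curve F"

section \<open>Cones containing the edges and the binormals\<close>

lemma edge_eq:
  assumes "0 \<le> a" "a \<le> b" "b \<le> L"
  shows "c b - c a = integral {a..b} T"
  using Henstock_Kurzweil_Integration.integral_combine[OF assms(1,2) integrable[of 0 b]] assms by (simp add: frame_curve_def algebra_simps)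

lemma norm_column: "s \<in> D \<Longrightarrow> norm (F s *v axis i 1) = 1"
  using rotation by (simp add: rotation_matrix_def orthogonal_matrix_norm)

lemma hull_bound:
  assumes "a \<le> b" "x \<in> D \<inter> {a..b}" "y \<in> D \<inter> {a..b}"
  shows "norm (F x *v axis i 1 - F y *v axis i 1) \<le> K b - K a"
proof -
  have "norm (F x - F y) \<le> K b - K a"
  proof (cases x y rule: linorder_cases)
    case less
    then show ?thesis
      using increment[of x y] K_mono[of a x] K_mono[of y b] assms by (simp add: norm_minus_commute)
  next
    case equal
    then show ?thesis using K_mono[OF assms(1)] by simp
  next
    case greater
    then show ?thesis
      using increment[of y x] K_mono[of a y] K_mono[of x b] assms by simp
  qed
  then show ?thesis
    using norm_matrix_vector_mult_le[of "F x - F y" "axis i 1"] by (simp add: matrix_vector_mult_diff_rdistrib)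
qed

text \<open>Every tangent on the larger interval \<open>{a..b}\<close> lies near
  \<open>T x0\<close>. Taking one interval that spans two edges puts both into the same
  cone.\<close>

lemma edge_cone:
  assumes ab: "0 \<le> a" "a \<le> p" "p < q" "q \<le> b" "b \<le> L" and x0: "x0 \<in> D \<inter> {a..b}"
    and small: "K b - K a \<le> 1 / 2"
  shows "c q - c p \<in> axis_cone (T x0) (2 * (K b - K a))"
proof -
  have "integral {p..q} T \<in> axis_cone (T x0) (2 * (K b - K a))"
  proof (rule cone_integral)
    show "T integrable_on {p..q}" using ab by (intro integrable) auto
    show "negligible (insert 0 (insert L Z))" using Z by simp
    fix s assume "s \<in> {p..q} - insert 0 (insert L Z)"
    then have "s \<in> D \<inter> {a..b}" using ab by auto
    then have "norm (T s - 1 *\<^sub>R T x0) \<le> (K b - K a) * 1"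
      using hull_bound[of a b s x0 1] x0 ab by simp
    then show "T s \<in> axis_cone (T x0) (2 * (K b - K a))"
      using norm_column[of x0 1] x0 small K_mono[of a b] ab by (intro cone_near[where m=1]) auto
  qed
  then show ?thesis using edge_eq[of p q] ab by simp
qed

text \<open>The cross product only sees the difference \<open>T y - T x\<close>, which is nearly
  \<open>m\<close> times the normal at \<open>x\<close> with nonnegative \<open>m\<close>, and
  tangent times normal is the binormal. Relative to \<open>m\<close>, the tangent cone contributes 6
  and the change of the binormal from \<open>x\<close> to \<open>x0\<close> contributes 1;
  \<open>cone_near\<close> doubles the total 7.\<close>

lemma tangent_cross_cone:
  assumes ab: "0 \<le> a" "a < b" "b \<le> L" and x: "x \<in> D \<inter> {a..b}" and y: "y \<in> D \<inter> {a..b}" and "x < y"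
    and x0: "x0 \<in> D \<inter> {a..b}" and small: "7 * (K b - K a) \<le> 1 / 2"
  shows "cross3 (T x) (T y) \<in> axis_cone (F x0 *v axis 3 1) (14 * (K b - K a))"
proof -
  let ?n = "F x *v axis 2 1" and ?b = "\<lambda>s. F s *v axis 3 1" and ?d = "K b - K a"
  have d0: "0 \<le> ?d" using K_mono[of a b] ab by simp
  have dxy: "K y - K x \<le> ?d" using K_mono[of a x] K_mono[of y b] x y by auto
  define v where "v = T y - T x"
  define m where "m = v \<bullet> ?n"
  have "v \<in> axis_cone ?n (6 * (K y - K x))"
    unfolding v_def using x y \<open>x < y\<close> dxy small d0 by (intro tangent) auto
  then have m0: "0 \<le> m" and e: "norm (v - m *\<^sub>R ?n) \<le> 6 * (K y - K x) * m"
    by (simp_all add: axis_cone_def m_def)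
  have b: "cross3 (T x) ?n = ?b x"
    using rotation[of x] x by (simp add: cross_rotation_matrix cross_basis)
  have "cross3 (T x) (T y) = cross3 (T x) v"
    by (simp add: v_def cross_diff_right)
  then have eq: "cross3 (T x) (T y) - m *\<^sub>R ?b x0 = cross3 (T x) (v - m *\<^sub>R ?n) + m *\<^sub>R (?b x - ?b x0)"
    by (simp add: cross_diff_right cross_mult_right b scaleR_diff_right)
  have "norm (cross3 (T x) (v - m *\<^sub>R ?n)) \<le> norm (v - m *\<^sub>R ?n)"
    using norm_cross_le[of "T x" "v - m *\<^sub>R ?n"] norm_column[of x 1] x by simp
  also have "\<dots> \<le> 6 * (K y - K x) * m" by (rule e)
  also have "\<dots> \<le> 6 * ?d * m" using dxy m0 by (intro mult_right_mono) auto
  finally have 1: "norm (cross3 (T x) (v - m *\<^sub>R ?n)) \<le> 6 * ?d * m" .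
  have "norm (m *\<^sub>R (?b x - ?b x0)) = m * norm (?b x - ?b x0)" using m0 by simp
  also have "\<dots> \<le> m * ?d"
    using hull_bound[of a b x x0 3] x x0 ab m0 by (intro mult_left_mono) auto
  finally have 2: "norm (m *\<^sub>R (?b x - ?b x0)) \<le> m * ?d" .
  have "norm (cross3 (T x) (T y) - m *\<^sub>R ?b x0) \<le> 6 * ?d * m + m * ?d"
    unfolding eq using norm_triangle_ineq[of "cross3 (T x) (v - m *\<^sub>R ?n)" "m *\<^sub>R (?b x - ?b x0)"] 1 2 by linarith
  also have "\<dots> = (7 * ?d) * m" by (simp add: algebra_simps)
  finally have "cross3 (T x) (T y) \<in> axis_cone (?b x0) (2 * (7 * ?d))"
    using norm_column[of x0 3] x0 m0 d0 small by (intro cone_near[where m=m]) auto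
  then show ?thesis by simp
qed

text \<open>By bilinearity the cross product of two edges is the double integral of
  \<open>cross3 (T x) (T y)\<close>. As the first edge lies before the second, \<open>x < y\<close>
  holds throughout, except possibly at \<open>x = q\<close>.\<close>

lemma binormal_cone:
  assumes ab: "0 \<le> a" "a \<le> p" "p < q" "q \<le> r" "r < s" "s \<le> b" "b \<le> L"
    and x0: "x0 \<in> D \<inter> {a..b}" and small: "7 * (K b - K a) \<le> 1 / 2"
  shows "cross3 (c q - c p) (c s - c r) \<in> axis_cone (F x0 *v axis 3 1) (14 * (K b - K a))"
proof -
  let ?C = "axis_cone (F x0 *v axis 3 1) (14 * (K b - K a))"
  have inner: "cross3 (T x) (c s - c r) \<in> ?C" if x: "x \<in> D \<inter> {a..b}" "x < q" for x
  proof -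
    have "integral {r..s} (cross3 (T x) \<circ> T) \<in> ?C"
    proof (rule cone_integral)
      show "(cross3 (T x) \<circ> T) integrable_on {r..s}"
        using ab by (intro integrable_linear integrable bounded_linear_cross_right) auto
      show "negligible (insert 0 (insert L Z))" using Z by simp
      fix y assume "y \<in> {r..s} - insert 0 (insert L Z)"
      then have "y \<in> D \<inter> {a..b}" "x < y" using ab x by auto
      then show "(cross3 (T x) \<circ> T) y \<in> ?C"
        unfolding o_def using ab x x0 small by (intro tangent_cross_cone) auto
    qed
    moreover have "integral {r..s} (cross3 (T x) \<circ> T) = cross3 (T x) (integral {r..s} T)"
      using ab by (intro integral_linear integrable bounded_linear_cross_right) auto
    ultimately show ?thesis using edge_eq[of r s] ab by simp
  qed
  have "integral {p..q} ((\<lambda>x. cross3 x (c s - c r)) \<circ> T) \<in> ?C"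
  proof (rule cone_integral)
    show "((\<lambda>x. cross3 x (c s - c r)) \<circ> T) integrable_on {p..q}"
      using ab by (intro integrable_linear integrable bounded_linear_cross_left) auto
    \<comment> \<open>The point \<open>q\<close> is discarded because \<open>x = q\<close> may meet
      \<open>y = r\<close>.\<close>
    show "negligible (insert 0 (insert q Z))" using Z by simp
    fix x assume "x \<in> {p..q} - insert 0 (insert q Z)"
    then have "x \<in> D \<inter> {a..b}" "x < q" using ab by auto
    then show "((\<lambda>x. cross3 x (c s - c r)) \<circ> T) x \<in> ?C" unfolding o_def by (rule inner)
  qed
  moreover have "integral {p..q} ((\<lambda>x. cross3 x (c s - c r)) \<circ> T) = cross3 (integral {p..q} T) (c s - c r)"
    using ab by (intro integral_linear[where h="\<lambda>x. cross3 x (c s - c r)"] integrable bounded_linear_cross_left) auto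
  ultimately show ?thesis using edge_eq[of p q] ab by simp
qed

lemma point_exists:
  assumes "0 \<le> a" "a < b" "b \<le> L"
  obtains x0 where "x0 \<in> D \<inter> {a..b}"
proof -
  obtain x where "x \<in> {a<..<b}" "x \<notin> Z" using not_negligible_Ioo[OF assms(2) Z] by blast
  then have "x \<in> D \<inter> {a..b}" using assms by auto
  then show thesis by (rule that)
qed

text \<open>The constant is \<open>8 * 2\<close> from \<open>cone_vec_angle_le\<close> and
  \<open>edge_cone\<close>. If the interval is too heavy for the cone, the bound exceeds 8 and hence
  \<open>pi\<close>.\<close>

lemma edge_angle:
  assumes ab: "0 \<le> p" "p < q" "q \<le> r" "r < s" "s \<le> L"
    and nz: "c q - c p \<noteq> 0" "c s - c r \<noteq> 0"
  shows "vec_angle (c q - c p) (c s - c r) \<le> 16 * (K s - K p)"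
proof (cases "K s - K p \<le> 1 / 2")
  case True
  obtain x0 where x0: "x0 \<in> D \<inter> {p..s}" using point_exists[of p s] ab by auto
  have "vec_angle (c q - c p) (c s - c r) \<le> 8 * (2 * (K s - K p))"
    using nz x0 ab True norm_column[of x0 1] K_mono[of p s]
    by (intro cone_vec_angle_le[where w="T x0"] edge_cone[of p _ _ s]) auto
  then show ?thesis by simp
next
  case False
  then have "8 \<le> 16 * (K s - K p)" by simp
  then show ?thesis using vec_angle_le_pi[of "c q - c p" "c s - c r"] pi_less_4 by linarith
qed

text \<open>Both binormals lie in one cone for the interval spanned by all four edges;
  \<open>112 = 8 * 14\<close>, and beyond the threshold the bound again exceeds 8.\<close>

lemma binormal_angle:
  assumes ab: "0 \<le> p" "p < q" "q \<le> r" "r < s" "p \<le> p'" "p' < q'" "q' \<le> r'" "r' < s'" "s \<le> s'" "s' \<le> L"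
    and nz: "cross3 (c q - c p) (c s - c r) \<noteq> 0" "cross3 (c q' - c p') (c s' - c r') \<noteq> 0"
  shows "line_angle (cross3 (c q - c p) (c s - c r)) (cross3 (c q' - c p') (c s' - c r')) \<le> 112 * (K s' - K p)"
    (is "line_angle ?x ?y \<le> _")
proof -
  have "vec_angle ?x ?y \<le> 112 * (K s' - K p)"
  proof (cases "7 * (K s' - K p) \<le> 1 / 2")
    case True
    obtain x0 where x0: "x0 \<in> D \<inter> {p..s'}" using point_exists[of p s'] ab by auto
    have "vec_angle ?x ?y \<le> 8 * (14 * (K s' - K p))"
      using nz x0 ab True norm_column[of x0 3] K_mono[of p s']
      by (intro cone_vec_angle_le[where w="F x0 *v axis 3 1"] binormal_cone[of p _ _ _ _ s']) auto
    then show ?thesis by simp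
  next
    case False
    then show ?thesis using vec_angle_le_pi[of ?x ?y] pi_less_4 by linarith
  qed
  then show ?thesis using line_angle_le_vec_angle[of ?x ?y] by linarith
qed

section \<open>Total curvature and total absolute torsion\<close>

definition edge :: "real \<times> real \<Rightarrow> real^3" where
  "edge p = c (snd p) - c (fst p)"

text \<open>Edges are kept as parameter intervals, since the estimates refer to \<open>K\<close> at
  their end points and the vectors alone have lost them.\<close>

definition edges :: "real list \<Rightarrow> (real \<times> real) list" where
  "edges ts = filter (\<lambda>p. edge p \<noteq> 0) (zip ts (tl ts))"

lemma poly_segments_eq: "poly_segments (map c ts) = map edge (edges ts)"
proof -
  have "map2 (\<lambda>v w. w - v) (map c ts) (tl (map c ts)) = map edge (zip ts (tl ts))"
    unfolding map_tl[symmetric] zip_map_map by (simp add: edge_def split_def)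
  then show ?thesis by (simp add: poly_segments_def edges_def filter_map o_def)
qed

lemma edges_properties:
  assumes "ts \<in> partitions L"
  shows "sorted_wrt precedes (edges ts)"
    and "\<And>p. p \<in> set (edges ts) \<Longrightarrow> 0 \<le> fst p \<and> fst p < snd p \<and> snd p \<le> L \<and> edge p \<noteq> 0"
    and "sum_list (map (\<lambda>p. K (snd p) - K (fst p)) (edges ts)) \<le> K L - K 0"
proof -
  have ts: "sorted_wrt (<) ts" "ts \<noteq> []" "hd ts = 0" "last ts = L" using assms by (auto simp: partitions_def)
  note pi = partition_intervals[OF ts(1,2)]
  show "sorted_wrt precedes (edges ts)"
    unfolding edges_def using pi(1) by (rule sorted_wrt_filter)
  show "0 \<le> fst p \<and> fst p < snd p \<and> snd p \<le> L \<and> edge p \<noteq> 0" if "p \<in> set (edges ts)" for p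
    using pi(2)[of p] that ts by (auto simp: edges_def)
  have "sum_list (map (\<lambda>p. K (snd p) - K (fst p)) (edges ts))
    \<le> sum_list (map (\<lambda>p. K (snd p) - K (fst p)) (zip ts (tl ts)))"
    unfolding edges_def using pi(2) by (intro sum_list_filter_le) (simp add: K_mono less_imp_le)
  then show "sum_list (map (\<lambda>p. K (snd p) - K (fst p)) (edges ts)) \<le> K L - K 0"
    using pi(3)[of K] ts by simp
qed

text \<open>Each turning angle is charged to the interval spanned by two edges. Single lengths and
  the telescoping part contribute \<open>16 * (K L - K 0)\<close> each.\<close>

lemma poly_rotation_bound:
  assumes ts: "ts \<in> partitions L"
  shows "poly_rotation (map c ts) \<le> 32 * (K L - K 0)"
proof (cases "edges ts = []")
  case True
  then show ?thesis using K_mono[of 0 L] L by (simp add: poly_rotation_def poly_segments_eq)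
next
  case False
  note ep = edges_properties[OF ts]
  let ?zs = "edges ts"
  have in0: "0 \<le> fst p \<and> fst p \<le> L" if "p \<in> set ?zs" for p using ep(2)[OF that] by auto
  have "poly_rotation (map c ts) = sum_list (map2 (\<lambda>p q. vec_angle (edge p) (edge q)) ?zs (tl ?zs))"
    unfolding poly_rotation_def Let_def poly_segments_eq map_tl[symmetric] zip_map_map by (simp add: split_def o_def)
  also have "\<dots> \<le> sum_list (map (\<lambda>x. 16 * K (snd x) - 16 * K (fst x)) (tl ?zs))
      + (16 * K (fst (last ?zs)) - 16 * K (fst (hd ?zs)))"
  proof (rule sum_list_consecutive_le[OF ep(1) _ False])
    fix p q assume "p \<in> set ?zs" "q \<in> set ?zs" "precedes p q"
    then show "vec_angle (edge p) (edge q) \<le> 16 * K (snd q) - 16 * K (fst p)"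
      using ep(2)[of p] ep(2)[of q] edge_angle[of "fst p" "snd p" "fst q" "snd q"]
      by (simp add: edge_def precedes_def)
  qed
  also have "sum_list (map (\<lambda>x. 16 * K (snd x) - 16 * K (fst x)) (tl ?zs))
      \<le> sum_list (map (\<lambda>x. 16 * K (snd x) - 16 * K (fst x)) ?zs)"
    using ep(2) by (intro sum_list_tl_le) (simp add: K_mono less_imp_le)
  also have "sum_list (map (\<lambda>x. 16 * K (snd x) - 16 * K (fst x)) ?zs)
      = 16 * sum_list (map (\<lambda>x. K (snd x) - K (fst x)) ?zs)"
    by (simp add: right_diff_distrib flip: sum_list_const_mult)
  also have "\<dots> \<le> 16 * (K L - K 0)" using ep(3) by simp
  also have "16 * K (fst (last ?zs)) - 16 * K (fst (hd ?zs)) \<le> 16 * (K L - K 0)"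
    using K_mono[of "fst (last ?zs)" L] K_mono[of 0 "fst (hd ?zs)"]
      in0[OF last_in_set[OF False]] in0[OF hd_in_set[OF False]] by simp
  finally show ?thesis by simp
qed

definition binormal :: "(real \<times> real) \<times> (real \<times> real) \<Rightarrow> real^3" where
  "binormal x = cross3 (edge (fst x)) (edge (snd x))"

text \<open>\<open>sum_list_consecutive_le\<close> is used twice: for consecutive binormals, where
  telescoping also covers dropped ones, and for the two edges of each binormal. Both uses add at
  most \<open>112 * (K L - K 0)\<close> to the sum over single edges, whence
  \<open>336 = 3 * 112\<close>.\<close>

lemma poly_TAT_bound:
  assumes ts: "ts \<in> partitions L"
  shows "poly_TAT (map c ts) \<le> 336 * (K L - K 0)"
proof -
  note ep = edges_properties[OF ts]
  let ?zs = "edges ts"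
  let ?ps = "zip ?zs (tl ?zs)"
  define ys where "ys = filter (\<lambda>x. binormal x \<noteq> 0) ?ps"
  have KL: "0 \<le> K L - K 0" using K_mono[of 0 L] L by simp
  have bin: "poly_binormals (map c ts) = map binormal ys"
    unfolding poly_binormals_def Let_def poly_segments_eq map_tl[symmetric] zip_map_map
    by (simp add: ys_def binormal_def[abs_def] filter_map o_def split_def)
  have tat: "poly_TAT (map c ts) = sum_list (map2 (\<lambda>x y. line_angle (binormal x) (binormal y)) ys (tl ys))"
    unfolding poly_TAT_def Let_def bin map_tl[symmetric] zip_map_map by (simp add: split_def o_def)
  show ?thesis
  proof (cases "ys = []")
    case True
    then show ?thesis using KL tat by simp
  next
    case False
    then have zs: "?zs \<noteq> []" by (auto simp: ys_def)
    have sorted: "sorted_wrt (\<lambda>x y. fst (fst x) \<le> fst (fst y) \<and> snd (snd x) \<le> snd (snd y)) ys"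
      unfolding ys_def using ep(1,2) by (intro sorted_wrt_filter sorted_wrt_pairs) auto
    have ys: "0 \<le> fst (fst x) \<and> fst (fst x) < snd (fst x) \<and> snd (fst x) \<le> fst (snd x)
        \<and> fst (snd x) < snd (snd x) \<and> snd (snd x) \<le> L" if "x \<in> set ?ps" for x
    proof -
      have "(fst x, snd x) \<in> set ?ps" using that by simp
      note z = set_zip_tlD[OF ep(1) this]
      have "snd x \<in> set ?zs" using z(2) by (cases ?zs) auto
      then show ?thesis using ep(2)[OF z(1)] ep(2)[of "snd x"] z(3) by (simp add: precedes_def)
    qed
    have ysub: "x \<in> set ?ps \<and> binormal x \<noteq> 0" if "x \<in> set ys" for x
      using that by (auto simp: ys_def)
    let ?len = "\<lambda>x :: (real \<times> real) \<times> (real \<times> real). 112 * K (snd (snd x)) - 112 * K (fst (fst x))"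
    have "poly_TAT (map c ts) \<le> sum_list (map ?len (tl ys))
      + (112 * K (fst (fst (last ys))) - 112 * K (fst (fst (hd ys))))"
      unfolding tat
    proof (rule sum_list_consecutive_le[OF sorted _ False])
      fix x y assume xy: "x \<in> set ys" "y \<in> set ys" "fst (fst x) \<le> fst (fst y) \<and> snd (snd x) \<le> snd (snd y)"
      have "line_angle (binormal x) (binormal y) \<le> 112 * (K (snd (snd y)) - K (fst (fst x)))"
        unfolding binormal_def edge_def
        by (rule binormal_angle)
          (use ys[of x] ys[of y] ysub[OF xy(1)] ysub[OF xy(2)] xy(3) in \<open>auto simp: binormal_def edge_def\<close>)
      then show "line_angle (binormal x) (binormal y) \<le> 112 * K (snd (snd y)) - 112 * K (fst (fst x))"
        by simp
    qed
    also have "sum_list (map ?len (tl ys)) \<le> sum_list (map ?len ys)"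
    proof (rule sum_list_tl_le)
      fix x assume "x \<in> set ys"
      then show "0 \<le> ?len x" using ys[of x] ysub[of x] K_mono[of "fst (fst x)" "snd (snd x)"] by linarith
    qed
    \<comment> \<open>Dropped binormals are put back: their lengths are nonnegative, and the full
      list of pairs allows the second use of the counting lemma.\<close>
    also have "sum_list (map ?len ys) \<le> sum_list (map ?len ?ps)"
      unfolding ys_def
    proof (rule sum_list_filter_le)
      fix x assume "x \<in> set ?ps"
      then show "0 \<le> ?len x" using ys[of x] K_mono[of "fst (fst x)" "snd (snd x)"] by linarith
    qed
    also have "sum_list (map ?len ?ps) = sum_list (map2 (\<lambda>p q. 112 * K (snd q) - 112 * K (fst p)) ?zs (tl ?zs))"
      by (simp add: split_def)
    also have "\<dots> \<le> sum_list (map (\<lambda>x. 112 * K (snd x) - 112 * K (fst x)) (tl ?zs))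
      + (112 * K (fst (last ?zs)) - 112 * K (fst (hd ?zs)))"
      by (rule sum_list_consecutive_le[OF ep(1) _ zs]) simp
    also have "sum_list (map (\<lambda>x. 112 * K (snd x) - 112 * K (fst x)) (tl ?zs))
        \<le> sum_list (map (\<lambda>x. 112 * K (snd x) - 112 * K (fst x)) ?zs)"
      using ep(2) by (intro sum_list_tl_le) (simp add: K_mono less_imp_le)
    also have "sum_list (map (\<lambda>x. 112 * K (snd x) - 112 * K (fst x)) ?zs)
        = 112 * sum_list (map (\<lambda>x. K (snd x) - K (fst x)) ?zs)"
      by (simp add: right_diff_distrib flip: sum_list_const_mult)
    also have "\<dots> \<le> 112 * (K L - K 0)" using ep(3) by simp
    also have "112 * K (fst (last ?zs)) - 112 * K (fst (hd ?zs)) \<le> 112 * (K L - K 0)"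
      using K_mono[of "fst (last ?zs)" L] K_mono[of 0 "fst (hd ?zs)"]
        ep(2)[OF last_in_set[OF zs]] ep(2)[OF hd_in_set[OF zs]] by simp
    also have "112 * K (fst (fst (last ys))) - 112 * K (fst (fst (hd ys))) \<le> 112 * (K L - K 0)"
    proof -
      have "fst (fst (last ys)) \<le> L" "0 \<le> fst (fst (hd ys))"
        using ys[of "last ys"] ys[of "hd ys"] ysub[OF last_in_set[OF False]] ysub[OF hd_in_set[OF False]] by auto
      then show ?thesis using K_mono[of "fst (fst (last ys))" L] K_mono[of 0 "fst (fst (hd ys))"] by simp
    qed
    finally show ?thesis by simp
  qed
qed

lemma TC_finite: "TC L c < \<infinity>"
proof -
  have "TC L c \<le> ennreal (32 * (K L - K 0))"
    unfolding TC_def by (intro SUP_least ennreal_leI poly_rotation_bound)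
  then show ?thesis by (rule le_less_trans) simp
qed

text \<open>A smaller bound on the modulus admits fewer partitions, so the supremum is monotone and
  its limit at 0 exists; otherwise \<open>Lim\<close> would carry no information.\<close>

lemma TAT_finite: "TAT L c < \<infinity>"
proof -
  let ?F = "\<lambda>\<epsilon>. SUP ts \<in> {ts \<in> partitions L. modulus c ts < \<epsilon>}. ennreal (poly_TAT (map c ts))"
  have "(?F \<longlongrightarrow> Inf (?F ` ({0<..} \<inter> UNIV))) (at 0 within ({0<..} \<inter> UNIV))"
  proof (rule Lim_right_bound[where K=0])
    fix a b :: real assume "a \<le> b"
    then show "?F a \<le> ?F b" by (intro SUP_subset_mono) auto
  qed simp
  then have lim: "(?F \<longlongrightarrow> TAT L c) (at_right 0)"
    unfolding TAT_def by (simp add: tendsto_Lim)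
  have "?F \<epsilon> \<le> ennreal (336 * (K L - K 0))" for \<epsilon>
    by (intro SUP_least ennreal_leI poly_TAT_bound) simp
  then have "TAT L c \<le> ennreal (336 * (K L - K 0))"
    by (intro tendsto_upperbound[OF lim]) auto
  then show ?thesis by (rule le_less_trans) simp
qed

section \<open>Length of the limit curve\<close>

lemma curve_lipschitz:
  assumes "0 \<le> x" "x \<le> y" "y \<le> L"
  shows "dist (c x) (c y) \<le> y - x"
proof -
  have "norm (integral {x..y} T) \<le> 1 * (y - x)"
  proof (rule norm_integral_le_ae)
    show "T integrable_on {x..y}" using assms by (intro integrable)
    show "negligible (insert 0 (insert L Z))" using Z by simp
    show "norm (T s) \<le> 1" if "s \<in> {x..y} - insert 0 (insert L Z)" for s
      using norm_column[of s 1] that assms by auto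
  qed (use assms in auto)
  then show ?thesis using edge_eq[OF assms] by (simp add: dist_norm norm_minus_commute[of "c x"])
qed

text \<open>The tangent stays within \<open>K b - K a\<close> of the fixed unit vector
  \<open>T x0\<close>, so the chord loses at most this fraction of the parameter length.\<close>

lemma curve_lower_bound:
  assumes "0 \<le> a" "a < b" "b \<le> L"
  shows "(b - a) - (b - a) * (K b - K a) \<le> dist (c a) (c b)"
proof -
  obtain x0 where x0: "x0 \<in> D \<inter> {a..b}" using point_exists[OF assms] .
  have int: "T integrable_on {a..b}" "(\<lambda>s. T x0) integrable_on {a..b}"
    using assms by (auto intro!: integrable)
  have "norm (integral {a..b} (\<lambda>s. T s - T x0)) \<le> (K b - K a) * (b - a)"
  proof (rule norm_integral_le_ae)
    show "(\<lambda>s. T s - T x0) integrable_on {a..b}" by (intro integrable_diff int)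
    show "negligible (insert 0 (insert L Z))" using Z by simp
    show "norm (T s - T x0) \<le> K b - K a" if "s \<in> {a..b} - insert 0 (insert L Z)" for s
      using that assms x0 by (intro hull_bound) auto
  qed (use assms K_mono[of a b] in auto)
  also have "integral {a..b} (\<lambda>s. T s - T x0) = (c b - c a) - (b - a) *\<^sub>R T x0"
    using edge_eq[of a b] assms int by (simp add: integral_diff)
  finally have "norm ((c b - c a) - (b - a) *\<^sub>R T x0) \<le> (K b - K a) * (b - a)" .
  moreover have "norm ((b - a) *\<^sub>R T x0) = b - a" using norm_column[of x0 1] x0 assms by simp
  moreover have "norm ((b - a) *\<^sub>R T x0) \<le> norm (c b - c a) + norm ((c b - c a) - (b - a) *\<^sub>R T x0)"
    using norm_triangle_sub[of "(b - a) *\<^sub>R T x0" "c b - c a"]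
    by (simp add: norm_minus_commute[of "(b - a) *\<^sub>R T x0"])
  ultimately show ?thesis by (simp add: dist_norm norm_minus_commute mult.commute)
qed

text \<open>The Lipschitz constant 1 gives the upper bound. For \<open>n + 1\<close> equal pieces
  the losses of the chords telescope to \<open>L / (n + 1)\<close> times \<open>K L - K 0\<close>,
  which tends to 0.\<close>

lemma curve_length: "variation {0..L} c = ennreal L"
proof (rule antisym)
  show "variation {0..L} c \<le> ennreal L"
    using variation_le_control[of 0 L c "\<lambda>x. x"] L curve_lipschitz by simp
  have *: "ennreal (L - L / real (Suc n) * (K L - K 0)) \<le> variation {0..L} c" for n
  proof -
    define x where "x i = real i * (L / real (Suc n))" for i
    let ?ts = "map x [0..<Suc (Suc n)]"
    have xmono: "x i \<le> x j" if "i \<le> j" for i j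
      unfolding x_def using that L by (intro mult_right_mono) auto
    have xL: "x (Suc n) = L" "x 0 = 0" by (simp_all add: x_def)
    have step: "x (Suc i) - x i = L / real (Suc n)" for i
      by (simp only: x_def left_diff_distrib[symmetric]) simp
    have h: "0 < L / real (Suc n)" using L by simp
    have "sorted ?ts" by (auto simp: sorted_iff_nth_mono intro!: xmono simp del: upt_Suc)
    moreover have "set ?ts \<subseteq> {0..L}"
      using xmono[of 0] xmono[of _ "Suc n"] xL by (auto simp del: upt_Suc)
    ultimately have "(\<Sum>i<length ?ts - 1. ennreal (dist (c (?ts ! i)) (c (?ts ! Suc i)))) \<le> variation {0..L} c"
      unfolding variation_def by (intro SUP_upper) (auto simp del: upt_Suc)
    moreover have "(\<Sum>i<length ?ts - 1. ennreal (dist (c (?ts ! i)) (c (?ts ! Suc i))))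
      = ennreal (\<Sum>i<Suc n. dist (c (x i)) (c (x (Suc i))))"
      by (subst sum_ennreal[symmetric]) (auto simp del: upt_Suc intro!: sum.cong)
    moreover have "L - L / real (Suc n) * (K L - K 0) \<le> (\<Sum>i<Suc n. dist (c (x i)) (c (x (Suc i))))"
    proof -
      have "(\<Sum>i<Suc n. L / real (Suc n) - L / real (Suc n) * (K (x (Suc i)) - K (x i)))
        \<le> (\<Sum>i<Suc n. dist (c (x i)) (c (x (Suc i))))"
      proof (rule sum_mono)
        fix i assume "i \<in> {..<Suc n}"
        then have "0 \<le> x i" "x i < x (Suc i)" "x (Suc i) \<le> L"
          using xmono[of 0 i] xmono[of "Suc i" "Suc n"] xL step[of i] h by auto
        from curve_lower_bound[OF this]
        show "L / real (Suc n) - L / real (Suc n) * (K (x (Suc i)) - K (x i)) \<le> dist (c (x i)) (c (x (Suc i)))"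
          by (simp only: step)
      qed
      also have "(\<Sum>i<Suc n. L / real (Suc n) - L / real (Suc n) * (K (x (Suc i)) - K (x i)))
        = real (Suc n) * (L / real (Suc n)) - L / real (Suc n) * (\<Sum>i<Suc n. K (x (Suc i)) - K (x i))"
        unfolding sum_subtractf sum_distrib_left[symmetric] sum_constant card_lessThan by (rule refl)
      also have "(\<Sum>i<Suc n. K (x (Suc i)) - K (x i)) = K L - K 0"
        using sum_lessThan_telescope[of "\<lambda>i. K (x i)" "Suc n"] by (simp only: xL)
      finally show ?thesis by simp
    qed
    ultimately show ?thesis using ennreal_leI order_trans by metis
  qed
  have "(\<lambda>n. L - L * inverse (real (Suc n)) * (K L - K 0)) \<longlonglongrightarrow> L - L * 0 * (K L - K 0)"
    by (intro tendsto_intros LIMSEQ_inverse_real_of_nat)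
  then have "(\<lambda>n. ennreal (L - L / real (Suc n) * (K L - K 0))) \<longlonglongrightarrow> ennreal L"
    by (intro tendsto_ennrealI) (simp add: divide_inverse)
  then show "ennreal L \<le> variation {0..L} c"
    by (rule tendsto_upperbound) (use * in auto)
qed

lemma curve_continuous: "continuous_on {0..L} c"
proof -
  have "dist (c x) (c y) \<le> 1 * dist x y" if "x \<in> {0..L}" "y \<in> {0..L}" for x y
    using curve_lipschitz[of x y] curve_lipschitz[of y x] that
    by (cases "x \<le> y") (auto simp: dist_real_def dist_commute)
  then show ?thesis
    by (intro lipschitz_on_continuous_on[where L=1] lipschitz_onI) auto
qed

end

theorem proposition4p5:
  fixes L :: real and \<theta> \<phi> :: "real \<Rightarrow> real" and G :: "nat \<Rightarrow> real \<Rightarrow> real^3^3"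
  assumes "L > 0"
    and "BV L \<theta>" and "BV L \<phi>"
    and "strict_mono_on {0<..<L} \<theta>"
    and "\<And>s. s \<in> jump_set L (Omega \<theta> \<phi>) \<Longrightarrow> 0 < jump_angle \<theta> \<phi> s \<and> jump_angle \<theta> \<phi> s < pi"
    and "\<And>n. n \<ge> 1 \<Longrightarrow> approx_frame L \<theta> \<phi> n (G n)"
  shows "\<exists>c :: real \<Rightarrow> real^3.
           uniform_limit {0..L} (\<lambda>n. frame_curve (G n)) c sequentially \<and>
           continuous_on {0..L} c \<and>
           variation {0..L} c = ennreal L \<and>
           TC L c < \<infinity> \<and>
           TAT L c < \<infinity>"
proof -
  interpret A: approx_frames L \<theta> \<phi> G
  proof
    show "\<theta> x \<le> \<theta> y" if "0 < x" "x \<le> y" "y < L" for x y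
      using strict_mono_onD[OF assms(4), of x y] that by (cases "x = y") auto
  qed (use assms in auto)
  have Ioc: "A.omega_mass {..y} - A.omega_mass {..x} = A.omega_mass {x<..y}" if "x \<le> y" for x y
  proof -
    have "{..y} = {..x} \<union> {x<..y}" using that by auto
    moreover have "A.omega_mass ({..x} \<union> {x<..y}) = A.omega_mass {..x} + A.omega_mass {x<..y}"
      by (rule additive_contentD[OF A.additive_omega_mass]) auto
    ultimately show ?thesis by simp
  qed
  interpret B: limit_frame L A.J A.Glim "\<lambda>s. 27 * A.omega_mass {..s}"
  proof
    show "27 * A.omega_mass {..x} \<le> 27 * A.omega_mass {..y}" if "x \<le> y" for x y
      using that by (intro mult_left_mono A.omega_mass_mono) auto
    show "norm (A.Glim y - A.Glim x) \<le> 27 * A.omega_mass {..y} - 27 * A.omega_mass {..x}"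
      if "x \<in> {0<..<L} - A.J" "y \<in> {0<..<L} - A.J" "x < y" for x y
      using A.Glim_bound[OF that] Ioc[of x y] that by simp
    show "A.Glim y *v axis 1 1 - A.Glim x *v axis 1 1
        \<in> axis_cone (A.Glim x0 *v axis 2 1) (6 * (27 * A.omega_mass {..y} - 27 * A.omega_mass {..x}))"
      if "x \<in> {0<..<L} - A.J" "y \<in> {0<..<L} - A.J" "x0 \<in> {0<..<L} - A.J" "x < y" "x \<le> x0" "x0 \<le> y"
        "3 * (27 * A.omega_mass {..y} - 27 * A.omega_mass {..x}) \<le> 1 / 2" for x y x0
    proof -
      have N: "A.omega_mass {..y} = A.omega_mass {..x} + A.omega_mass {x<..y}" using Ioc[of x y] that by simp
      show ?thesis
        using A.Glim_tangent_cone[OF that(1,2,4,3,5,6)] that(7) unfolding N by simp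
    qed
  qed (use assms A.negligible_J A.rotation_Glim A.limit_tangent_integrable in auto)
  show ?thesis
    using A.frame_curve_uniform_limit B.curve_continuous B.curve_length B.TC_finite B.TAT_finite by blast
qed

end
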